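(* Let $\lambda$ be a tempered distribution on $\mathbb{R}^d$ whose Fourier transform is a locally integrable function satisfying $|\widehat{\lambda}(\xi)|\le C|\xi|^{-\alpha}$ for some $\alpha\in[0,\frac d2)$. Let $\mu$ be a compactly supported Borel measure on $\mathbb{R}^d$ satisfying the growth condition with exponent $s_\mu$, and let $\nu$ be another compactly supported Borel measure on $\mathbb{R}^d$ satisfying the growth condition with exponent $s_\nu$. Let $T_{\lambda^\epsilon}f(x)=\int\lambda^\epsilon(x-y)f(y)\,d\mu(y)$, and let $s=\frac{s_\mu+s_\nu}{2}$. (i) Suppose that $\alpha>d-s$. Then $$\|T_{\lambda^\epsilon}f\|_{L^2(\nu)}\le C\|f\|_{L^2(\mu)}$$ with constant $C$ independent of $\epsilon$. (ii) If $\alpha\le d-s$, then $T_{\lambda^\epsilon}$ does not in general map $L^2(\mu)$ to $L^2(\nu)$ with constants independent of $\epsilon>0$.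
   Context: A compactly supported Borel measure $\mu$ on $\mathbb{R}^d$ satisfies the growth condition with exponent $s_\mu$, where $0<s_\mu\le d$, if there is a constant $C$ with $\mu(B(x,r))\le Cr^{s_\mu}$ for every $x\in\operatorname{supp}(\mu)$ and every $r\in[0,\operatorname{diam}(\operatorname{supp}(\mu))]$. Here $\rho\in C_0^\infty(\mathbb{R}^d)$ with $\int\rho(x)\,dx=1$, $\rho_\epsilon(x)=\epsilon^{-d}\rho(x/\epsilon)$ for $\epsilon>0$, and $\lambda^\epsilon=\lambda*\rho_\epsilon$, which is a $C^\infty(\mathbb{R}^d)$ function.
   Formalization: Part (ii) is proved for every choice of parameters with α ≤ d−s except α = 0, s = d; there μ and ν have bounded densities and the Fourier transform of λ is bounded, so Plancherel gives a uniform bound and the claim fails. *)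

theory Defs
  imports "HOL-Analysis.Analysis"
begin

text \<open>
  Multi-indices are encoded as lists of standard basis vectors: \<open>pderivs [b\<^sub>1, \<dots>, b\<^sub>k] f\<close> is
  the iterated partial derivative of \<open>f\<close> in the coordinate directions \<open>b\<^sub>k, \<dots>, b\<^sub>1\<close>.
\<close>

primrec pderivs :: "'a::euclidean_space list \<Rightarrow> ('a \<Rightarrow> complex) \<Rightarrow> 'a \<Rightarrow> complex" where
  "pderivs [] f = f"
| "pderivs (b # bs) f = (\<lambda>x. frechet_derivative (pderivs bs f) (at x) b)"

definition smooth :: "('a::euclidean_space \<Rightarrow> complex) \<Rightarrow> bool" where
  "smooth f \<longleftrightarrow> (\<forall>bs \<in> lists Basis. \<forall>x. pderivs bs f differentiable (at x))"

definition test_function :: "('a::euclidean_space \<Rightarrow> complex) \<Rightarrow> bool" where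
  "test_function f \<longleftrightarrow> smooth f \<and> compact (closure {x. f x \<noteq> 0})"

definition schwartz :: "('a::euclidean_space \<Rightarrow> complex) set" where
  "schwartz = {f. smooth f \<and>
     (\<forall>k::nat. \<forall>bs \<in> lists Basis. bdd_above (range (\<lambda>x. norm x ^ k * norm (pderivs bs f x))))}"

definition schwartz_seminorm ::
    "nat \<Rightarrow> 'a::euclidean_space list \<Rightarrow> ('a \<Rightarrow> complex) \<Rightarrow> real" where
  "schwartz_seminorm k bs f = (SUP x. norm x ^ k * norm (pderivs bs f x))"

definition schwartz_tendsto ::
    "(nat \<Rightarrow> 'a::euclidean_space \<Rightarrow> complex) \<Rightarrow> ('a \<Rightarrow> complex) \<Rightarrow> bool" where
  "schwartz_tendsto \<phi> \<psi> \<longleftrightarrow>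
     (\<forall>k. \<forall>bs \<in> lists Basis. (\<lambda>n. schwartz_seminorm k bs (\<lambda>x. \<phi> n x - \<psi> x)) \<longlonglongrightarrow> 0)"

text \<open>
  Continuous linear functionals on the Schwartz space. The Schwartz space is metrizable, so
  continuity is sequential continuity. Values outside \<open>schwartz\<close> are irrelevant.
\<close>

definition tempered_distribution ::
    "(('a::euclidean_space \<Rightarrow> complex) \<Rightarrow> complex) \<Rightarrow> bool" where
  "tempered_distribution \<Lambda> \<longleftrightarrow>
     (\<forall>\<phi> \<in> schwartz. \<forall>\<psi> \<in> schwartz. \<Lambda> (\<lambda>x. \<phi> x + \<psi> x) = \<Lambda> \<phi> + \<Lambda> \<psi>) \<and>
     (\<forall>c. \<forall>\<phi> \<in> schwartz. \<Lambda> (\<lambda>x. c * \<phi> x) = c * \<Lambda> \<phi>) \<and>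
     (\<forall>\<phi> \<psi>. (\<forall>n. \<phi> n \<in> schwartz) \<longrightarrow> \<psi> \<in> schwartz \<longrightarrow> schwartz_tendsto \<phi> \<psi> \<longrightarrow>
        (\<lambda>n. \<Lambda> (\<phi> n)) \<longlonglongrightarrow> \<Lambda> \<psi>)"

definition fourier :: "('a::euclidean_space \<Rightarrow> complex) \<Rightarrow> 'a \<Rightarrow> complex" where
  "fourier \<phi> \<xi> = (LINT x|lborel. cis (- 2 * pi * (x \<bullet> \<xi>)) * \<phi> x)"

definition fourier_distr ::
    "(('a::euclidean_space \<Rightarrow> complex) \<Rightarrow> complex) \<Rightarrow> ('a \<Rightarrow> complex) \<Rightarrow> complex" where
  "fourier_distr \<Lambda> \<phi> = \<Lambda> (fourier \<phi>)"

definition locally_integrable :: "('a::euclidean_space \<Rightarrow> complex) \<Rightarrow> bool" where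
  "locally_integrable h \<longleftrightarrow> (\<forall>K. compact K \<longrightarrow> set_integrable lborel K h)"

definition represented_by ::
    "(('a::euclidean_space \<Rightarrow> complex) \<Rightarrow> complex) \<Rightarrow> ('a \<Rightarrow> complex) \<Rightarrow> bool" where
  "represented_by \<Lambda> h \<longleftrightarrow>
     (\<forall>\<phi> \<in> schwartz. has_bochner_integral lborel (\<lambda>x. h x * \<phi> x) (\<Lambda> \<phi>))"

text \<open>
  For \<open>\<alpha> < d\<close> the pointwise bound makes every product \<open>h \<phi>\<close> with \<open>\<phi>\<close> Schwartz integrable, so
  it makes no difference whether \<open>h\<close> is tested against Schwartz functions or only against
  test functions. As \<open>h\<close> is determined up to null sets, the bound is required almost everywhere.
\<close>

definition fourier_decay ::
    "(('a::euclidean_space \<Rightarrow> complex) \<Rightarrow> complex) \<Rightarrow> real \<Rightarrow> bool" where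
  "fourier_decay \<Lambda> \<alpha> \<longleftrightarrow>
     (\<exists>h. locally_integrable h \<and> represented_by (fourier_distr \<Lambda>) h \<and>
        (\<exists>C. AE \<xi> in lborel. norm (h \<xi>) \<le> C * norm \<xi> powr (- \<alpha>)))"

definition mollifier :: "('a::euclidean_space \<Rightarrow> complex) \<Rightarrow> real \<Rightarrow> 'a \<Rightarrow> complex" where
  "mollifier \<rho> \<epsilon> x = complex_of_real (1 / \<epsilon> ^ DIM('a)) * \<rho> (x /\<^sub>R \<epsilon>)"

definition distr_convolution ::
    "(('a::euclidean_space \<Rightarrow> complex) \<Rightarrow> complex) \<Rightarrow> ('a \<Rightarrow> complex) \<Rightarrow> 'a \<Rightarrow> complex" where
  "distr_convolution \<Lambda> \<phi> x = \<Lambda> (\<lambda>y. \<phi> (x - y))"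

definition msupp :: "'a::euclidean_space measure \<Rightarrow> 'a set" where
  "msupp \<mu> = {x. \<forall>U. open U \<longrightarrow> x \<in> U \<longrightarrow> emeasure \<mu> U > 0}"

definition compactly_supported_borel_measure :: "'a::euclidean_space measure \<Rightarrow> bool" where
  "compactly_supported_borel_measure \<mu> \<longleftrightarrow> sets \<mu> = sets borel \<and> compact (msupp \<mu>)"

text \<open>
  The balls are closed. For open balls a point mass would satisfy the condition, since its
  support has diameter \<open>0\<close>; with closed balls the case \<open>r = 0\<close> rules out atoms (for \<open>s > 0\<close>).
\<close>

definition growth_condition :: "'a::euclidean_space measure \<Rightarrow> real \<Rightarrow> bool" where
  "growth_condition \<mu> s \<longleftrightarrow>
     (\<exists>C. \<forall>x \<in> msupp \<mu>. \<forall>r \<in> {0..diameter (msupp \<mu>)}.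
        emeasure \<mu> (cball x r) \<le> ennreal (C * r powr s))"

definition in_L2 :: "'a measure \<Rightarrow> ('a \<Rightarrow> complex) \<Rightarrow> bool" where
  "in_L2 M f \<longleftrightarrow> f \<in> borel_measurable M \<and> integrable M (\<lambda>x. (norm (f x))\<^sup>2)"

definition norm_L2 :: "'a measure \<Rightarrow> ('a \<Rightarrow> complex) \<Rightarrow> real" where
  "norm_L2 M f = sqrt (LINT x|M. (norm (f x))\<^sup>2)"

definition T_op ::
    "('a::euclidean_space \<Rightarrow> complex) \<Rightarrow> 'a measure \<Rightarrow> ('a \<Rightarrow> complex) \<Rightarrow> 'a \<Rightarrow> complex" where
  "T_op k \<mu> f x = (LINT y|\<mu>. k (x - y) * f y)"

definition uniformly_L2_bounded ::
    "(('a::euclidean_space \<Rightarrow> complex) \<Rightarrow> complex) \<Rightarrow> ('a \<Rightarrow> complex) \<Rightarrow>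
      'a measure \<Rightarrow> 'a measure \<Rightarrow> bool" where
  "uniformly_L2_bounded \<Lambda> \<rho> \<mu> \<nu> \<longleftrightarrow>
     (\<exists>C. \<forall>\<epsilon>>0. \<forall>f. in_L2 \<mu> f \<longrightarrow>
        in_L2 \<nu> (T_op (distr_convolution \<Lambda> (mollifier \<rho> \<epsilon>)) \<mu> f) \<and>
        norm_L2 \<nu> (T_op (distr_convolution \<Lambda> (mollifier \<rho> \<epsilon>)) \<mu> f) \<le> C * norm_L2 \<mu> f)"

definition admissible ::
    "(('a::euclidean_space \<Rightarrow> complex) \<Rightarrow> complex) \<Rightarrow> 'a measure \<Rightarrow> 'a measure \<Rightarrow>
      real \<Rightarrow> real \<Rightarrow> real \<Rightarrow> bool" where
  "admissible \<Lambda> \<mu> \<nu> \<alpha> s\<^sub>\<mu> s\<^sub>\<nu> \<longleftrightarrow>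
     tempered_distribution \<Lambda> \<and> fourier_decay \<Lambda> \<alpha> \<and>
     compactly_supported_borel_measure \<mu> \<and> growth_condition \<mu> s\<^sub>\<mu> \<and>
     compactly_supported_borel_measure \<nu> \<and> growth_condition \<nu> s\<^sub>\<nu>"

end

(*
  (i) By Fourier inversion, lambda^eps is the inverse Fourier transform of m_eps = h * (rho_eps)^,
  where h is the Fourier transform of lambda, so by Fubini the pairing of T f with g in L^2(nu) is
  the integral of m_eps * (f mu)^ * (g nu)^.  The growth condition and Schur's test give
    integral of exp(-pi |xi|^2 / R^2) |(f mu)^|^2  <=  C R^(d - s_mu) |f|^2,
  hence the weighted energy with weight |xi|^(-a), |xi| >= 1, is finite for a > d - s_mu.  As
  alpha > d - s, the exponent 2 alpha splits as a + b with a > d - s_mu and b > d - s_nu, and the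
  Cauchy-Schwarz inequality bounds the high frequencies; the low ones are trivial since h is
  locally integrable.

  (ii) Take lambda = sum_i r_i^(-s) G(x / r_i) with G a Gaussian and r_i = 2^(-m^i); it has Fourier
  decay |xi|^(-(d - s)).  For mu and nu take Cantor measures of dimensions s_mu, s_nu with nested
  sets of admissible binary digits.  If u >= t are the two dimensions and E is the smaller set,
  the function F = (sum_(i<=j) r_i^(-(u - t)) 1_(r_i-neighbourhood of E))^(1/2) has square norm
  O(j) on the larger measure, while every scale contributes a constant to the bilinear form, which
  is therefore at least c j.  The lacunary choice of the scales makes the mollification at scale
  r_j^(d + 2) of lambda differ from its j-th partial sum by a bounded function, so that no
  positivity of rho is needed.
*)
theory Submission
  imports Defs "HOL-Probability.Probability" "HOL-Real_Asymp.Real_Asymp"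
begin

section \<open>Fubini and Gaussian integrals\<close>

text \<open>In (i) the pairing is tested with the conjugate of T f, so the square norm of T f occurs
  on both sides. The Cauchy-Schwarz step is therefore done as a weighted arithmetic-geometric
  inequality, whose weight leaves half of that norm to be absorbed. The frequency weight is Gaussian
  because its transform is explicit and positive, so that Schur's test only asks for the mass of
  balls. In (ii) the obstacle is the endpoint \<alpha> = d - s, where scaling makes one scale yield
  only a bounded ratio: scales of equal strength have to add up. The other function is the constant
  1, so a form of size j meets a product of norms of size sqrt(j). The weights in F are forced by
  the exponents: scale r contributes r^(-s) from the kernel, r^u from the mass of a ball and r^(-(u
  - t)/2) from F, and these cancel because s = (u + t)/2. In the mollification scale r_j^(d + 2),
  the power d + 1 pays for the slope of the steepest bump and one more for the number of bumps.
  Since r_(j+1) = r_j^m, a large m makes the mass of all later bumps smaller than any prescribed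
  power of r_j.\<close>

lemma integral_swap_bounded:
  fixes a :: "'a \<Rightarrow> 'c::{real_normed_field, banach, second_countable_topology}"
  assumes "sigma_finite_measure M" "sigma_finite_measure N"
    and a: "integrable M a" and b: "integrable N b"
    and k: "(\<lambda>(x, y). k x y) \<in> borel_measurable (M \<Otimes>\<^sub>M N)"
    and bound: "\<And>x y. norm (k x y) \<le> B"
  shows "(LINT x|M. a x * (LINT y|N. k x y * b y)) = (LINT y|N. b y * (LINT x|M. k x y * a x))"
proof -
  interpret M: sigma_finite_measure M by fact
  interpret N: sigma_finite_measure N by fact
  interpret P: pair_sigma_finite M N ..
  note [measurable] = borel_measurable_integrable[OF a] borel_measurable_integrable[OF b] k
  have k1: "k x \<in> borel_measurable N" if "x \<in> space M" for x
    using measurable_Pair2[OF k that] by simp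
  have ky: "integrable N (\<lambda>y. k x y * b y)" if "x \<in> space M" for x
    using b k1[OF that]
    by (intro Bochner_Integration.integrable_bound[OF integrable_mult_right[OF integrable_norm[OF b], of "\<bar>B\<bar>"]])
       (auto simp: norm_mult intro!: mult_right_mono order_trans[OF bound])
  have int: "integrable (M \<Otimes>\<^sub>M N) (\<lambda>(x, y). a x * (k x y * b y))"
  proof (rule P.Fubini_integrable)
    show "(\<lambda>(x, y). a x * (k x y * b y)) \<in> borel_measurable (M \<Otimes>\<^sub>M N)"
      by measurable
    show "integrable M (\<lambda>x. \<integral>y. norm (case (x, y) of (x, y) \<Rightarrow> a x * (k x y * b y)) \<partial>N)"
    proof (rule Bochner_Integration.integrable_bound)
      show "integrable M (\<lambda>x. norm (a x) * (\<bar>B\<bar> * (\<integral>y. norm (b y) \<partial>N)))"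
        using a by auto
      show "AE x in M. norm (\<integral>y. norm (case (x, y) of (x, y) \<Rightarrow> a x * (k x y * b y)) \<partial>N)
          \<le> norm (norm (a x) * (\<bar>B\<bar> * (\<integral>y. norm (b y) \<partial>N)))"
      proof (rule AE_I2)
        fix x assume x: "x \<in> space M"
        have "(\<integral>y. norm (a x * (k x y * b y)) \<partial>N) \<le> (\<integral>y. norm (a x) * (\<bar>B\<bar> * norm (b y)) \<partial>N)"
          using b ky[OF x, THEN integrable_norm] by (intro integral_mono)
            (auto simp: norm_mult intro!: mult_left_mono mult_right_mono order_trans[OF bound])
        then show "norm (\<integral>y. norm (case (x, y) of (x, y) \<Rightarrow> a x * (k x y * b y)) \<partial>N)
          \<le> norm (norm (a x) * (\<bar>B\<bar> * (\<integral>y. norm (b y) \<partial>N)))"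
          by (simp add: abs_mult)
      qed
    qed measurable
    show "AE x in M. integrable N (\<lambda>y. case (x, y) of (x, y) \<Rightarrow> a x * (k x y * b y))"
      using ky by auto
  qed
  have "(LINT x|M. a x * (LINT y|N. k x y * b y)) = (LINT x|M. (LINT y|N. a x * (k x y * b y)))"
    by simp
  also have "\<dots> = (LINT y|N. (LINT x|M. a x * (k x y * b y)))"
    using P.Fubini_integral[OF int] by simp
  also have "\<dots> = (LINT y|N. (LINT x|M. b y * (k x y * a x)))"
    by (simp add: algebra_simps)
  finally show ?thesis by simp
qed

text \<open>Lebesgue measure is the image of the product of one-dimensional Lebesgue measures under
  the coordinate sum. This serves both the Gaussian and the integrable majorant of Schwartz
  functions.\<close>

lemma
  fixes g :: "'a::euclidean_space \<Rightarrow> real \<Rightarrow> 'b::{real_normed_field, banach, second_countable_topology}"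
  assumes g: "\<And>b. b \<in> Basis \<Longrightarrow> integrable lborel (g b)"
  shows integrable_lborel_prod: "integrable lborel (\<lambda>x. \<Prod>b\<in>Basis. g b (x \<bullet> b))"
    and integral_lborel_prod:
      "(LINT x|lborel. (\<Prod>b\<in>Basis. g b (x \<bullet> b))) = (\<Prod>b\<in>Basis. (LINT t|lborel. g b t))"
proof -
  interpret product_sigma_finite "\<lambda>_::'a. lborel :: real measure" by standard
  have m: "(\<lambda>x. \<Prod>b\<in>Basis. g b (x \<bullet> b)) \<in> borel_measurable borel"
    using borel_measurable_integrable[OF g] by measurable
  have eq: "(\<Prod>b\<in>Basis. g b ((\<Sum>i\<in>Basis. f i *\<^sub>R i) \<bullet> b)) = (\<Prod>b\<in>Basis. g b (f b))" for f
    by (intro prod.cong) (auto simp: inner_sum_left inner_Basis if_distrib sum.delta cong: if_cong)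
  show "integrable lborel (\<lambda>x. \<Prod>b\<in>Basis. g b (x \<bullet> b))"
    by (subst lborel_eq, subst integrable_distr_eq)
       (use m product_integrable_prod[of Basis g] g in \<open>auto simp: eq\<close>)
  show "(LINT x|lborel. (\<Prod>b\<in>Basis. g b (x \<bullet> b))) = (\<Prod>b\<in>Basis. (LINT t|lborel. g b t))"
    by (subst lborel_eq, subst integral_distr)
       (use m product_integral_prod[of Basis g] g in \<open>auto simp: eq\<close>)
qed

lemma
  fixes f :: "'a::euclidean_space \<Rightarrow> 'b::{banach, second_countable_topology}"
  assumes c: "c \<noteq> 0"
  shows integrable_lborel_affine: "integrable lborel f \<Longrightarrow> integrable lborel (\<lambda>x. f (t + c *\<^sub>R x))"
    and integral_lborel_affine:
      "integrable lborel f \<Longrightarrow> (LINT x|lborel. f x) = \<bar>c\<bar> ^ DIM('a) *\<^sub>R (LINT x|lborel. f (t + c *\<^sub>R x))"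
proof -
  assume f: "integrable lborel f"
  have [measurable]: "f \<in> borel_measurable borel" using borel_measurable_integrable[OF f] by simp
  from f have f': "integrable (density (distr lborel borel (\<lambda>x. t + c *\<^sub>R x)) (\<lambda>_. \<bar>c\<bar> ^ DIM('a))) f"
    using lborel_affine[OF c, of t] by simp
  then have "integrable lborel (\<lambda>x. \<bar>c\<bar> ^ DIM('a) *\<^sub>R f (t + c *\<^sub>R x))"
    by (subst (asm) integrable_density) (auto simp: integrable_distr_eq)
  then show "integrable lborel (\<lambda>x. f (t + c *\<^sub>R x))"
    using c integrable_scaleR_right[of "1 / \<bar>c\<bar> ^ DIM('a)" lborel "\<lambda>x. \<bar>c\<bar> ^ DIM('a) *\<^sub>R f (t + c *\<^sub>R x)"]
    by simp
  have "(LINT x|lborel. f x) = (LINT x|density (distr lborel borel (\<lambda>x. t + c *\<^sub>R x)) (\<lambda>_. \<bar>c\<bar> ^ DIM('a)). f x)"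
    using lborel_affine[OF c, of t] by simp
  also have "\<dots> = \<bar>c\<bar> ^ DIM('a) *\<^sub>R (LINT x|lborel. f (t + c *\<^sub>R x))"
    by (subst integral_density) (auto simp: integral_distr)
  finally show "(LINT x|lborel. f x) = \<bar>c\<bar> ^ DIM('a) *\<^sub>R (LINT x|lborel. f (t + c *\<^sub>R x))" .
qed

text \<open>The substitution with factor sqrt(2 pi) turns the integrand into the standard normal
  density times a character, so the value is the characteristic function of the normal
  distribution.\<close>

lemma cis_integral_gaussian_real:
  "integrable lborel (\<lambda>x::real. cis (- 2 * pi * (x * t)) * complex_of_real (exp (- pi * x\<^sup>2)))" (is ?I)
  "(LINT x|lborel. cis (- 2 * pi * (x * t)) * complex_of_real (exp (- pi * x\<^sup>2)))
     = complex_of_real (exp (- pi * t\<^sup>2))" (is ?E)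
proof -
  define c where "c = sqrt (2 * pi)"
  have c: "c > 0" "c\<^sup>2 = 2 * pi" by (auto simp: c_def)
  define g where "g = (\<lambda>x::real. std_normal_density x *\<^sub>R iexp (- c * t * x))"
  have g: "integrable lborel g"
  proof -
    have "integrable std_normal_distribution (\<lambda>x. iexp (- c * t * x))"
      using real_dist_normal_dist by (intro prob_space.integrable_iexp[of std_normal_distribution] real_distribution.axioms) auto
    then show ?thesis unfolding g_def by (subst (asm) integrable_density) auto
  qed
  have "(LINT x|lborel. g x) = char std_normal_distribution (- c * t)"
    unfolding char_def g_def by (subst integral_density) auto
  also have "\<dots> = complex_of_real (exp (- (c * t)\<^sup>2 / 2))"
    by (simp add: char_std_normal_distribution)
  finally have eg: "(LINT x|lborel. g x) = complex_of_real (exp (- pi * t\<^sup>2))" using c by (simp add: power_mult_distrib)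
  have gc: "c *\<^sub>R g (0 + c * x) = cis (- 2 * pi * (x * t)) * complex_of_real (exp (- pi * x\<^sup>2))" for x
  proof -
    have 1: "c * std_normal_density (c * x) = exp (- pi * x\<^sup>2)"
      using c by (simp add: std_normal_density_def power_mult_distrib c_def)
    have 2: "- c * t * (c * x) = - 2 * pi * (x * t)"
      using c(2) by (simp add: power2_eq_square algebra_simps)
    have "c *\<^sub>R g (0 + c * x) = (c * std_normal_density (c * x)) *\<^sub>R cis (- c * t * (c * x))"
      by (simp add: g_def cis_conv_exp)
    then show ?thesis unfolding 1 2 by (simp add: scaleR_conv_of_real)
  qed
  have "integrable lborel (\<lambda>x. g (0 + c * x))"
    using lborel_integrable_real_affine[OF g, of c 0] c by simp
  then have "integrable lborel (\<lambda>x. c *\<^sub>R g (0 + c * x))" by simp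
  then show ?I unfolding gc .
  have "(LINT x|lborel. g x) = c *\<^sub>R (LINT x|lborel. g (0 + c * x))"
    using lborel_integral_real_affine[of c g 0] c by simp
  also have "\<dots> = (LINT x|lborel. c *\<^sub>R g (0 + c * x))" by simp
  finally show ?E unfolding gc eg by simp
qed

text \<open>The factor pi is the normalization for the phase 2 pi: the function has integral 1 and
  is its own Fourier transform.\<close>

definition gauss :: "'a::euclidean_space \<Rightarrow> real" where
  "gauss x = exp (- pi * (norm x)\<^sup>2)"

lemma gauss_pos [simp]: "0 < gauss x" and gauss_nonneg [simp]: "0 \<le> gauss x"
  and gauss_le_1 [simp]: "gauss x \<le> 1"
  by (auto simp: gauss_def)

lemma gauss_minus [simp]: "gauss (- x) = gauss x"
  by (simp add: gauss_def)

lemma borel_measurable_gauss [measurable]: "gauss \<in> borel_measurable borel"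
  unfolding gauss_def by measurable

lemma gauss_eq_prod: "gauss x = (\<Prod>b\<in>Basis. exp (- pi * (x \<bullet> b)\<^sup>2))"
proof -
  have "(norm x)\<^sup>2 = (\<Sum>b\<in>Basis. (x \<bullet> b)\<^sup>2)"
    unfolding power2_norm_eq_inner by (subst euclidean_inner) (simp add: power2_eq_square)
  then show ?thesis by (simp add: gauss_def exp_sum[symmetric] sum_distrib_left sum_negf)
qed

lemma
  fixes \<xi> :: "'a::euclidean_space"
  shows integrable_gauss_cis: "integrable lborel (\<lambda>x. cis (- 2 * pi * (x \<bullet> \<xi>)) * complex_of_real (gauss x))"
    and fourier_gauss: "fourier (\<lambda>x. complex_of_real (gauss x)) \<xi> = complex_of_real (gauss \<xi>)"
proof -
  define g where "g = (\<lambda>(b::'a) t::real. cis (- 2 * pi * (t * (\<xi> \<bullet> b))) * complex_of_real (exp (- pi * t\<^sup>2)))"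
  have cis_sum: "cis (\<Sum>b\<in>S. f b) = (\<Prod>b\<in>S. cis (f b))" if "finite S" for S :: "'a set" and f
    using that by (induction S) (auto simp: cis_mult[symmetric])
  have eq: "cis (- 2 * pi * (x \<bullet> \<xi>)) * complex_of_real (gauss x) = (\<Prod>b\<in>Basis. g b (x \<bullet> b))" for x :: 'a
  proof -
    have "- 2 * pi * (x \<bullet> \<xi>) = (\<Sum>b\<in>Basis. - 2 * pi * ((x \<bullet> b) * (\<xi> \<bullet> b)))"
      by (simp add: euclidean_inner[of x \<xi>] sum_distrib_left)
    then show ?thesis
      by (simp add: gauss_eq_prod g_def prod.distrib cis_sum del: euclidean_inner)
  qed
  have gi: "integrable lborel (g b)" for b
    unfolding g_def by (rule cis_integral_gaussian_real)
  have gint: "(LINT t|lborel. g b t) = complex_of_real (exp (- pi * (\<xi> \<bullet> b)\<^sup>2))" for b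
    unfolding g_def by (rule cis_integral_gaussian_real)
  show "integrable lborel (\<lambda>x. cis (- 2 * pi * (x \<bullet> \<xi>)) * complex_of_real (gauss x))"
    unfolding eq by (rule integrable_lborel_prod[OF gi])
  show "fourier (\<lambda>x. complex_of_real (gauss x)) \<xi> = complex_of_real (gauss \<xi>)"
    unfolding fourier_def eq
    by (subst integral_lborel_prod[OF gi]) (simp only: gint gauss_eq_prod of_real_prod)
qed

lemma integrable_gauss: "integrable lborel (gauss :: 'a::euclidean_space \<Rightarrow> real)"
  using integrable_Re[OF integrable_gauss_cis[of "0::'a"]] by simp

lemma integral_gauss: "(LINT x|lborel. gauss (x::'a::euclidean_space)) = 1"
proof -
  have "complex_of_real (LINT x|lborel. gauss (x::'a)) = 1"
    using fourier_gauss[of "0::'a"] by (simp add: fourier_def gauss_def)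
  then show ?thesis using of_real_eq_1_iff by blast
qed

lemma integrable_gauss_affine:
  "c \<noteq> 0 \<Longrightarrow> integrable lborel (\<lambda>x. gauss (t + c *\<^sub>R x :: 'a::euclidean_space))"
  by (rule integrable_lborel_affine[OF _ integrable_gauss])

lemma integral_cis_gauss_scaled:
  fixes \<xi> :: "'a::euclidean_space"
  assumes "r > 0"
  shows "(LINT x|lborel. cis (2 * pi * (x \<bullet> \<xi>)) * complex_of_real (gauss (x /\<^sub>R r)))
    = complex_of_real (r ^ DIM('a) * gauss (r *\<^sub>R \<xi>))"
proof -
  define g where "g = (\<lambda>x::'a. cis (- 2 * pi * (x \<bullet> (- r *\<^sub>R \<xi>))) * complex_of_real (gauss x))"
  have g: "integrable lborel g" unfolding g_def by (rule integrable_gauss_cis)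
  have eq: "g (0 + (1 / r) *\<^sub>R x) = cis (2 * pi * (x \<bullet> \<xi>)) * complex_of_real (gauss (x /\<^sub>R r))" for x
    using assms by (simp add: g_def inverse_eq_divide)
  have "(LINT x|lborel. g x) = complex_of_real (gauss (- r *\<^sub>R \<xi>))"
    using fourier_gauss[of "- r *\<^sub>R \<xi>"] unfolding fourier_def g_def .
  moreover have "(LINT x|lborel. g x) = \<bar>1 / r\<bar> ^ DIM('a) *\<^sub>R (LINT x|lborel. g (0 + (1 / r) *\<^sub>R x))"
    by (rule integral_lborel_affine[OF _ g]) (use assms in auto)
  ultimately have "complex_of_real (gauss (r *\<^sub>R \<xi>)) =
      (1 / r) ^ DIM('a) *\<^sub>R (LINT x|lborel. cis (2 * pi * (x \<bullet> \<xi>)) * complex_of_real (gauss (x /\<^sub>R r)))"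
    unfolding eq using assms by simp
  then show ?thesis
    using assms by (simp add: scaleR_conv_of_real power_one_over field_simps)
qed

section \<open>Smooth functions and test functions\<close>

lemma pderivs_append: "pderivs (xs @ ys) f = pderivs xs (pderivs ys f)"
  by (induction xs) auto

text \<open>Smoothness quantifies over all iterated derivatives. An invariant class of
  differentiable functions replaces explicit formulas for the higher derivatives.\<close>

lemma smoothI_coinduct:
  assumes "f \<in> S"
    and diff: "\<And>g x. g \<in> S \<Longrightarrow> g differentiable (at x)"
    and closed: "\<And>g b. g \<in> S \<Longrightarrow> b \<in> Basis \<Longrightarrow> (\<lambda>x. frechet_derivative g (at x) b) \<in> S"
  shows "smooth f"
proof -
  have "pderivs bs f \<in> S" if "bs \<in> lists Basis" for bs
    using that by (induction bs) (auto intro: assms)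
  then show ?thesis by (auto simp: smooth_def intro: diff)
qed

lemma smooth_differentiable: "smooth f \<Longrightarrow> f differentiable (at x)"
  unfolding smooth_def by (metis lists.Nil pderivs.simps(1))

lemma smooth_pderivs: "smooth f \<Longrightarrow> bs \<in> lists Basis \<Longrightarrow> smooth (pderivs bs f)"
  unfolding smooth_def pderivs_append[symmetric] by auto

lemma smooth_frechet_derivative:
  "smooth f \<Longrightarrow> b \<in> Basis \<Longrightarrow> smooth (\<lambda>x. frechet_derivative f (at x) b)"
  using smooth_pderivs[of f "[b]"] by simp

lemma smooth_has_derivative: "smooth f \<Longrightarrow> (f has_derivative frechet_derivative f (at x)) (at x)"
  using smooth_differentiable frechet_derivative_works by blast

lemma smooth_continuous_on: "smooth f \<Longrightarrow> continuous_on S f"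
  by (meson continuous_at_imp_continuous_on differentiable_imp_continuous_within smooth_differentiable)

lemma smooth_measurable: "smooth f \<Longrightarrow> f \<in> borel_measurable borel"
  by (intro borel_measurable_continuous_onI smooth_continuous_on)

lemma smooth_affine:
  fixes f :: "'a::euclidean_space \<Rightarrow> complex"
  assumes "smooth f"
  shows "smooth (\<lambda>x. c * f (t + a *\<^sub>R x))"
\<comment> \<open>The constant belongs to the family because every derivative produces a chain rule
  factor \<open>a\<close>, which is moved into it.\<close>
proof (rule smoothI_coinduct[where S = "{\<lambda>x. c * g (t + a *\<^sub>R x) | c g. smooth g}"])
  have der: "((\<lambda>x. c * g (t + a *\<^sub>R x)) has_derivative (\<lambda>h. c * frechet_derivative g (at (t + a *\<^sub>R x)) (a *\<^sub>R h))) (at x)"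
    if "smooth g" for c g and x :: 'a
    by (rule has_derivative_compose[OF _ smooth_has_derivative[OF that], THEN has_derivative_mult_right])
       (auto intro!: derivative_eq_intros)
  show "(\<lambda>x. c * f (t + a *\<^sub>R x)) \<in> {\<lambda>x. c * g (t + a *\<^sub>R x) | c g. smooth g}"
    using assms by auto
  fix h :: "'a \<Rightarrow> complex" assume "h \<in> {\<lambda>x. c * g (t + a *\<^sub>R x) | c g. smooth g}"
  then obtain c g where h: "h = (\<lambda>x. c * g (t + a *\<^sub>R x))" and g: "smooth g" by auto
  show "h differentiable (at x)" for x
    unfolding h using der[OF g] differentiable_def by blast
  show "(\<lambda>x. frechet_derivative h (at x) b) \<in> {\<lambda>x. c * g (t + a *\<^sub>R x) | c g. smooth g}" if b: "b \<in> Basis" for b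
  proof -
    have "frechet_derivative h (at x) b = (c * complex_of_real a) * frechet_derivative g (at (t + a *\<^sub>R x)) b" for x
    proof -
      have "frechet_derivative h (at x) b = c * frechet_derivative g (at (t + a *\<^sub>R x)) (a *\<^sub>R b)"
        unfolding h frechet_derivative_at[OF der[OF g], symmetric] ..
      also have "frechet_derivative g (at (t + a *\<^sub>R x)) (a *\<^sub>R b) = a *\<^sub>R frechet_derivative g (at (t + a *\<^sub>R x)) b"
        using smooth_has_derivative[OF g, THEN has_derivative_linear] by (rule linear_scale)
      finally show ?thesis by (simp add: scaleR_conv_of_real)
    qed
    then have "(\<lambda>x. frechet_derivative h (at x) b) =
        (\<lambda>x. (c * complex_of_real a) * (\<lambda>x. frechet_derivative g (at x) b) (t + a *\<^sub>R x))" by auto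
    then show ?thesis
      using smooth_frechet_derivative[OF g b]
      by (intro CollectI exI[of _ "c * complex_of_real a"] exI[of _ "\<lambda>x. frechet_derivative g (at x) b"] conjI)
  qed
qed

text \<open>An invariant class for \<open>smoothI_coinduct\<close>: the product rule for a linear
  form times f stays inside it, so no Leibniz formula of higher order is required.\<close>

inductive_set linear_multiples :: "('a::euclidean_space \<Rightarrow> complex) set" where
  base: "smooth f \<Longrightarrow> f \<in> linear_multiples"
| mult: "f \<in> linear_multiples \<Longrightarrow> (\<lambda>x. complex_of_real (x \<bullet> v) * f x) \<in> linear_multiples"
| scale: "f \<in> linear_multiples \<Longrightarrow> (\<lambda>x. c * f x) \<in> linear_multiples"
| add: "f \<in> linear_multiples \<Longrightarrow> g \<in> linear_multiples \<Longrightarrow> (\<lambda>x. f x + g x) \<in> linear_multiples"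

lemma linear_multiples_derivative:
  assumes "f \<in> linear_multiples"
  shows "(\<forall>x. f differentiable (at x)) \<and>
    (\<forall>b\<in>Basis. (\<lambda>x. frechet_derivative f (at x) b) \<in> linear_multiples)"
  using assms
proof induction
  case (base f)
  then show ?case
    by (auto intro: smooth_differentiable smooth_frechet_derivative linear_multiples.base)
next
  case (mult f v)
  then have f: "(f has_derivative frechet_derivative f (at x)) (at x)" for x
    by (simp add: frechet_derivative_works[symmetric])
  have der: "((\<lambda>x. complex_of_real (x \<bullet> v) * f x) has_derivative
      (\<lambda>h. complex_of_real (x \<bullet> v) * frechet_derivative f (at x) h + complex_of_real (h \<bullet> v) * f x)) (at x)" for x
    by (rule has_derivative_mult[OF _ f]) (auto intro!: derivative_eq_intros)
  have "frechet_derivative (\<lambda>x. complex_of_real (x \<bullet> v) * f x) (at x) b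
      = complex_of_real (x \<bullet> v) * frechet_derivative f (at x) b + complex_of_real (b \<bullet> v) * f x" for x b
    by (simp add: frechet_derivative_at[OF der, symmetric])
  then show ?case
    using der mult by (auto simp: differentiable_def intro!: linear_multiples.intros(2-))
next
  case (scale f c)
  then have f: "(f has_derivative frechet_derivative f (at x)) (at x)" for x
    by (simp add: frechet_derivative_works[symmetric])
  have der: "((\<lambda>x. c * f x) has_derivative (\<lambda>h. c * frechet_derivative f (at x) h)) (at x)" for x
    by (rule has_derivative_mult_right[OF f])
  have "frechet_derivative (\<lambda>x. c * f x) (at x) b = c * frechet_derivative f (at x) b" for x b
    by (simp add: frechet_derivative_at[OF der, symmetric])
  then show ?case
    using der scale by (auto simp: differentiable_def intro!: linear_multiples.intros(2-))
next
  case (add f g)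
  then have f: "(f has_derivative frechet_derivative f (at x)) (at x)"
    and g: "(g has_derivative frechet_derivative g (at x)) (at x)" for x
    by (simp_all add: frechet_derivative_works[symmetric])
  have der: "((\<lambda>x. f x + g x) has_derivative (\<lambda>h. frechet_derivative f (at x) h + frechet_derivative g (at x) h)) (at x)" for x
    by (rule has_derivative_add[OF f g])
  have "frechet_derivative (\<lambda>x. f x + g x) (at x) b = frechet_derivative f (at x) b + frechet_derivative g (at x) b" for x b
    by (simp add: frechet_derivative_at[OF der, symmetric])
  then show ?case
    using der add by (auto simp: differentiable_def intro!: linear_multiples.intros(2-))
qed

lemma smooth_linear_multiple:
  assumes "smooth f" shows "smooth (\<lambda>x. c * (complex_of_real (x \<bullet> v) * f x))"
proof (rule smoothI_coinduct[where S = linear_multiples])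
  show "(\<lambda>x. c * (complex_of_real (x \<bullet> v) * f x)) \<in> linear_multiples"
    by (intro linear_multiples.scale linear_multiples.mult linear_multiples.base assms)
qed (use linear_multiples_derivative in auto)

lemma test_function_iff: "test_function f \<longleftrightarrow> smooth f \<and> (\<exists>R. \<forall>x. f x \<noteq> 0 \<longrightarrow> norm x \<le> R)"
  unfolding test_function_def compact_closure bounded_iff by auto

lemma test_function_smooth: "test_function f \<Longrightarrow> smooth f"
  by (simp add: test_function_def)

lemma test_function_affine:
  fixes f :: "'a::euclidean_space \<Rightarrow> complex"
  assumes f: "test_function f" and a: "a \<noteq> 0"
  shows "test_function (\<lambda>x. c * f (t + a *\<^sub>R x))"
proof -
  obtain R where R: "\<And>x. f x \<noteq> 0 \<Longrightarrow> norm x \<le> R"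
    using f by (auto simp: test_function_iff)
  have "norm x \<le> (R + norm t) / \<bar>a\<bar>" if "f (t + a *\<^sub>R x) \<noteq> 0" for x
  proof -
    have "norm (a *\<^sub>R x) \<le> norm (t + a *\<^sub>R x) + norm t"
      by (metis add.commute add_diff_cancel_left' norm_triangle_ineq4)
    with R[OF that] have "\<bar>a\<bar> * norm x \<le> R + norm t" by simp
    then show ?thesis using a by (simp add: field_simps)
  qed
  with f show ?thesis
    by (auto simp: test_function_iff intro: smooth_affine)
qed

lemma test_function_linear_multiple:
  assumes "test_function f" shows "test_function (\<lambda>x. c * (complex_of_real (x \<bullet> v) * f x))"
  using assms by (auto simp: test_function_iff intro: smooth_linear_multiple)

lemma test_function_frechet_derivative:
  assumes f: "test_function f" and b: "b \<in> Basis"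
  shows "test_function (\<lambda>x. frechet_derivative f (at x) b)"
proof -
  obtain R where R: "\<And>x. f x \<noteq> 0 \<Longrightarrow> norm x \<le> R"
    using f by (auto simp: test_function_iff)
  have "frechet_derivative f (at x) b = 0" if "\<not> norm x \<le> R" for x
  proof -
    have "((\<lambda>_. 0) has_derivative (\<lambda>_. 0)) (at x)" by simp
    then have "(f has_derivative (\<lambda>_. 0)) (at x)"
    proof (rule has_derivative_transform_within_open)
      show "open (- cball 0 R)" "x \<in> - cball 0 R" using that by auto
      show "0 = f y" if "y \<in> - cball 0 R" for y using that R[of y] by auto
    qed
    from frechet_derivative_at[OF this] show ?thesis by metis
  qed
  then show ?thesis
    using f b unfolding test_function_iff by (metis smooth_frechet_derivative)
qed

lemma test_function_mult_integrable:
  fixes f g :: "'a::euclidean_space \<Rightarrow> complex"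
  assumes f: "test_function f" and g: "continuous_on UNIV g"
  shows "integrable lborel (\<lambda>x. g x * f x)"
proof -
  obtain R where R: "\<And>x. f x \<noteq> 0 \<Longrightarrow> norm x \<le> R"
    using f by (auto simp: test_function_iff)
  have "integrable lborel (\<lambda>x. indicator (cball 0 R) x *\<^sub>R (g x * f x))"
    using g smooth_continuous_on[OF test_function_smooth[OF f], of UNIV]
    by (intro borel_integrable_compact continuous_intros) (auto intro: continuous_on_subset)
  also have "(\<lambda>x. indicator (cball 0 R) x *\<^sub>R (g x * f x)) = (\<lambda>x. g x * f x)"
    using R by (auto simp: indicator_def fun_eq_iff)
  finally show ?thesis .
qed

lemma test_function_integrable: "test_function f \<Longrightarrow> integrable lborel f"
  using test_function_mult_integrable[of f "\<lambda>_. 1"] by simp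

lemma test_function_bounded:
  assumes f: "test_function f" shows "\<exists>B\<ge>0. \<forall>x. norm (f x) \<le> B"
proof -
  obtain R where R: "\<And>x. f x \<noteq> 0 \<Longrightarrow> norm x \<le> R"
    using f by (auto simp: test_function_iff)
  have "compact (f ` cball 0 R)"
    by (intro compact_continuous_image smooth_continuous_on test_function_smooth f compact_cball)
  then obtain B where B: "\<forall>y\<in>f ` cball 0 R. norm y \<le> B"
    using compact_imp_bounded bounded_iff by blast
  have "norm (f x) \<le> max B 0" for x
    using B R[of x] by (cases "f x = 0") (auto simp: le_max_iff_disj)
  then show ?thesis by (intro exI[of _ "max B 0"]) auto
qed

section \<open>Differentiation under the Fourier integral\<close>

lemma norm_cis_minus_linear: "norm (cis t - 1 - \<i> * complex_of_real t) \<le> t\<^sup>2"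
proof -
  have "norm (cis t - 1 - \<i> * complex_of_real t) \<le> t\<^sup>2 / 2"
    using iexp_approx1[of t 1] by (simp add: cis_conv_exp algebra_simps power2_eq_square)
  then show ?thesis by (smt (verit) zero_le_power2 field_sum_of_halves)
qed

text \<open>The second-order estimate for \<open>cis\<close> makes the error of the linear
  approximation at most C times the squared increment, where C is the second moment of |f|, finite
  because of the compact support.\<close>

lemma fourier_has_derivative:
  fixes f :: "'a::euclidean_space \<Rightarrow> complex"
  assumes f: "test_function f"
  shows "(fourier f has_derivative
    (\<lambda>h. LINT x|lborel. (- 2 * pi * \<i>) * (complex_of_real (x \<bullet> h) * cis (- 2 * pi * (x \<bullet> \<xi>))) * f x)) (at \<xi>)"
proof -
  define D where "D = (\<lambda>h. LINT x|lborel. (- 2 * pi * \<i>) * (complex_of_real (x \<bullet> h) * cis (- 2 * pi * (x \<bullet> \<xi>))) * f x)"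
  have intD: "integrable lborel (\<lambda>x. (- 2 * pi * \<i>) * (complex_of_real (x \<bullet> h) * cis (- 2 * pi * (x \<bullet> \<xi>))) * f x)" for h
    by (intro test_function_mult_integrable f continuous_intros)
  have intF: "integrable lborel (\<lambda>x. cis (- 2 * pi * (x \<bullet> \<eta>)) * f x)" for \<eta>
    by (intro test_function_mult_integrable f continuous_intros)
  have intC: "integrable lborel (\<lambda>x. (2 * pi * norm x)\<^sup>2 * norm (f x))"
    using integrable_norm[OF test_function_mult_integrable[OF f, of "\<lambda>x. complex_of_real ((2 * pi * norm x)\<^sup>2)"]]
    by (simp add: norm_mult norm_power continuous_intros)
  define C where "C = (LINT x|lborel. (2 * pi * norm x)\<^sup>2 * norm (f x))"
  have C0: "C \<ge> 0" unfolding C_def by (intro Bochner_Integration.integral_nonneg) auto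
  have "linear D"
  proof
    show "D (h + h') = D h + D h'" for h h'
      unfolding D_def Bochner_Integration.integral_add[OF intD intD, symmetric]
      by (intro Bochner_Integration.integral_cong) (auto simp: inner_add_right algebra_simps)
    show "D (c *\<^sub>R h) = c *\<^sub>R D h" for c h
      unfolding D_def by (subst integral_scaleR_right[symmetric])
        (auto intro!: Bochner_Integration.integral_cong simp: scaleR_conv_of_real algebra_simps)
  qed
  then have bl: "bounded_linear D" by (rule linear_conv_bounded_linear[THEN iffD1])
  have est: "norm (fourier f \<eta> - fourier f \<xi> - D (\<eta> - \<xi>)) \<le> C * (norm (\<eta> - \<xi>))\<^sup>2" for \<eta>
  proof -
    define h where "h = \<eta> - \<xi>"
    have eq: "cis (- 2 * pi * (x \<bullet> \<eta>)) * f x - cis (- 2 * pi * (x \<bullet> \<xi>)) * f x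
        - (- 2 * pi * \<i>) * (complex_of_real (x \<bullet> h) * cis (- 2 * pi * (x \<bullet> \<xi>))) * f x
       = cis (- 2 * pi * (x \<bullet> \<xi>)) * (cis (- 2 * pi * (x \<bullet> h)) - 1 - \<i> * complex_of_real (- 2 * pi * (x \<bullet> h))) * f x"
      for x
    proof -
      have "- 2 * pi * (x \<bullet> \<eta>) = - 2 * pi * (x \<bullet> \<xi>) + - 2 * pi * (x \<bullet> h)"
        by (simp add: h_def inner_diff_right algebra_simps)
      then have "cis (- 2 * pi * (x \<bullet> \<eta>)) = cis (- 2 * pi * (x \<bullet> \<xi>)) * cis (- 2 * pi * (x \<bullet> h))"
        by (simp only: cis_mult)
      then show ?thesis by (simp add: algebra_simps)
    qed
    have "fourier f \<eta> - fourier f \<xi> - D h = (LINT x|lborel. cis (- 2 * pi * (x \<bullet> \<xi>)) *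
         (cis (- 2 * pi * (x \<bullet> h)) - 1 - \<i> * complex_of_real (- 2 * pi * (x \<bullet> h))) * f x)"
      unfolding fourier_def D_def eq[symmetric]
      by (simp only: Bochner_Integration.integral_diff[OF Bochner_Integration.integrable_diff[OF intF intF] intD]
          Bochner_Integration.integral_diff[OF intF intF])
    also have "norm \<dots> \<le> (LINT x|lborel. (norm h)\<^sup>2 * ((2 * pi * norm x)\<^sup>2 * norm (f x)))"
    proof (rule order_trans[OF integral_norm_bound integral_mono], rule integrable_norm)
      show "integrable lborel (\<lambda>x. cis (- 2 * pi * (x \<bullet> \<xi>)) *
         (cis (- 2 * pi * (x \<bullet> h)) - 1 - \<i> * complex_of_real (- 2 * pi * (x \<bullet> h))) * f x)"
        by (intro test_function_mult_integrable f continuous_intros)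
      show "integrable lborel (\<lambda>x. (norm h)\<^sup>2 * ((2 * pi * norm x)\<^sup>2 * norm (f x)))"
        using intC by simp
      fix x :: 'a
      have "norm (cis (- 2 * pi * (x \<bullet> h)) - 1 - \<i> * complex_of_real (- 2 * pi * (x \<bullet> h))) \<le> (- 2 * pi * (x \<bullet> h))\<^sup>2"
        by (rule norm_cis_minus_linear)
      also have "\<dots> = (2 * pi * \<bar>x \<bullet> h\<bar>)\<^sup>2" by (simp add: power_mult_distrib)
      also have "\<dots> \<le> (2 * pi * (norm x * norm h))\<^sup>2"
        by (intro power_mono mult_left_mono Cauchy_Schwarz_ineq2) auto
      also have "\<dots> = (norm h)\<^sup>2 * (2 * pi * norm x)\<^sup>2" by (simp add: power_mult_distrib)
      finally show "norm (cis (- 2 * pi * (x \<bullet> \<xi>)) *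
         (cis (- 2 * pi * (x \<bullet> h)) - 1 - \<i> * complex_of_real (- 2 * pi * (x \<bullet> h))) * f x)
         \<le> (norm h)\<^sup>2 * ((2 * pi * norm x)\<^sup>2 * norm (f x))"
        unfolding norm_mult norm_cis mult_1_left mult.assoc[symmetric] by (intro mult_right_mono) auto
    qed
    finally show ?thesis by (simp add: C_def h_def mult.commute)
  qed
  show ?thesis unfolding D_def[symmetric]
  proof (rule has_derivativeI_sandwich[where e = 1 and H = "\<lambda>\<eta>. C * norm (\<eta> - \<xi>)"])
    show "((\<lambda>\<eta>. C * norm (\<eta> - \<xi>)) \<longlongrightarrow> 0) (at \<xi>)"
      by (auto intro!: tendsto_eq_intros)
    show "norm (fourier f \<eta> - fourier f \<xi> - D (\<eta> - \<xi>)) / norm (\<eta> - \<xi>) \<le> C * norm (\<eta> - \<xi>)"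
      if "\<eta> \<noteq> \<xi>" for \<eta>
      using est[of \<eta>] that by (simp add: divide_le_eq power2_eq_square mult.assoc)
  qed (use bl in auto)
qed

section \<open>Fourier transforms of test functions\<close>

lemma frechet_derivative_fourier:
  assumes "test_function f"
  shows "frechet_derivative (fourier f) (at \<xi>) v
    = fourier (\<lambda>x. (- 2 * pi * \<i>) * (complex_of_real (x \<bullet> v) * f x)) \<xi>"
  unfolding frechet_derivative_at[OF fourier_has_derivative[OF assms], symmetric] fourier_def
  by (intro Bochner_Integration.integral_cong) (auto simp: algebra_simps)

text \<open>Multiplication by a coordinate preserves test functions, so derivatives of transforms
  are again transforms of test functions. The Schwartz bounds for all derivatives thus reduce to the
  decay of the transform itself.\<close>

lemma pderivs_fourier:
  assumes "test_function f" and "bs \<in> lists Basis"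
  shows "\<exists>g. test_function g \<and> pderivs bs (fourier f) = fourier g"
  using assms(2)
proof induction
  case (Cons b bs)
  then obtain g where "test_function g" "pderivs bs (fourier f) = fourier g" by auto
  then show ?case
    by (intro exI[of _ "\<lambda>x. (- 2 * pi * \<i>) * (complex_of_real (x \<bullet> b) * g x)"])
       (simp only: pderivs.simps frechet_derivative_fourier test_function_linear_multiple simp_thms)
qed (use assms in auto)

lemma smooth_fourier: "test_function (f :: 'a::euclidean_space \<Rightarrow> complex) \<Longrightarrow> smooth (fourier f)"
  unfolding smooth_def
proof (intro ballI allI)
  fix bs :: "'a list" and x :: 'a
  assume "test_function f" "bs \<in> lists Basis"
  then obtain g where "test_function g" "pderivs bs (fourier f) = fourier g"
    using pderivs_fourier by blast
  then show "pderivs bs (fourier f) differentiable (at x)"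
    using fourier_has_derivative[of g x] by (auto simp: differentiable_def)
qed

lemma norm_fourier_le: "norm (fourier f \<xi>) \<le> (LINT x|lborel. norm (f x))"
  unfolding fourier_def
  by (rule order_trans[OF integral_norm_bound]) (simp add: norm_mult)

lemma fourier_translate:
  fixes f :: "'a::euclidean_space \<Rightarrow> complex"
  assumes f: "integrable lborel f"
  shows "fourier (\<lambda>x. f (t + x)) \<xi> = cis (2 * pi * (t \<bullet> \<xi>)) * fourier f \<xi>"
proof -
  have [measurable]: "f \<in> borel_measurable borel" using borel_measurable_integrable[OF f] by simp
  have i: "integrable lborel (\<lambda>x. cis (- 2 * pi * (x \<bullet> \<xi>)) * f x)"
  proof (rule Bochner_Integration.integrable_bound[OF f])
    have "(\<lambda>x. cis (- 2 * pi * (x \<bullet> \<xi>))) \<in> borel_measurable borel"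
      by (intro borel_measurable_continuous_onI continuous_intros)
    then show "(\<lambda>x. cis (- 2 * pi * (x \<bullet> \<xi>)) * f x) \<in> borel_measurable lborel" by simp
  qed (auto simp: norm_mult)
  have "fourier f \<xi> = (LINT x|lborel. cis (- 2 * pi * ((t + x) \<bullet> \<xi>)) * f (t + x))"
    unfolding fourier_def using integral_lborel_affine[OF _ i, of 1 t] by simp
  also have "\<dots> = (LINT x|lborel. cis (- 2 * pi * (t \<bullet> \<xi>)) * (cis (- 2 * pi * (x \<bullet> \<xi>)) * f (t + x)))"
  proof (intro Bochner_Integration.integral_cong refl)
    fix x
    have "- 2 * pi * ((t + x) \<bullet> \<xi>) = - 2 * pi * (t \<bullet> \<xi>) + - 2 * pi * (x \<bullet> \<xi>)"
      by (simp add: inner_add_left algebra_simps)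
    then show "cis (- 2 * pi * ((t + x) \<bullet> \<xi>)) * f (t + x) =
        cis (- 2 * pi * (t \<bullet> \<xi>)) * (cis (- 2 * pi * (x \<bullet> \<xi>)) * f (t + x))"
      by (simp only: cis_mult[symmetric] mult.assoc)
  qed
  also have "\<dots> = cis (- 2 * pi * (t \<bullet> \<xi>)) * fourier (\<lambda>x. f (t + x)) \<xi>"
    by (simp add: fourier_def)
  finally have "cis (2 * pi * (t \<bullet> \<xi>)) * fourier f \<xi> = (cis (2 * pi * (t \<bullet> \<xi>)) * cis (- 2 * pi * (t \<bullet> \<xi>))) * fourier (\<lambda>x. f (t + x)) \<xi>"
    by simp
  then show ?thesis by (simp add: cis_mult)
qed

text \<open>Provides the dominating constant for the difference quotients in
  \<open>fourier_frechet_derivative\<close>.\<close>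

lemma test_function_lipschitz:
  assumes f: "test_function f" and b: "b \<in> Basis"
  shows "\<exists>B\<ge>0. \<forall>x t. norm (f (x + t *\<^sub>R b) - f x) \<le> B * \<bar>t\<bar>"
proof -
  obtain B where B: "B \<ge> 0" "\<And>x. norm (frechet_derivative f (at x) b) \<le> B"
    using test_function_bounded[OF test_function_frechet_derivative[OF f b]] by auto
  have "norm (f (x + t *\<^sub>R b) - f (x + 0 *\<^sub>R b)) \<le> B * norm (t - 0)" for x t
  proof (rule differentiable_bound[of UNIV "\<lambda>t. f (x + t *\<^sub>R b)" "\<lambda>t h. h *\<^sub>R frechet_derivative f (at (x + t *\<^sub>R b)) b"])
    show "((\<lambda>t. f (x + t *\<^sub>R b)) has_derivative (\<lambda>h. h *\<^sub>R frechet_derivative f (at (x + t *\<^sub>R b)) b)) (at t within UNIV)" for t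
    proof -
      have "((\<lambda>t. f (x + t *\<^sub>R b)) has_derivative (\<lambda>h. frechet_derivative f (at (x + t *\<^sub>R b)) (h *\<^sub>R b))) (at t)"
        by (rule has_derivative_compose[OF _ smooth_has_derivative[OF test_function_smooth[OF f]]])
           (auto intro!: derivative_eq_intros)
      moreover have "frechet_derivative f (at y) (h *\<^sub>R b) = h *\<^sub>R frechet_derivative f (at y) b" for y h
        using smooth_has_derivative[OF test_function_smooth[OF f], THEN has_derivative_linear] by (rule linear_scale)
      ultimately show ?thesis by simp
    qed
    show "onorm (\<lambda>h. h *\<^sub>R frechet_derivative f (at (x + t *\<^sub>R b)) b) \<le> B" for t
      by (rule onorm_le) (use B(2) in \<open>auto simp: mult.commute[of B] intro: mult_left_mono\<close>)
  qed auto
  then have "norm (f (x + t *\<^sub>R b) - f x) \<le> B * \<bar>t\<bar>" for x t by simp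
  with B(1) show ?thesis by blast
qed

lemma has_vector_derivative_quotient:
  assumes "(f has_vector_derivative v) (at 0)"
  shows "((\<lambda>s. (f s - f 0) /\<^sub>R s) \<longlongrightarrow> v) (at 0)"
proof -
  have "((\<lambda>s. norm ((f s - f 0) - s *\<^sub>R v) / norm s) \<longlongrightarrow> 0) (at 0)"
    using assms by (simp add: has_vector_derivative_def has_derivative_iff_norm)
  moreover have "\<forall>\<^sub>F s in at 0. norm ((f s - f 0) - s *\<^sub>R v) / norm s = norm ((f s - f 0) /\<^sub>R s - v)"
  proof (rule eventually_at_topological[THEN iffD2], intro exI[of _ UNIV] conjI ballI impI)
    fix s :: real assume "s \<noteq> 0"
    then have "(f s - f 0) /\<^sub>R s - v = (f s - f 0 - s *\<^sub>R v) /\<^sub>R s" by (simp add: scaleR_diff_right)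
    then show "norm ((f s - f 0) - s *\<^sub>R v) / norm s = norm ((f s - f 0) /\<^sub>R s - v)"
      by (simp add: divide_inverse mult.commute)
  qed auto
  ultimately have "((\<lambda>s. norm ((f s - f 0) /\<^sub>R s - v)) \<longlongrightarrow> 0) (at 0)"
    by (rule Lim_transform_eventually)
  then show ?thesis by (simp add: LIM_zero_iff tendsto_norm_zero_iff)
qed

text \<open>Takes the place of integration by parts: a translation multiplies the transform by a
  phase, so the transform of a difference quotient is a difference quotient of \<open>cis\<close>
  times the transform of f. Dominated convergence gives the limit on one side, the derivative of
  \<open>cis\<close> at 0 on the other.\<close>

lemma fourier_frechet_derivative:
  fixes f :: "'a::euclidean_space \<Rightarrow> complex"
  assumes f: "test_function f" and b: "b \<in> Basis"
  shows "fourier (\<lambda>x. frechet_derivative f (at x) b) \<xi> = 2 * pi * \<i> * (\<xi> \<bullet> b) * fourier f \<xi>"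
proof -
  define t where "t = (\<lambda>n. inverse (real (Suc n)))"
  have t: "t n > 0" "t n \<le> 1" for n by (auto simp: t_def field_simps)
  have t0: "t \<longlonglongrightarrow> 0" unfolding t_def by (rule LIMSEQ_inverse_real_of_nat)
  then have tat: "filterlim t (at 0) sequentially"
    using t(1) by (intro filterlim_atI) (auto simp: less_imp_neq[symmetric])
  define q where "q = (\<lambda>n x. (f (x + t n *\<^sub>R b) - f x) /\<^sub>R t n)"
  obtain R where R: "\<And>x. f x \<noteq> 0 \<Longrightarrow> norm x \<le> R"
    using f by (auto simp: test_function_iff)
  obtain B where B: "B \<ge> 0" "\<And>x t. norm (f (x + t *\<^sub>R b) - f x) \<le> B * \<bar>t\<bar>"
    using test_function_lipschitz[OF f b] by auto
  note [measurable] = smooth_measurable[OF test_function_smooth[OF f]]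
  have cm: "(\<lambda>x. cis (- 2 * pi * (x \<bullet> \<xi>))) \<in> borel_measurable borel"
    by (intro borel_measurable_continuous_onI continuous_intros)
  have fi: "integrable lborel (\<lambda>x. f (x + s *\<^sub>R b))" for s
    using test_function_integrable[OF test_function_affine[OF f, of 1 1 "s *\<^sub>R b"]] by (simp add: add.commute)
  have lim1: "(\<lambda>n. fourier (q n) \<xi>) \<longlonglongrightarrow> fourier (\<lambda>x. frechet_derivative f (at x) b) \<xi>"
    unfolding fourier_def
  \<comment> \<open>The shifts satisfy \<open>t n \<le> 1\<close>, so all difference quotients
    vanish outside the ball of radius R + 1.\<close>
  proof (rule integral_dominated_convergence[where w = "\<lambda>x. B * indicator (cball 0 (R + 1)) x"])
    show "integrable lborel (\<lambda>x::'a. B * indicator (cball 0 (R + 1)) x)"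
      using emeasure_lborel_cball_finite[of "0::'a" "R + 1"]
      by (intro integrable_mult_right integrable_real_indicator) (auto simp: top.not_eq_extremum)
    show "AE x in lborel. (\<lambda>n. cis (- 2 * pi * (x \<bullet> \<xi>)) * q n x)
         \<longlonglongrightarrow> cis (- 2 * pi * (x \<bullet> \<xi>)) * frechet_derivative f (at x) b"
    proof (intro AE_I2 tendsto_mult tendsto_const)
      fix x
      have "((\<lambda>s. f (x + s *\<^sub>R b)) has_derivative (\<lambda>h. frechet_derivative f (at (x + 0 *\<^sub>R b)) (h *\<^sub>R b))) (at 0)"
        by (rule has_derivative_compose[OF _ smooth_has_derivative[OF test_function_smooth[OF f]]])
           (auto intro!: derivative_eq_intros)
      moreover have "frechet_derivative f (at y) (h *\<^sub>R b) = h *\<^sub>R frechet_derivative f (at y) b" for y h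
        using smooth_has_derivative[OF test_function_smooth[OF f], THEN has_derivative_linear] by (rule linear_scale)
      ultimately have "((\<lambda>s. f (x + s *\<^sub>R b)) has_vector_derivative frechet_derivative f (at x) b) (at 0)"
        by (simp add: has_vector_derivative_def)
      then have "((\<lambda>s. (f (x + s *\<^sub>R b) - f (x + 0 *\<^sub>R b)) /\<^sub>R s) \<longlongrightarrow> frechet_derivative f (at x) b) (at 0)"
        by (rule has_vector_derivative_quotient)
      from filterlim_compose[OF this tat] show "(\<lambda>n. q n x) \<longlonglongrightarrow> frechet_derivative f (at x) b"
        by (simp add: q_def)
    qed
    show "AE x in lborel. norm (cis (- 2 * pi * (x \<bullet> \<xi>)) * q n x) \<le> B * indicator (cball 0 (R + 1)) x" for n
    proof (rule AE_I2)
      fix x :: 'a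
      show "norm (cis (- 2 * pi * (x \<bullet> \<xi>)) * q n x) \<le> B * indicator (cball 0 (R + 1)) x"
      proof (cases "norm x \<le> R + 1")
        case True
        have "norm (f (x + t n *\<^sub>R b) - f x) / t n \<le> B"
          using B(2)[of x "t n"] t(1)[of n] by (simp add: divide_le_eq)
        with True show ?thesis using t(1)[of n] by (simp add: q_def norm_mult divide_inverse mult.commute)
      next
        case False
        have "norm x \<le> norm (x + t n *\<^sub>R b) + norm (t n *\<^sub>R b)"
          by (metis add_diff_cancel_right' norm_triangle_ineq4)
        then have "norm x \<le> norm (x + t n *\<^sub>R b) + 1"
          using t[of n] b by simp
        with False have "f x = 0" "f (x + t n *\<^sub>R b) = 0" using R[of x] R[of "x + t n *\<^sub>R b"] by force+
        with B show ?thesis by (simp add: q_def)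
      qed
    qed
    show "(\<lambda>x. cis (- 2 * pi * (x \<bullet> \<xi>)) * q n x) \<in> borel_measurable lborel" for n
      unfolding q_def using cm by measurable
    show "(\<lambda>x. cis (- 2 * pi * (x \<bullet> \<xi>)) * frechet_derivative f (at x) b) \<in> borel_measurable lborel"
      using cm smooth_measurable[OF smooth_frechet_derivative[OF test_function_smooth[OF f] b]] by measurable
  qed
  have qn: "fourier (q n) \<xi> = (cis (t n * (2 * pi * (\<xi> \<bullet> b))) - 1) /\<^sub>R t n * fourier f \<xi>" for n
  proof -
    have i1: "integrable lborel (\<lambda>x. cis (- 2 * pi * (x \<bullet> \<xi>)) * f (x + s *\<^sub>R b))" for s
      using cm by (intro Bochner_Integration.integrable_bound[OF fi[of s]]) (auto simp: norm_mult intro: AE_I2)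
    have "fourier (q n) \<xi> = (LINT x|lborel. (cis (- 2 * pi * (x \<bullet> \<xi>)) * f (x + t n *\<^sub>R b)
        - cis (- 2 * pi * (x \<bullet> \<xi>)) * f (x + 0 *\<^sub>R b)) /\<^sub>R t n)"
      unfolding fourier_def q_def
      by (intro Bochner_Integration.integral_cong) (auto simp: right_diff_distrib)
    also have "\<dots> = (fourier (\<lambda>x. f (x + t n *\<^sub>R b)) \<xi> - fourier (\<lambda>x. f (x + 0 *\<^sub>R b)) \<xi>) /\<^sub>R t n"
      unfolding fourier_def integral_scaleR_right by (subst Bochner_Integration.integral_diff[OF i1 i1]) (rule refl)
    also have "fourier (\<lambda>x. f (x + t n *\<^sub>R b)) \<xi> = cis (2 * pi * ((t n *\<^sub>R b) \<bullet> \<xi>)) * fourier f \<xi>"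
      using fourier_translate[OF test_function_integrable[OF f], of "t n *\<^sub>R b"] by (simp add: add.commute)
    also have "2 * pi * ((t n *\<^sub>R b) \<bullet> \<xi>) = t n * (2 * pi * (\<xi> \<bullet> b))"
      by (simp add: inner_commute)
    finally show ?thesis by (simp add: algebra_simps)
  qed
  have lim2: "(\<lambda>n. (cis (t n * (2 * pi * (\<xi> \<bullet> b))) - 1) /\<^sub>R t n * fourier f \<xi>) \<longlonglongrightarrow> 2 * pi * \<i> * (\<xi> \<bullet> b) * fourier f \<xi>"
  proof (intro tendsto_mult tendsto_const)
    define a where "a = 2 * pi * (\<xi> \<bullet> b)"
    have "((\<lambda>s. cis (s * a)) has_vector_derivative (\<i> * a)) (at 0)"
      unfolding cis_conv_exp of_real_mult
      by (rule has_vector_derivative_real_field[where f = "\<lambda>z. exp (\<i> * (z * complex_of_real a))"])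
         (auto intro!: derivative_eq_intros)
    then have "((\<lambda>s. (cis (s * a) - cis (0 * a)) /\<^sub>R s) \<longlongrightarrow> \<i> * a) (at 0)"
      by (rule has_vector_derivative_quotient)
    from filterlim_compose[OF this tat] show "(\<lambda>n. (cis (t n * (2 * pi * (\<xi> \<bullet> b))) - 1) /\<^sub>R t n) \<longlonglongrightarrow> 2 * pi * \<i> * (\<xi> \<bullet> b)"
      by (simp add: a_def algebra_simps)
  qed
  show ?thesis
    by (rule LIMSEQ_unique[OF lim1]) (use lim2 qn in simp)
qed

text \<open>Each factor of the coordinate is traded for a derivative of f in the direction
  \<open>b\<close>; hence f varies in the induction. The factor 2 pi is at least 1 and is given
  away.\<close>

lemma fourier_coordinate_decay:
  assumes f: "test_function f" and b: "b \<in> Basis"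
  shows "\<exists>B\<ge>0. \<forall>\<xi>. \<bar>\<xi> \<bullet> b\<bar> ^ k * norm (fourier f \<xi>) \<le> B"
  using f
proof (induction k arbitrary: f)
  case 0
  show ?case
    by (intro exI[of _ "LINT x|lborel. norm (f x)"]) (auto simp: norm_fourier_le)
next
  case (Suc k)
  obtain B where B: "B \<ge> 0" "\<And>\<xi>. \<bar>\<xi> \<bullet> b\<bar> ^ k * norm (fourier (\<lambda>x. frechet_derivative f (at x) b) \<xi>) \<le> B"
    using Suc.IH[OF test_function_frechet_derivative[OF Suc.prems b]] by auto
  have "\<bar>\<xi> \<bullet> b\<bar> ^ Suc k * norm (fourier f \<xi>) \<le> B" for \<xi>
  proof -
    have "\<bar>\<xi> \<bullet> b\<bar> ^ Suc k * norm (fourier f \<xi>) = \<bar>\<xi> \<bullet> b\<bar> ^ k * (1 * (\<bar>\<xi> \<bullet> b\<bar> * norm (fourier f \<xi>)))"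
      by simp
    also have "\<dots> \<le> \<bar>\<xi> \<bullet> b\<bar> ^ k * ((2 * pi) * (\<bar>\<xi> \<bullet> b\<bar> * norm (fourier f \<xi>)))"
      using pi_gt3 by (intro mult_left_mono mult_right_mono) auto
    also have "\<dots> = \<bar>\<xi> \<bullet> b\<bar> ^ k * norm (fourier (\<lambda>x. frechet_derivative f (at x) b) \<xi>)"
      by (simp add: fourier_frechet_derivative[OF Suc.prems b] norm_mult)
    finally show ?thesis using B(2)[of \<xi>] by simp
  qed
  then show ?case using B(1) by blast
qed

text \<open>The norm is at most d times the largest coordinate. This passes from decay in each
  coordinate to decay in the norm.\<close>

lemma norm_power_le_sum_Basis:
  fixes x :: "'a::euclidean_space"
  shows "norm x ^ k \<le> real DIM('a) ^ k * (\<Sum>b\<in>Basis. \<bar>x \<bullet> b\<bar> ^ k)"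
proof -
  obtain c :: 'a where c: "c \<in> Basis" "\<And>b. b \<in> Basis \<Longrightarrow> \<bar>x \<bullet> b\<bar> \<le> \<bar>x \<bullet> c\<bar>"
  proof -
    have "Max ((\<lambda>b. \<bar>x \<bullet> b\<bar>) ` Basis) \<in> (\<lambda>b. \<bar>x \<bullet> b\<bar>) ` Basis"
      by (rule Max_in) auto
    then obtain c where c: "c \<in> Basis" "Max ((\<lambda>b. \<bar>x \<bullet> b\<bar>) ` Basis) = \<bar>x \<bullet> c\<bar>" by (elim imageE) (rule that)
    have "\<bar>x \<bullet> b\<bar> \<le> \<bar>x \<bullet> c\<bar>" if "b \<in> Basis" for b
      unfolding c(2)[symmetric] using that by (intro Max_ge) auto
    with c(1) show ?thesis by (rule that)
  qed
  have "norm x \<le> (\<Sum>b\<in>Basis. \<bar>x \<bullet> b\<bar>)" by (rule norm_le_l1)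
  also have "\<dots> \<le> real DIM('a) * \<bar>x \<bullet> c\<bar>" using c(2) by (intro sum_bounded_above) auto
  finally have "norm x ^ k \<le> (real DIM('a) * \<bar>x \<bullet> c\<bar>) ^ k" by (intro power_mono) auto
  also have "\<dots> = real DIM('a) ^ k * \<bar>x \<bullet> c\<bar> ^ k" by (simp add: power_mult_distrib)
  also have "\<dots> \<le> real DIM('a) ^ k * (\<Sum>b\<in>Basis. \<bar>x \<bullet> b\<bar> ^ k)"
    using c(1) by (intro mult_left_mono member_le_sum) auto
  finally show ?thesis .
qed

lemma fourier_in_schwartz:
  fixes f :: "'a::euclidean_space \<Rightarrow> complex"
  assumes f: "test_function f"
  shows "fourier f \<in> schwartz"
proof -
  have *: "bdd_above (range (\<lambda>\<xi>. norm \<xi> ^ k * norm (fourier g \<xi>)))" if g: "test_function g" for k and g :: "'a \<Rightarrow> complex"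
  proof -
    obtain B where B: "\<And>b \<xi>. b \<in> Basis \<Longrightarrow> \<bar>\<xi> \<bullet> b\<bar> ^ k * norm (fourier g \<xi>) \<le> B b"
      using fourier_coordinate_decay[OF g, of _ k] by metis
    have "norm \<xi> ^ k * norm (fourier g \<xi>) \<le> real DIM('a) ^ k * (\<Sum>b\<in>Basis. B b)" for \<xi>
    proof -
      have "norm \<xi> ^ k * norm (fourier g \<xi>) \<le> real DIM('a) ^ k * (\<Sum>b\<in>Basis. \<bar>\<xi> \<bullet> b\<bar> ^ k) * norm (fourier g \<xi>)"
        by (intro mult_right_mono norm_power_le_sum_Basis) auto
      also have "\<dots> = real DIM('a) ^ k * (\<Sum>b\<in>Basis. \<bar>\<xi> \<bullet> b\<bar> ^ k * norm (fourier g \<xi>))"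
        by (simp add: sum_distrib_right)
      also have "\<dots> \<le> real DIM('a) ^ k * (\<Sum>b\<in>Basis. B b)"
        by (intro mult_left_mono sum_mono B) auto
      finally show ?thesis .
    qed
    then show ?thesis by (intro bdd_aboveI2)
  qed
  then show ?thesis
    unfolding schwartz_def
  proof (intro CollectI conjI allI ballI smooth_fourier f)
    fix k and bs :: "'a list" assume "bs \<in> lists Basis"
    then obtain g where "test_function g" "pderivs bs (fourier f) = fourier g"
      using pderivs_fourier[OF f] by blast
    then show "bdd_above (range (\<lambda>x. norm x ^ k * norm (pderivs bs (fourier f) x)))"
      using * by simp
  qed
qed

text \<open>The reciprocal of the left side is an integrable product of one-variable functions; the
  right side is what the Schwartz bounds with powers 0 and 2 d control.\<close>

lemma prod_one_plus_square_le:
  fixes x :: "'a::euclidean_space"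
  shows "(\<Prod>b\<in>Basis. 1 + (x \<bullet> b)\<^sup>2) \<le> 2 ^ DIM('a) * (1 + norm x ^ (2 * DIM('a)))"
proof -
  have "(\<Prod>b\<in>Basis. 1 + (x \<bullet> b)\<^sup>2) \<le> (\<Prod>b\<in>(Basis::'a set). 1 + (norm x)\<^sup>2)"
  proof (intro prod_mono conjI)
    fix b :: 'a assume "b \<in> Basis"
    then have "\<bar>x \<bullet> b\<bar>\<^sup>2 \<le> (norm x)\<^sup>2" by (intro power_mono Basis_le_norm) auto
    then show "1 + (x \<bullet> b)\<^sup>2 \<le> 1 + (norm x)\<^sup>2" by simp
  qed simp
  also have "\<dots> = (1 + (norm x)\<^sup>2) ^ DIM('a)" by simp
  also have "\<dots> \<le> (2 * max 1 ((norm x)\<^sup>2)) ^ DIM('a)"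
    by (intro power_mono) auto
  also have "\<dots> = 2 ^ DIM('a) * (max 1 ((norm x)\<^sup>2)) ^ DIM('a)"
    by (simp add: power_mult_distrib)
  also have "\<dots> \<le> 2 ^ DIM('a) * (1 + norm x ^ (2 * DIM('a)))"
    by (intro mult_left_mono) (auto simp: max_def power_mult)
  finally show ?thesis .
qed

lemma schwartz_bounded: "f \<in> schwartz \<Longrightarrow> \<exists>B\<ge>0. \<forall>x. norm x ^ k * norm (f x) \<le> B"
proof -
  assume "f \<in> schwartz"
  then have "bdd_above (range (\<lambda>x. norm x ^ k * norm (pderivs [] f x)))"
    unfolding schwartz_def mem_Collect_eq by (metis lists.Nil)
  then obtain B where B: "\<And>x. norm x ^ k * norm (f x) \<le> B" by (auto simp: bdd_above_def)
  show ?thesis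
    by (intro exI[of _ B] conjI allI B order_trans[OF _ B[of 0]]) simp
qed

lemma schwartz_integrable:
  fixes f :: "'a::euclidean_space \<Rightarrow> complex"
  assumes f: "f \<in> schwartz"
  shows "integrable lborel f"
proof -
  obtain B0 where B0: "\<And>x. norm (f x) \<le> B0" "B0 \<ge> 0" using schwartz_bounded[OF f, of 0] by auto
  obtain B1 where B1: "\<And>x. norm x ^ (2 * DIM('a)) * norm (f x) \<le> B1" "B1 \<ge> 0"
    using schwartz_bounded[OF f, of "2 * DIM('a)"] by auto
  define w where "w = (\<lambda>x::'a. \<Prod>b\<in>Basis. inverse (1 + (x \<bullet> b)\<^sup>2))"
  have "integrable lborel (\<lambda>t::real. inverse (1 + t\<^sup>2))"
    using integrable_inverse_1_plus_square by (simp add: set_integrable_def)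
  then have wi: "integrable lborel w"
    unfolding w_def by (intro integrable_lborel_prod)
  show ?thesis
  proof (rule Bochner_Integration.integrable_bound)
    show "integrable lborel (\<lambda>x. 2 ^ DIM('a) * (B0 + B1) * w x)" using wi by simp
    show "f \<in> borel_measurable lborel" using f smooth_measurable by (auto simp: schwartz_def)
    show "AE x in lborel. norm (f x) \<le> norm (2 ^ DIM('a) * (B0 + B1) * w x)"
    proof (rule AE_I2)
      fix x :: 'a
      have P: "(\<Prod>b\<in>Basis. 1 + (x \<bullet> b)\<^sup>2) > 0" by (intro prod_pos) (auto intro: add_pos_nonneg)
      have "(\<Prod>b\<in>Basis. 1 + (x \<bullet> b)\<^sup>2) * norm (f x) \<le> 2 ^ DIM('a) * (1 + norm x ^ (2 * DIM('a))) * norm (f x)"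
        by (intro mult_right_mono prod_one_plus_square_le) auto
      also have "\<dots> = 2 ^ DIM('a) * (norm (f x) + norm x ^ (2 * DIM('a)) * norm (f x))"
        by (simp add: algebra_simps)
      also have "\<dots> \<le> 2 ^ DIM('a) * (B0 + B1)"
        by (intro mult_left_mono add_mono B0 B1) auto
      finally have "norm (f x) \<le> 2 ^ DIM('a) * (B0 + B1) * inverse (\<Prod>b\<in>Basis. 1 + (x \<bullet> b)\<^sup>2)"
        using P by (simp add: divide_inverse[symmetric] pos_le_divide_eq mult.commute)
      then have "norm (f x) \<le> 2 ^ DIM('a) * (B0 + B1) * w x"
        unfolding w_def prod_inversef[unfolded o_def] .
      also have "\<dots> \<le> norm (2 ^ DIM('a) * (B0 + B1) * w x)" by simp
      finally show "norm (f x) \<le> norm (2 ^ DIM('a) * (B0 + B1) * w x)" .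
    qed
  qed
qed

section \<open>Fourier inversion for test functions\<close>

lemma integrable_cis_mult:
  fixes f :: "'a::euclidean_space \<Rightarrow> complex"
  assumes f: "integrable M f" and M: "sets M = sets borel" and g: "continuous_on UNIV g"
  shows "integrable M (\<lambda>x. cis (g x) * f x)"
proof (rule Bochner_Integration.integrable_bound[OF f])
  have "(\<lambda>x. cis (g x)) \<in> borel_measurable borel"
    by (intro borel_measurable_continuous_onI continuous_intros g)
  then have "(\<lambda>x. cis (g x)) \<in> borel_measurable M" using measurable_cong_sets[OF M refl] by blast
  then show "(\<lambda>x. cis (g x) * f x) \<in> borel_measurable M"
    using borel_measurable_integrable[OF f] by (rule borel_measurable_times)
qed (auto simp: norm_mult)

text \<open>The Gaussian factor makes Fubini applicable. Its transform is the Gaussian of width r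
  around y, and an affine substitution brings that integral into a form in which r can tend to 0
  inside f.\<close>

lemma fourier_inversion_gauss:
  fixes f :: "'a::euclidean_space \<Rightarrow> complex"
  assumes f: "integrable lborel f" and r: "r > 0"
  shows "(LINT \<xi>|lborel. complex_of_real (gauss (r *\<^sub>R \<xi>)) * (cis (2 * pi * (\<xi> \<bullet> y)) * fourier f \<xi>))
    = (LINT x|lborel. complex_of_real (gauss x) * f (y + r *\<^sub>R x))"
proof -
  have gi: "integrable lborel (\<lambda>\<xi>::'a. complex_of_real (gauss (r *\<^sub>R \<xi>)))"
    using integrable_of_real[OF integrable_gauss_affine[of r 0]] r by simp
  have "(LINT \<xi>|lborel. complex_of_real (gauss (r *\<^sub>R \<xi>)) * (cis (2 * pi * (\<xi> \<bullet> y)) * fourier f \<xi>))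
     = (LINT \<xi>|lborel. complex_of_real (gauss (r *\<^sub>R \<xi>)) * (LINT x|lborel. cis (2 * pi * ((y - x) \<bullet> \<xi>)) * f x))"
  proof (intro Bochner_Integration.integral_cong refl arg_cong2[where f = "(*)"])
    fix \<xi> :: 'a
    have "2 * pi * ((y - x) \<bullet> \<xi>) = 2 * pi * (\<xi> \<bullet> y) + - 2 * pi * (x \<bullet> \<xi>)" for x
      by (simp add: inner_diff_left inner_commute algebra_simps)
    then have "cis (2 * pi * ((y - x) \<bullet> \<xi>)) = cis (2 * pi * (\<xi> \<bullet> y)) * cis (- 2 * pi * (x \<bullet> \<xi>))" for x
      by (simp only: cis_mult)
    then show "cis (2 * pi * (\<xi> \<bullet> y)) * fourier f \<xi> = (LINT x|lborel. cis (2 * pi * ((y - x) \<bullet> \<xi>)) * f x)"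
      by (simp add: fourier_def mult.assoc)
  qed
  also have "\<dots> = (LINT x|lborel. f x * (LINT \<xi>|lborel. cis (2 * pi * ((y - x) \<bullet> \<xi>)) * complex_of_real (gauss (r *\<^sub>R \<xi>))))"
  proof (rule integral_swap_bounded[OF _ _ gi f, where B = 1])
    show "(\<lambda>(\<xi>, x). cis (2 * pi * ((y - x) \<bullet> \<xi>))) \<in> borel_measurable (lborel \<Otimes>\<^sub>M lborel)"
      unfolding split_beta' lborel_prod
      by (simp, intro borel_measurable_continuous_onI continuous_intros)
  qed (auto intro: lborel.sigma_finite_measure_axioms)
  also have "\<dots> = (LINT x|lborel. f x * complex_of_real ((1 / r) ^ DIM('a) * gauss ((1 / r) *\<^sub>R (y - x))))"
    using integral_cis_gauss_scaled[of "1 / r" "y - x" for x] r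
    by (simp add: inner_commute)
  also have "\<dots> = (LINT x|lborel. complex_of_real (gauss x) * f (y + r *\<^sub>R x))"
  proof -
    define g where "g = (\<lambda>x. f x * complex_of_real ((1 / r) ^ DIM('a) * gauss ((1 / r) *\<^sub>R (y - x))))"
    have [measurable]: "f \<in> borel_measurable borel" using borel_measurable_integrable[OF f] by simp
    have "integrable lborel g"
    proof (rule Bochner_Integration.integrable_bound)
      show "integrable lborel (\<lambda>x. (1 / r) ^ DIM('a) *\<^sub>R f x)" using f by simp
      show "g \<in> borel_measurable lborel" unfolding g_def by measurable
      show "AE x in lborel. norm (g x) \<le> norm ((1 / r) ^ DIM('a) *\<^sub>R f x)"
      proof (rule AE_I2)
        fix x
        have "norm (g x) = norm (f x) * ((1 / r) ^ DIM('a) * gauss ((1 / r) *\<^sub>R (y - x)))"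
          unfolding g_def norm_mult norm_of_real using r by (simp add: abs_mult)
        also have "\<dots> \<le> norm (f x) * ((1 / r) ^ DIM('a) * 1)"
          using r by (intro mult_left_mono gauss_le_1) auto
        finally show "norm (g x) \<le> norm ((1 / r) ^ DIM('a) *\<^sub>R f x)" using r by (simp add: mult.commute)
      qed
    qed
    then have "(LINT x|lborel. g x) = \<bar>r\<bar> ^ DIM('a) *\<^sub>R (LINT x|lborel. g (y + r *\<^sub>R x))"
      using r by (intro integral_lborel_affine) auto
    also have "\<dots> = (LINT x|lborel. \<bar>r\<bar> ^ DIM('a) *\<^sub>R g (y + r *\<^sub>R x))" by simp
    also have "\<dots> = (LINT x|lborel. complex_of_real (gauss x) * f (y + r *\<^sub>R x))"
      using r by (intro Bochner_Integration.integral_cong) (auto simp: g_def scaleR_conv_of_real power_one_over)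
    finally show ?thesis unfolding g_def .
  qed
  finally show ?thesis .
qed

text \<open>Let r tend to 0 in \<open>fourier_inversion_gauss\<close>: the left side is dominated by
  the integrable transform, the right side by a multiple of the Gaussian, whose integral is
  1.\<close>

lemma fourier_inversion:
  fixes f :: "'a::euclidean_space \<Rightarrow> complex"
  assumes f: "test_function f"
  shows "(LINT \<xi>|lborel. cis (2 * pi * (\<xi> \<bullet> y)) * fourier f \<xi>) = f y"
proof -
  define r where "r = (\<lambda>n. inverse (real (Suc n)))"
  have r: "r n > 0" for n by (auto simp: r_def field_simps)
  have r0: "r \<longlonglongrightarrow> 0" unfolding r_def by (rule LIMSEQ_inverse_real_of_nat)
  have Fi: "integrable lborel (\<lambda>\<xi>. cis (2 * pi * (\<xi> \<bullet> y)) * fourier f \<xi>)"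
    by (intro integrable_cis_mult schwartz_integrable fourier_in_schwartz f continuous_intros) simp
  note [measurable] = borel_measurable_integrable[OF Fi] smooth_measurable[OF test_function_smooth[OF f]]
  obtain B where B: "B \<ge> 0" "\<And>x. norm (f x) \<le> B" using test_function_bounded[OF f] by auto
  have "(\<lambda>n. LINT \<xi>|lborel. complex_of_real (gauss (r n *\<^sub>R \<xi>)) * (cis (2 * pi * (\<xi> \<bullet> y)) * fourier f \<xi>))
      \<longlonglongrightarrow> (LINT \<xi>|lborel. complex_of_real (gauss (0 *\<^sub>R \<xi>)) * (cis (2 * pi * (\<xi> \<bullet> y)) * fourier f \<xi>))"
  proof (rule integral_dominated_convergence[OF _ _ integrable_norm[OF Fi]])
    show "AE \<xi> in lborel. (\<lambda>n. complex_of_real (gauss (r n *\<^sub>R \<xi>)) * (cis (2 * pi * (\<xi> \<bullet> y)) * fourier f \<xi>))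
        \<longlonglongrightarrow> complex_of_real (gauss (0 *\<^sub>R \<xi>)) * (cis (2 * pi * (\<xi> \<bullet> y)) * fourier f \<xi>)"
      unfolding gauss_def by (intro AE_I2 tendsto_intros r0)
    show "AE \<xi> in lborel. norm (complex_of_real (gauss (r n *\<^sub>R \<xi>)) * (cis (2 * pi * (\<xi> \<bullet> y)) * fourier f \<xi>))
        \<le> norm (cis (2 * pi * (\<xi> \<bullet> y)) * fourier f \<xi>)" for n
      by (auto simp: norm_mult intro!: AE_I2 mult_left_le_one_le)
  qed measurable
  then have lim1: "(\<lambda>n. LINT x|lborel. complex_of_real (gauss x) * f (y + r n *\<^sub>R x))
      \<longlonglongrightarrow> (LINT \<xi>|lborel. cis (2 * pi * (\<xi> \<bullet> y)) * fourier f \<xi>)"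
    unfolding fourier_inversion_gauss[OF test_function_integrable[OF f] r] by (simp add: gauss_def)
  have "(\<lambda>n. LINT x|lborel. complex_of_real (gauss x) * f (y + r n *\<^sub>R x))
      \<longlonglongrightarrow> (LINT x|lborel. complex_of_real (gauss x) * f (y + 0 *\<^sub>R x))"
  proof (rule integral_dominated_convergence[where w = "\<lambda>x. gauss x * B"])
    show "AE x in lborel. (\<lambda>n. complex_of_real (gauss x) * f (y + r n *\<^sub>R x))
        \<longlonglongrightarrow> complex_of_real (gauss x) * f (y + 0 *\<^sub>R x)"
    proof (intro AE_I2 tendsto_mult tendsto_const)
      fix x
      show "(\<lambda>n. f (y + r n *\<^sub>R x)) \<longlonglongrightarrow> f (y + 0 *\<^sub>R x)"
        using smooth_continuous_on[OF test_function_smooth[OF f], of UNIV]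
        by (intro continuous_on_tendsto_compose[of UNIV f] tendsto_intros r0) auto
    qed
    show "AE x in lborel. norm (complex_of_real (gauss x) * f (y + r n *\<^sub>R x)) \<le> gauss x * B" for n
      using B by (auto simp: norm_mult intro!: AE_I2 mult_left_mono)
  qed (use integrable_gauss in \<open>auto intro: integrable_mult_left\<close>)
  also have "(LINT x|lborel. complex_of_real (gauss x) * f (y + 0 *\<^sub>R x)) = f y"
    by (simp add: integral_gauss)
  finally show ?thesis using lim1 LIMSEQ_unique by blast
qed

section \<open>Measures with the growth condition\<close>

lemma closed_msupp: "closed (msupp \<mu>)"
proof -
  have "- msupp \<mu> = \<Union>{U. open U \<and> \<not> emeasure \<mu> U > 0}"
    by (auto simp: msupp_def)
  then have "open (- msupp \<mu>)" by auto
  then show ?thesis by (simp add: closed_def)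
qed

text \<open>The complement of the support is a union of open null sets, and by Lindelof countably
  many of them cover it.\<close>

lemma AE_in_msupp:
  assumes "sets \<mu> = sets borel"
  shows "AE x in \<mu>. x \<in> msupp \<mu>"
proof -
  define F where "F = {U. open U \<and> \<not> emeasure \<mu> U > 0}"
  obtain F' where F': "F' \<subseteq> F" "countable F'" "\<Union>F' = \<Union>F"
    using Lindelof[of F] unfolding F_def by (metis (no_types, lifting) mem_Collect_eq)
  have "(\<Union>U\<in>F'. U) \<in> null_sets \<mu>"
    using F' assms by (intro null_sets_UN') (auto simp: F_def null_sets_def)
  moreover have "- msupp \<mu> = \<Union>F"
    by (auto simp: msupp_def F_def)
  ultimately have "- msupp \<mu> \<in> null_sets \<mu>" using F'(3) by simp
  then show ?thesis by (rule AE_I') auto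
qed

text \<open>The condition stops at the diameter of the support, but a ball of that radius around a
  point of the support already carries the whole measure. So the measure is finite and the same
  bound persists for larger radii.\<close>

lemma growth_condition_cball:
  fixes \<mu> :: "'a::euclidean_space measure"
  assumes \<mu>: "compactly_supported_borel_measure \<mu>" and growth: "growth_condition \<mu> s"
    and s: "s > 0"
  shows "finite_measure \<mu>"
    and "\<exists>C\<ge>0. \<forall>x\<in>msupp \<mu>. \<forall>r\<ge>0. emeasure \<mu> (cball x r) \<le> ennreal (C * r powr s)"
proof -
  have sets: "sets \<mu> = sets borel" and comp: "compact (msupp \<mu>)"
    using \<mu> by (auto simp: compactly_supported_borel_measure_def)
  have space: "space \<mu> = UNIV" using sets_eq_imp_space_eq[OF sets] by simp
  define D where "D = diameter (msupp \<mu>)"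
  obtain C where "\<forall>x\<in>msupp \<mu>. \<forall>r\<in>{0..D}. emeasure \<mu> (cball x r) \<le> ennreal (C * r powr s)"
    using growth unfolding growth_condition_def D_def[symmetric] by (elim exE) (rule that)
  then have C: "emeasure \<mu> (cball x r) \<le> ennreal (C * r powr s)" if "x \<in> msupp \<mu>" "r \<in> {0..D}" for x r
    using that by simp
  have D0: "D \<ge> 0" unfolding D_def by (rule diameter_ge_0) (rule compact_imp_bounded[OF comp])
  have total: "emeasure \<mu> UNIV \<le> ennreal (C * D powr s)" if "x \<in> msupp \<mu>" for x
  proof -
    have "emeasure \<mu> UNIV \<le> emeasure \<mu> (cball x D)"
    proof (rule emeasure_mono_AE)
      show "AE y in \<mu>. y \<in> UNIV \<longrightarrow> y \<in> cball x D"
        using AE_in_msupp[OF sets]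
      proof eventually_elim
        fix y assume "y \<in> msupp \<mu>"
        then have "dist x y \<le> D"
          unfolding D_def by (intro diameter_bounded_bound compact_imp_bounded[OF comp] that)
        then show "y \<in> UNIV \<longrightarrow> y \<in> cball x D" by simp
      qed
    qed (use sets in auto)
    also have "\<dots> \<le> ennreal (C * D powr s)" using D0 that by (intro C) auto
    finally show ?thesis .
  qed
  have "emeasure \<mu> UNIV < \<infinity>"
  \<comment> \<open>An empty support offers no centre for a ball; then the measure is zero.\<close>
  proof (cases "msupp \<mu> = {}")
    case True
    then have "AE x in \<mu>. x \<notin> UNIV" using AE_in_msupp[OF sets] by simp
    then have "emeasure \<mu> UNIV = 0"
      by (subst (asm) AE_iff_measurable[of UNIV]) (auto simp: space sets)
    then show ?thesis by simp
  next
    case False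
    then obtain x where "x \<in> msupp \<mu>" by auto
    from total[OF this] show ?thesis by (rule le_less_trans) simp
  qed
  then show "finite_measure \<mu>" by (intro finite_measureI) (auto simp: space)
  have bound: "emeasure \<mu> (cball x r) \<le> ennreal (max C 0 * r powr s)" if x: "x \<in> msupp \<mu>" and r: "r \<ge> 0" for x r
  proof (cases "r \<le> D")
    case True
    then have "emeasure \<mu> (cball x r) \<le> ennreal (C * r powr s)" using C[OF x] r by simp
    also have "\<dots> \<le> ennreal (max C 0 * r powr s)" by (intro ennreal_leI mult_right_mono) auto
    finally show ?thesis .
  next
    case False
    have "emeasure \<mu> (cball x r) \<le> emeasure \<mu> UNIV" by (intro emeasure_mono) (auto simp: sets)
    also have "\<dots> \<le> ennreal (C * D powr s)" by (rule total[OF x])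
    also have "\<dots> \<le> ennreal (max C 0 * r powr s)"
      using False D0 s by (intro ennreal_leI mult_mono powr_mono2) auto
    finally show ?thesis .
  qed
  show "\<exists>C\<ge>0. \<forall>x\<in>msupp \<mu>. \<forall>r\<ge>0. emeasure \<mu> (cball x r) \<le> ennreal (C * r powr s)"
    by (intro exI[of _ "max C 0"] conjI ballI allI impI bound) simp
qed

text \<open>Cut the space into shells n <= R |x - y| < n + 1: the Gaussian is at most exp(-pi n^2)
  there and the shell lies in a ball of mass at most C ((n + 1) / R)^s. The resulting series
  converges and does not depend on x or R.\<close>

lemma gauss_potential_bound:
  fixes \<mu> :: "'a::euclidean_space measure"
  assumes \<mu>: "compactly_supported_borel_measure \<mu>" and growth: "growth_condition \<mu> s"
    and s: "s > 0"
  shows "\<exists>A\<ge>0. \<forall>x\<in>msupp \<mu>. \<forall>R>0. (LINT y|\<mu>. gauss (R *\<^sub>R (x - y))) \<le> A * R powr (- s)"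
proof -
  have sets: "sets \<mu> = sets borel" using \<mu> by (auto simp: compactly_supported_borel_measure_def)
  interpret finite_measure \<mu> using growth_condition_cball(1)[OF assms] .
  obtain C where C: "C \<ge> 0" "\<And>x r. x \<in> msupp \<mu> \<Longrightarrow> r \<ge> 0 \<Longrightarrow> emeasure \<mu> (cball x r) \<le> ennreal (C * r powr s)"
    using growth_condition_cball(2)[OF assms] by auto
  define w where "w = (\<lambda>n::nat. exp (- pi * (real n)\<^sup>2) * real (Suc n) powr s)"
  have w0: "w n \<ge> 0" for n by (simp add: w_def)
  have sw: "summable w"
  proof (rule summable_comparison_test_bigo)
    show "summable (\<lambda>n. norm (1 / real n ^ 2))" using inverse_power_summable[of 2] by (simp add: divide_inverse)
    show "w \<in> O(\<lambda>n. 1 / real n ^ 2)" unfolding w_def using s by real_asymp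
  qed
  have "(LINT y|\<mu>. gauss (R *\<^sub>R (x - y))) \<le> (C * suminf w) * R powr (- s)" if x: "x \<in> msupp \<mu>" and R: "R > 0" for x R
  proof -
    have gm: "(\<lambda>y. gauss (R *\<^sub>R (x - y))) \<in> borel_measurable \<mu>"
      unfolding measurable_cong_sets[OF sets refl] by measurable
    have "ennreal (gauss (R *\<^sub>R (x - y))) \<le> (\<Sum>n. ennreal (exp (- pi * (real n)\<^sup>2)) * indicator (cball x (real (Suc n) / R)) y)" for y
    proof -
      define t where "t = (\<lambda>n. ennreal (exp (- pi * (real n)\<^sup>2)) * indicator (cball x (real (Suc n) / R)) y)"
      \<comment> \<open>The index of the shell containing y; this single term of the series already
        dominates the Gaussian.\<close>
      define n where "n = nat \<lfloor>R * norm (x - y)\<rfloor>"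
      have n: "real n \<le> R * norm (x - y)" "R * norm (x - y) \<le> real (Suc n)"
        using R by (auto simp: n_def) linarith
      have "gauss (R *\<^sub>R (x - y)) \<le> exp (- pi * (real n)\<^sup>2)"
        using n R by (auto simp: gauss_def intro!: power_mono)
      moreover have "y \<in> cball x (real (Suc n) / R)"
        using n(2) R by (simp add: dist_norm field_simps)
      ultimately have "ennreal (gauss (R *\<^sub>R (x - y))) \<le> t n"
        unfolding t_def by (simp add: ennreal_leI)
      also have "t n = sum t {n}" by simp
      also have "\<dots> \<le> suminf t" by (rule sum_le_suminf) auto
      finally show ?thesis unfolding t_def .
    qed
    then have "(\<integral>\<^sup>+y. gauss (R *\<^sub>R (x - y)) \<partial>\<mu>)
        \<le> (\<integral>\<^sup>+y. (\<Sum>n. ennreal (exp (- pi * (real n)\<^sup>2)) * indicator (cball x (real (Suc n) / R)) y) \<partial>\<mu>)"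
      by (intro nn_integral_mono)
    also have "\<dots> = (\<Sum>n. ennreal (exp (- pi * (real n)\<^sup>2)) * emeasure \<mu> (cball x (real (Suc n) / R)))"
    proof (subst nn_integral_suminf)
      show "(\<lambda>y. ennreal (exp (- pi * (real n)\<^sup>2)) * indicator (cball x (real (Suc n) / R)) y) \<in> borel_measurable \<mu>" for n
        unfolding measurable_cong_sets[OF sets refl]
        by (intro borel_measurable_times_ennreal borel_measurable_const borel_measurable_indicator) auto
    qed (simp add: nn_integral_cmult_indicator sets)
    also have "\<dots> \<le> (\<Sum>n. ennreal (C * R powr (- s) * w n))"
    proof (intro suminf_le summableI)
      fix n
      have "ennreal (exp (- pi * (real n)\<^sup>2)) * emeasure \<mu> (cball x (real (Suc n) / R))
          \<le> ennreal (exp (- pi * (real n)\<^sup>2)) * ennreal (C * (real (Suc n) / R) powr s)"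
        using R by (intro mult_left_mono C x) auto
      also have "\<dots> = ennreal (C * R powr (- s) * w n)"
        using R C(1) by (simp add: ennreal_mult[symmetric] w_def powr_divide powr_minus field_simps)
      finally show "ennreal (exp (- pi * (real n)\<^sup>2)) * emeasure \<mu> (cball x (real (Suc n) / R)) \<le> ennreal (C * R powr (- s) * w n)" .
    qed
    also have "\<dots> = ennreal (\<Sum>n. C * R powr (- s) * w n)"
      using C(1) w0 sw by (intro suminf_ennreal2 summable_mult) auto
    also have "(\<Sum>n. C * R powr (- s) * w n) = (C * suminf w) * R powr (- s)"
      using suminf_mult[OF sw, of "C * R powr (- s)"] by (simp add: algebra_simps)
    finally have "(\<integral>\<^sup>+y. gauss (R *\<^sub>R (x - y)) \<partial>\<mu>) \<le> ennreal ((C * suminf w) * R powr (- s))" .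
    moreover have "0 \<le> (C * suminf w) * R powr (- s)" using C(1) sw w0 by (simp add: suminf_nonneg)
    ultimately show ?thesis
      using gm by (subst integral_eq_nn_integral) (auto simp: enn2real_leI)
  qed
  then show ?thesis
    using C(1) sw w0 by (intro exI[of _ "C * suminf w"]) (auto intro!: mult_nonneg_nonneg suminf_nonneg)
qed

section \<open>Cauchy-Schwarz inequality and Schur's test\<close>

lemma square_integral_le:
  fixes f :: "'a \<Rightarrow> real"
  assumes "finite_measure M" and f: "integrable M f" and f2: "integrable M (\<lambda>x. (f x)\<^sup>2)"
  shows "(LINT x|M. f x)\<^sup>2 \<le> measure M (space M) * (LINT x|M. (f x)\<^sup>2)"
proof -
  interpret finite_measure M by fact
  define m where "m = measure M (space M)"
  define I where "I = (LINT x|M. f x)"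
  define N where "N = (LINT x|M. (f x)\<^sup>2)"
  have m0: "m \<ge> 0" by (simp add: m_def)
  \<comment> \<open>Expanding the square gives m (m N - I^2), so only the case m = 0 has to be
    treated separately.\<close>
  have "0 \<le> (LINT x|M. (m * f x - I)\<^sup>2)" by (intro Bochner_Integration.integral_nonneg) auto
  also have "\<dots> = (LINT x|M. m\<^sup>2 * (f x)\<^sup>2 - 2 * m * I * f x + I\<^sup>2)"
    by (intro Bochner_Integration.integral_cong) (auto simp: power2_eq_square algebra_simps)
  also have "\<dots> = m\<^sup>2 * N - 2 * m * I * I + I\<^sup>2 * m"
    using f f2 by (simp add: I_def N_def m_def)
  also have "\<dots> = m * (m * N - I\<^sup>2)" by (simp add: power2_eq_square algebra_simps)
  finally have *: "0 \<le> m * (m * N - I\<^sup>2)" .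
  show ?thesis
  proof (cases "m = 0")
    case True
    then have "emeasure M (space M) = 0" by (simp add: m_def emeasure_eq_measure)
    then have "space M \<in> null_sets M" by auto
    then have "AE x in M. f x = 0" by (rule AE_I') auto
    then have "I = 0" unfolding I_def by (simp add: integral_eq_zero_AE)
    then show ?thesis using True by (simp add: I_def m_def)
  next
    case False
    then have "m > 0" using m0 by simp
    with * have "I\<^sup>2 \<le> m * N" by (simp add: zero_le_mult_iff)
    then show ?thesis by (simp add: I_def m_def N_def)
  qed
qed

lemma in_L2_integrable:
  assumes "finite_measure M" and f: "in_L2 M f"
  shows "integrable M f"
proof -
  interpret finite_measure M by fact
  show ?thesis
  proof (rule Bochner_Integration.integrable_bound)
    show "integrable M (\<lambda>x. 1 + (norm (f x))\<^sup>2)" using f by (auto simp: in_L2_def)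
    have "norm (f x) \<le> 1 + (norm (f x))\<^sup>2" for x
      using zero_le_power2[of "norm (f x) - 1 / 2"] by (simp add: power2_eq_square algebra_simps)
    then show "AE x in M. norm (f x) \<le> norm (1 + (norm (f x))\<^sup>2)" by (auto intro!: AE_I2 order_trans[OF _ abs_ge_self])
  qed (use f in \<open>simp add: in_L2_def\<close>)
qed

lemma norm_L2_square: "(norm_L2 M f)\<^sup>2 = (LINT x|M. (norm (f x))\<^sup>2)"
  unfolding norm_L2_def by (subst real_sqrt_pow2) (auto intro: Bochner_Integration.integral_nonneg)

lemma norm_L2_nonneg [simp]: "0 \<le> norm_L2 M f"
  unfolding norm_L2_def by (auto intro: Bochner_Integration.integral_nonneg)

lemma square_integral_norm_le:
  assumes M: "finite_measure M" and f: "in_L2 M f"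
  shows "(LINT x|M. norm (f x))\<^sup>2 \<le> measure M (space M) * (norm_L2 M f)\<^sup>2"
  unfolding norm_L2_square
  by (rule square_integral_le[OF M integrable_norm[OF in_L2_integrable[OF M f]]]) (use f in \<open>simp add: in_L2_def\<close>)

text \<open>By u(x) u(y) <= (u(x)^2 + u(y)^2) / 2 the form splits into two halves, which are equal
  by the symmetry of the kernel. The bound on the row integrals is required only almost everywhere,
  since the growth condition speaks about points of the support.\<close>

lemma schur_test:
  fixes f :: "'a \<Rightarrow> complex" and k :: "'a \<Rightarrow> 'a \<Rightarrow> real"
  assumes M: "finite_measure M" and f: "in_L2 M f"
    and k: "(\<lambda>(x, y). k x y) \<in> borel_measurable (M \<Otimes>\<^sub>M M)"
    and k0: "\<And>x y. 0 \<le> k x y" "\<And>x y. k x y \<le> B" and sym: "\<And>x y. k x y = k y x"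
    and A: "AE x in M. (LINT y|M. k x y) \<le> A"
  shows "norm (LINT x|M. f x * (LINT y|M. complex_of_real (k x y) * cnj (f y))) \<le> A * (norm_L2 M f)\<^sup>2"
proof -
  interpret finite_measure M by fact
  define u where "u = (\<lambda>x. norm (f x))"
  have u0: "u x \<ge> 0" for x by (simp add: u_def)
  have ui: "integrable M u" unfolding u_def by (rule integrable_norm[OF in_L2_integrable[OF M f]])
  have u2i: "integrable M (\<lambda>x. (u x)\<^sup>2)" using f by (simp add: in_L2_def u_def)
  have kx: "k x \<in> borel_measurable M" if "x \<in> space M" for x
    using measurable_Pair2[OF k that] by simp
  have nk: "norm (k x y) \<le> B" for x y using k0 by simp
  have B0: "B \<ge> 0" using order_trans[OF k0(1) k0(2)] .
  have kint: "integrable M (\<lambda>y. k x y * v y)" if "x \<in> space M" and v: "integrable M v" for x and v :: "'a \<Rightarrow> real"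
    using kx[OF that(1)] v k0 B0
    by (intro Bochner_Integration.integrable_bound[OF integrable_mult_right[OF v, of B]])
       (auto simp: abs_mult intro!: AE_I2 mult_right_mono)
  have meas: "(\<lambda>x. LINT y|M. k x y * v y) \<in> borel_measurable M" if v: "integrable M v" for v :: "'a \<Rightarrow> real"
  proof (rule borel_measurable_lebesgue_integral)
    have "(\<lambda>p. v (snd p)) \<in> borel_measurable (M \<Otimes>\<^sub>M M)"
      using borel_measurable_integrable[OF v] by (rule measurable_compose[OF measurable_snd])
    then show "(\<lambda>(x, y). k x y * v y) \<in> borel_measurable (M \<Otimes>\<^sub>M M)"
      using k unfolding split_beta' by (intro borel_measurable_times)
  qed
  have bound: "\<bar>LINT y|M. k x y * v y\<bar> \<le> B * (LINT y|M. \<bar>v y\<bar>)" if "x \<in> space M" and v: "integrable M v" for x and v :: "'a \<Rightarrow> real"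
  proof -
    have "\<bar>LINT y|M. k x y * v y\<bar> \<le> (LINT y|M. \<bar>k x y * v y\<bar>)" by (rule integral_abs_bound)
    also have "\<dots> \<le> (LINT y|M. B * \<bar>v y\<bar>)"
    proof (rule integral_mono)
      show "integrable M (\<lambda>y. \<bar>k x y * v y\<bar>)" by (rule integrable_abs[OF kint[OF that]])
    qed (use v k0 in \<open>auto simp: abs_mult intro: mult_right_mono\<close>)
    finally show ?thesis by simp
  qed
  have prodint: "integrable M (\<lambda>x. w x * (LINT y|M. k x y * v y))" if w: "integrable M w" and v: "integrable M v" for w v :: "'a \<Rightarrow> real"
  proof (rule Bochner_Integration.integrable_bound[OF integrable_mult_left[OF integrable_norm[OF w], of "B * (LINT y|M. \<bar>v y\<bar>)"]])
    show "(\<lambda>x. w x * (LINT y|M. k x y * v y)) \<in> borel_measurable M"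
      using meas[OF v] borel_measurable_integrable[OF w] by measurable
    show "AE x in M. norm (w x * (LINT y|M. k x y * v y)) \<le> norm (norm (w x) * (B * (LINT y|M. \<bar>v y\<bar>)))"
    proof (rule AE_I2)
      fix x assume "x \<in> space M"
      from mult_left_mono[OF bound[OF this v], of "\<bar>w x\<bar>"]
      show "norm (w x * (LINT y|M. k x y * v y)) \<le> norm (norm (w x) * (B * (LINT y|M. \<bar>v y\<bar>)))"
        unfolding real_norm_def abs_mult abs_abs by (rule order_trans) (auto intro!: mult_left_mono mult_right_mono)
    qed
  qed
  have one: "integrable M (\<lambda>_. 1::real)" by simp
  have "norm (LINT x|M. f x * (LINT y|M. complex_of_real (k x y) * cnj (f y)))
      \<le> (LINT x|M. u x * (LINT y|M. k x y * u y))"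
  proof (rule order_trans[OF integral_norm_bound integral_mono_AE'])
    show "integrable M (\<lambda>x. u x * (LINT y|M. k x y * u y))" by (rule prodint[OF ui ui])
    show "AE x in M. norm (f x * (LINT y|M. complex_of_real (k x y) * cnj (f y))) \<le> u x * (LINT y|M. k x y * u y)"
    proof (rule AE_I2)
      fix x
      have "norm (LINT y|M. complex_of_real (k x y) * cnj (f y)) \<le> (LINT y|M. norm (complex_of_real (k x y) * cnj (f y)))"
        by (rule integral_norm_bound)
      then show "norm (f x * (LINT y|M. complex_of_real (k x y) * cnj (f y))) \<le> u x * (LINT y|M. k x y * u y)"
        using k0 by (auto simp: norm_mult u_def intro: mult_left_mono)
    qed
  qed (auto intro!: AE_I2 mult_nonneg_nonneg Bochner_Integration.integral_nonneg u0 k0)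
  also have "\<dots> \<le> (LINT x|M. ((u x)\<^sup>2 * (LINT y|M. k x y * 1) + 1 * (LINT y|M. k x y * (u y)\<^sup>2)) / 2)"
  proof (rule integral_mono[OF prodint[OF ui ui]])
    show "integrable M (\<lambda>x. ((u x)\<^sup>2 * (LINT y|M. k x y * 1) + 1 * (LINT y|M. k x y * (u y)\<^sup>2)) / 2)"
      by (intro integrable_divide_zero Bochner_Integration.integrable_add prodint u2i one)
    fix x assume x: "x \<in> space M"
    have "u x * (LINT y|M. k x y * u y) = (LINT y|M. u x * (k x y * u y))" by simp
    also have "\<dots> \<le> (LINT y|M. ((u x)\<^sup>2 * (k x y * 1) + k x y * (u y)\<^sup>2) / 2)"
    proof (rule integral_mono)
      show "integrable M (\<lambda>y. u x * (k x y * u y))" using kint[OF x ui] by simp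
      show "integrable M (\<lambda>y. ((u x)\<^sup>2 * (k x y * 1) + k x y * (u y)\<^sup>2) / 2)"
        using kint[OF x u2i] kint[OF x one] by auto
      fix y
      have "u x * u y \<le> ((u x)\<^sup>2 + (u y)\<^sup>2) / 2"
        using sum_squares_bound[of "u x" "u y"] by simp
      from mult_left_mono[OF this k0(1)[of x y]]
      show "u x * (k x y * u y) \<le> ((u x)\<^sup>2 * (k x y * 1) + k x y * (u y)\<^sup>2) / 2"
        by (simp add: algebra_simps)
    qed
    also have "\<dots> = ((u x)\<^sup>2 * (LINT y|M. k x y * 1) + 1 * (LINT y|M. k x y * (u y)\<^sup>2)) / 2"
      using kint[OF x u2i] kint[OF x one] by simp
    finally show "u x * (LINT y|M. k x y * u y) \<le> ((u x)\<^sup>2 * (LINT y|M. k x y * 1) + 1 * (LINT y|M. k x y * (u y)\<^sup>2)) / 2" .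
  qed
  also have "\<dots> = ((LINT x|M. (u x)\<^sup>2 * (LINT y|M. k x y * 1)) + (LINT x|M. 1 * (LINT y|M. k x y * (u y)\<^sup>2))) / 2"
    using prodint[OF u2i one] prodint[OF one u2i] by simp
  also have "(LINT x|M. 1 * (LINT y|M. k x y * (u y)\<^sup>2)) = (LINT y|M. (u y)\<^sup>2 * (LINT x|M. k x y * 1))"
    by (rule integral_swap_bounded[OF sigma_finite_measure_axioms sigma_finite_measure_axioms one u2i k nk])
  also have "\<dots> = (LINT x|M. (u x)\<^sup>2 * (LINT y|M. k x y * 1))"
    by (intro Bochner_Integration.integral_cong refl arg_cong2[where f = "(*)"] sym)
  also have "((LINT x|M. (u x)\<^sup>2 * (LINT y|M. k x y * 1)) + (LINT x|M. (u x)\<^sup>2 * (LINT y|M. k x y * 1))) / 2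
      = (LINT x|M. (u x)\<^sup>2 * (LINT y|M. k x y * 1))" by simp
  also have "\<dots> \<le> (LINT x|M. (u x)\<^sup>2 * A)"
  proof (intro integral_mono_AE prodint u2i one integrable_mult_left)
    show "AE x in M. (u x)\<^sup>2 * (LINT y|M. k x y * 1) \<le> (u x)\<^sup>2 * A"
      using A by eventually_elim (simp add: mult_left_mono)
  qed
  also have "\<dots> = A * (norm_L2 M f)\<^sup>2" by (simp add: norm_L2_square u_def)
  finally show ?thesis .
qed

section \<open>Fourier transforms of measures\<close>

text \<open>The phase has the sign opposite to \<open>fourier\<close>; it is the one that Fourier
  inversion produces when the kernel is integrated against a measure.\<close>

definition ft_measure :: "'a::euclidean_space measure \<Rightarrow> ('a \<Rightarrow> complex) \<Rightarrow> 'a \<Rightarrow> complex" where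
  "ft_measure \<mu> f \<xi> = (LINT y|\<mu>. cis (2 * pi * (y \<bullet> \<xi>)) * f y)"

lemma borel_measurable_cis_inner:
  fixes \<mu> :: "'a::euclidean_space measure" and \<nu> :: "'a measure"
  assumes "sets \<mu> = sets borel" "sets \<nu> = sets borel"
  shows "(\<lambda>(x, y). cis (2 * pi * (x \<bullet> y))) \<in> borel_measurable (\<mu> \<Otimes>\<^sub>M \<nu>)"
proof -
  have "(\<lambda>(x, y). cis (2 * pi * (x \<bullet> (y::'a)))) \<in> borel_measurable (borel \<Otimes>\<^sub>M borel)"
    unfolding borel_prod split_beta' by (intro borel_measurable_continuous_onI continuous_intros)
  then show ?thesis
    using measurable_cong_sets[OF sets_pair_measure_cong[OF assms] refl] by blast
qed

lemma ft_measure_measurable: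
  assumes "sigma_finite_measure \<mu>" "sets \<mu> = sets borel" and f: "integrable \<mu> f"
  shows "ft_measure \<mu> f \<in> borel_measurable lborel"
proof -
  interpret sigma_finite_measure \<mu> by fact
  have "(\<lambda>p. f (snd p)) \<in> borel_measurable (lborel \<Otimes>\<^sub>M \<mu>)"
    using borel_measurable_integrable[OF f] by (rule measurable_compose[OF measurable_snd])
  then have "(\<lambda>(\<xi>, y). cis (2 * pi * (\<xi> \<bullet> y)) * f y) \<in> borel_measurable (lborel \<Otimes>\<^sub>M \<mu>)"
    using borel_measurable_cis_inner[of lborel \<mu>] assms(2) unfolding split_beta'
    by (intro borel_measurable_times) auto
  then show ?thesis
    unfolding ft_measure_def[abs_def] by (subst inner_commute) (rule borel_measurable_lebesgue_integral)
qed

lemma norm_ft_measure_le: "norm (ft_measure \<mu> f \<xi>) \<le> (LINT y|\<mu>. norm (f y))"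
  unfolding ft_measure_def by (rule order_trans[OF integral_norm_bound]) (simp add: norm_mult)

lemma norm_ft_measure_square_le:
  assumes "finite_measure \<mu>" "in_L2 \<mu> f"
  shows "(norm (ft_measure \<mu> f \<xi>))\<^sup>2 \<le> measure \<mu> (space \<mu>) * (norm_L2 \<mu> f)\<^sup>2"
  by (rule order_trans[OF power_mono[OF norm_ft_measure_le] square_integral_norm_le[OF assms]]) simp

text \<open>Writing the squared modulus as a double integral over the measure and integrating in the
  frequency first leaves the positive symmetric kernel R^d gauss(R (y - z)). Its row integrals are
  at most R^d A, and Schur's test applies.\<close>

lemma gauss_energy:
  fixes \<mu> :: "'a::euclidean_space measure"
  assumes fin: "finite_measure \<mu>" and sets: "sets \<mu> = sets borel" and f: "in_L2 \<mu> f" and R: "R > 0"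
    and A: "AE x in \<mu>. (LINT y|\<mu>. gauss (R *\<^sub>R (x - y))) \<le> A"
  shows "integrable lborel (\<lambda>\<xi>. gauss (\<xi> /\<^sub>R R) * (norm (ft_measure \<mu> f \<xi>))\<^sup>2)"
    and "(LINT \<xi>|lborel. gauss (\<xi> /\<^sub>R R) * (norm (ft_measure \<mu> f \<xi>))\<^sup>2) \<le> R ^ DIM('a) * A * (norm_L2 \<mu> f)\<^sup>2"
proof -
  interpret finite_measure \<mu> by fact
  note sf = sigma_finite_measure_axioms lborel.sigma_finite_measure_axioms
  define F where "F = ft_measure \<mu> f"
  have F_eq: "F \<xi> = (LINT y|\<mu>. cis (2 * pi * (\<xi> \<bullet> y)) * f y)" for \<xi>
    unfolding F_def ft_measure_def by (intro Bochner_Integration.integral_cong refl) (simp add: inner_commute)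
  have fi: "integrable \<mu> f" by (rule in_L2_integrable[OF fin f])
  have Fm: "F \<in> borel_measurable lborel" unfolding F_def by (rule ft_measure_measurable[OF sf(1) sets fi])
  define L where "L = (LINT y|\<mu>. norm (f y))"
  have FL: "norm (F \<xi>) \<le> L" for \<xi> unfolding F_def L_def by (rule norm_ft_measure_le)
  define G where "G = (\<lambda>\<xi>::'a. complex_of_real (gauss (\<xi> /\<^sub>R R)))"
  have Gi: "integrable lborel G"
    unfolding G_def using integrable_of_real[OF integrable_gauss_affine[of "inverse R" 0]] R by simp
  have GFi: "integrable lborel (\<lambda>\<xi>. G \<xi> * cnj (F \<xi>))"
  proof (rule Bochner_Integration.integrable_bound[OF integrable_mult_right[OF integrable_norm[OF Gi], of L]])
    have "(\<lambda>\<xi>. cnj (F \<xi>)) \<in> borel_measurable lborel"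
      using Fm by (rule borel_measurable_continuous_on[rotated]) (intro continuous_intros)
    then show "(\<lambda>\<xi>. G \<xi> * cnj (F \<xi>)) \<in> borel_measurable lborel"
      using borel_measurable_integrable[OF Gi] by measurable
    show "AE \<xi> in lborel. norm (G \<xi> * cnj (F \<xi>)) \<le> norm (L * norm (G \<xi>))"
      using FL by (auto simp: norm_mult mult.commute[of L] intro!: AE_I2 mult_left_mono order_trans[OF _ abs_ge_self])
  qed
  have GFFi: "integrable lborel (\<lambda>\<xi>. G \<xi> * cnj (F \<xi>) * F \<xi>)"
    using FL Fm borel_measurable_integrable[OF GFi]
    by (intro Bochner_Integration.integrable_bound[OF integrable_mult_right[OF integrable_norm[OF GFi], of L]])
       (auto simp: norm_mult mult.commute[of L] intro!: AE_I2 mult_left_mono order_trans[OF _ abs_ge_self])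
  have eq: "G \<xi> * cnj (F \<xi>) * F \<xi> = complex_of_real (gauss (\<xi> /\<^sub>R R) * (norm (F \<xi>))\<^sup>2)" for \<xi>
    unfolding G_def of_real_mult complex_norm_square by (simp add: mult.commute)
  show "integrable lborel (\<lambda>\<xi>. gauss (\<xi> /\<^sub>R R) * (norm (ft_measure \<mu> f \<xi>))\<^sup>2)"
    using integrable_Re[OF GFFi] unfolding eq by (simp add: F_def)
  \<comment> \<open>The frequency integral is evaluated by the transform of the Gaussian of width R,
    after the conjugate transform has been unfolded into an integral over z.\<close>
  have inner: "(LINT \<xi>|lborel. cis (2 * pi * (\<xi> \<bullet> y)) * (G \<xi> * cnj (F \<xi>)))
      = (LINT z|\<mu>. complex_of_real (R ^ DIM('a) * gauss (R *\<^sub>R (y - z))) * cnj (f z))" for y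
  proof -
    have "(LINT \<xi>|lborel. cis (2 * pi * (\<xi> \<bullet> y)) * (G \<xi> * cnj (F \<xi>)))
       = (LINT \<xi>|lborel. G \<xi> * (LINT z|\<mu>. cis (2 * pi * (\<xi> \<bullet> (y - z))) * cnj (f z)))"
    proof (intro Bochner_Integration.integral_cong refl)
      fix \<xi>
      have "cis (2 * pi * (\<xi> \<bullet> y)) * cnj (F \<xi>) = (LINT z|\<mu>. cis (2 * pi * (\<xi> \<bullet> y)) * cnj (cis (2 * pi * (z \<bullet> \<xi>)) * f z))"
        unfolding F_def ft_measure_def by (simp only: integral_mult_right_zero Bochner_Integration.integral_cnj)
      also have "\<dots> = (LINT z|\<mu>. cis (2 * pi * (\<xi> \<bullet> (y - z))) * cnj (f z))"
      proof (intro Bochner_Integration.integral_cong refl)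
        fix z
        have "2 * pi * (\<xi> \<bullet> (y - z)) = 2 * pi * (\<xi> \<bullet> y) + - (2 * pi * (z \<bullet> \<xi>))"
          by (simp add: inner_diff_right inner_commute algebra_simps)
        then have "cis (2 * pi * (\<xi> \<bullet> (y - z))) = cis (2 * pi * (\<xi> \<bullet> y)) * cnj (cis (2 * pi * (z \<bullet> \<xi>)))"
          by (simp only: cis_mult[symmetric] cis_cnj)
        then show "cis (2 * pi * (\<xi> \<bullet> y)) * cnj (cis (2 * pi * (z \<bullet> \<xi>)) * f z) = cis (2 * pi * (\<xi> \<bullet> (y - z))) * cnj (f z)"
          by simp
      qed
      finally have "G \<xi> * (cis (2 * pi * (\<xi> \<bullet> y)) * cnj (F \<xi>)) = G \<xi> * (LINT z|\<mu>. cis (2 * pi * (\<xi> \<bullet> (y - z))) * cnj (f z))"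
        by (rule arg_cong)
      then show "cis (2 * pi * (\<xi> \<bullet> y)) * (G \<xi> * cnj (F \<xi>)) = G \<xi> * (LINT z|\<mu>. cis (2 * pi * (\<xi> \<bullet> (y - z))) * cnj (f z))"
        by (subst mult.left_commute)
    qed
    also have "\<dots> = (LINT z|\<mu>. cnj (f z) * (LINT \<xi>|lborel. cis (2 * pi * (\<xi> \<bullet> (y - z))) * G \<xi>))"
    proof (rule integral_swap_bounded[OF sf(2,1) Gi _ _, where B = 1])
      have "(\<lambda>(\<xi>, z). cis (2 * pi * (\<xi> \<bullet> (y - (z::'a))))) \<in> borel_measurable (borel \<Otimes>\<^sub>M borel)"
        unfolding borel_prod split_beta' by (intro borel_measurable_continuous_onI continuous_intros)
      then show "(\<lambda>(\<xi>, z). cis (2 * pi * (\<xi> \<bullet> (y - z)))) \<in> borel_measurable (lborel \<Otimes>\<^sub>M \<mu>)"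
        using measurable_cong_sets[OF sets_pair_measure_cong[OF sets_lborel sets] refl] by blast
    qed (use fi in auto)
    also have "\<dots> = (LINT z|\<mu>. complex_of_real (R ^ DIM('a) * gauss (R *\<^sub>R (y - z))) * cnj (f z))"
      unfolding G_def integral_cis_gauss_scaled[OF R] by (simp add: mult.commute)
    finally show ?thesis .
  qed
  have "complex_of_real (LINT \<xi>|lborel. gauss (\<xi> /\<^sub>R R) * (norm (F \<xi>))\<^sup>2) = (LINT \<xi>|lborel. G \<xi> * cnj (F \<xi>) * F \<xi>)"
    unfolding eq integral_complex_of_real ..
  also have "\<dots> = (LINT \<xi>|lborel. G \<xi> * cnj (F \<xi>) * (LINT y|\<mu>. cis (2 * pi * (\<xi> \<bullet> y)) * f y))"
    by (intro Bochner_Integration.integral_cong refl arg_cong2[where f = "(*)"] F_eq)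
  also have "\<dots> = (LINT y|\<mu>. f y * (LINT \<xi>|lborel. cis (2 * pi * (\<xi> \<bullet> y)) * (G \<xi> * cnj (F \<xi>))))"
    by (rule integral_swap_bounded[OF sf(2,1) GFi fi _, where B = 1])
       (use borel_measurable_cis_inner[of lborel \<mu>] sets in auto)
  also have "\<dots> = (LINT y|\<mu>. f y * (LINT z|\<mu>. complex_of_real (R ^ DIM('a) * gauss (R *\<^sub>R (y - z))) * cnj (f z)))"
    unfolding inner ..
  finally have eq2: "complex_of_real (LINT \<xi>|lborel. gauss (\<xi> /\<^sub>R R) * (norm (F \<xi>))\<^sup>2)
      = (LINT y|\<mu>. f y * (LINT z|\<mu>. complex_of_real (R ^ DIM('a) * gauss (R *\<^sub>R (y - z))) * cnj (f z)))" .
  have "\<bar>LINT \<xi>|lborel. gauss (\<xi> /\<^sub>R R) * (norm (F \<xi>))\<^sup>2\<bar>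
      = norm (LINT y|\<mu>. f y * (LINT z|\<mu>. complex_of_real (R ^ DIM('a) * gauss (R *\<^sub>R (y - z))) * cnj (f z)))"
    unfolding eq2[symmetric] norm_of_real ..
  also have "\<dots> \<le> R ^ DIM('a) * A * (norm_L2 \<mu> f)\<^sup>2"
  proof (rule schur_test[OF fin f, where B = "R ^ DIM('a)"])
    have "(\<lambda>(y, z). R ^ DIM('a) * gauss (R *\<^sub>R (y - (z::'a)))) \<in> borel_measurable (borel \<Otimes>\<^sub>M borel)"
      unfolding borel_prod split_beta' gauss_def by (intro borel_measurable_continuous_onI continuous_intros)
    then show "(\<lambda>(y, z). R ^ DIM('a) * gauss (R *\<^sub>R (y - z))) \<in> borel_measurable (\<mu> \<Otimes>\<^sub>M \<mu>)"
      using measurable_cong_sets[OF sets_pair_measure_cong[OF sets sets] refl] by blast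
    show "0 \<le> R ^ DIM('a) * gauss (R *\<^sub>R (y - z))" for y z :: 'a using R by simp
    show "R ^ DIM('a) * gauss (R *\<^sub>R (y - z)) \<le> R ^ DIM('a)" for y z :: 'a
      using R by (intro mult_left_le) auto
    show "R ^ DIM('a) * gauss (R *\<^sub>R (y - z)) = R ^ DIM('a) * gauss (R *\<^sub>R (z - y))" for y z :: 'a
      using gauss_minus[of "R *\<^sub>R (y - z)"] by (simp add: scaleR_diff_right)
    show "AE y in \<mu>. (LINT z|\<mu>. R ^ DIM('a) * gauss (R *\<^sub>R (y - z))) \<le> R ^ DIM('a) * A"
      using A R by (auto intro: mult_left_mono)
  qed
  finally show "(LINT \<xi>|lborel. gauss (\<xi> /\<^sub>R R) * (norm (ft_measure \<mu> f \<xi>))\<^sup>2) \<le> R ^ DIM('a) * A * (norm_L2 \<mu> f)\<^sup>2"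
    by (simp add: F_def)
qed

text \<open>The frequencies are grouped by powers of two. On the j-th group the power weight is
  comparable to R^(-a) with R = 2^j and the Gaussian of width R is at least exp(-pi), so
  \<open>gauss_energy\<close> bounds the group by a multiple of R^(d - s - a). Nonnegative integrals
  are used because finiteness is part of the claim.\<close>

lemma high_frequency_energy:
  fixes \<mu> :: "'a::euclidean_space measure"
  assumes \<mu>: "compactly_supported_borel_measure \<mu>" and growth: "growth_condition \<mu> s"
    and s: "0 < s" and a: "real DIM('a) - s < a" "0 \<le> a"
  shows "\<exists>C\<ge>0. \<forall>f. in_L2 \<mu> f \<longrightarrow>
    (\<integral>\<^sup>+\<xi>. ennreal (indicator {\<xi>. 1 \<le> norm \<xi>} \<xi> * (norm \<xi> powr (- a) * (norm (ft_measure \<mu> f \<xi>))\<^sup>2)) \<partial>lborel)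
      \<le> ennreal (C * (norm_L2 \<mu> f)\<^sup>2)"
proof -
  have sets: "sets \<mu> = sets borel" using \<mu> by (simp add: compactly_supported_borel_measure_def)
  have fin: "finite_measure \<mu>" by (rule growth_condition_cball(1)[OF \<mu> growth s])
  obtain A where A: "A \<ge> 0" "\<And>x R. x \<in> msupp \<mu> \<Longrightarrow> R > 0 \<Longrightarrow> (LINT y|\<mu>. gauss (R *\<^sub>R (x - y))) \<le> A * R powr (- s)"
    using gauss_potential_bound[OF \<mu> growth s] by auto
  \<comment> \<open>The ratio of the geometric series over the groups; it is below 1 because a > d -
    s.\<close>
  define q where "q = 2 powr (real DIM('a) - s - a)"
  have q: "0 < q" "q < 1" using a by (auto simp: q_def powr_less_one)
  \<comment> \<open>exp(pi) undoes the Gaussian on its group, 2^a compares the power weight with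
    R^(-a), and \<open>A\<close> comes from the potential bound.\<close>
  define c where "c = exp pi * 2 powr a * A"
  have c: "c \<ge> 0" using A by (simp add: c_def)
  have "(\<integral>\<^sup>+\<xi>. ennreal (indicator {\<xi>. 1 \<le> norm \<xi>} \<xi> * (norm \<xi> powr (- a) * (norm (ft_measure \<mu> f \<xi>))\<^sup>2)) \<partial>lborel)
      \<le> ennreal (c / (1 - q) * (norm_L2 \<mu> f)\<^sup>2)" if f: "in_L2 \<mu> f" for f
  proof -
    define F where "F = ft_measure \<mu> f"
    define R where "R = (\<lambda>j::nat. (2::real) ^ j)"
    have R: "R j > 0" for j by (simp add: R_def)
    define t where "t = (\<lambda>j \<xi>. exp pi * 2 powr a * R j powr (- a) * (gauss (\<xi> /\<^sub>R R j) * (norm (F \<xi>))\<^sup>2))"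
    have AE: "AE x in \<mu>. (LINT y|\<mu>. gauss (R j *\<^sub>R (x - y))) \<le> A * R j powr (- s)" for j
      using AE_in_msupp[OF sets] by eventually_elim (intro A R)
    have ti: "integrable lborel (t j)" for j
      unfolding t_def F_def by (intro integrable_mult_right gauss_energy(1)[OF fin sets f R AE])
    have t0: "t j \<xi> \<ge> 0" for j \<xi> by (simp add: t_def)
    have tle: "(LINT \<xi>|lborel. t j \<xi>) \<le> c * q ^ j * (norm_L2 \<mu> f)\<^sup>2" for j
    proof -
      have "(LINT \<xi>|lborel. t j \<xi>) = exp pi * 2 powr a * R j powr (- a) * (LINT \<xi>|lborel. gauss (\<xi> /\<^sub>R R j) * (norm (F \<xi>))\<^sup>2)"
        by (simp add: t_def)
      also have "\<dots> \<le> exp pi * 2 powr a * R j powr (- a) * (R j ^ DIM('a) * (A * R j powr (- s)) * (norm_L2 \<mu> f)\<^sup>2)"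
        unfolding F_def by (intro mult_left_mono gauss_energy(2)[OF fin sets f R AE]) auto
      also have "\<dots> = c * (R j powr (real DIM('a) - s - a)) * (norm_L2 \<mu> f)\<^sup>2"
        using R[of j] by (simp add: c_def powr_diff powr_add powr_realpow powr_minus field_simps)
      also have "R j powr (real DIM('a) - s - a) = q ^ j"
        unfolding R_def q_def by (simp add: powr_realpow[symmetric] powr_powr mult.commute)
      finally show ?thesis .
    qed
    have "ennreal (indicator {\<xi>. 1 \<le> norm \<xi>} \<xi> * (norm \<xi> powr (- a) * (norm (F \<xi>))\<^sup>2)) \<le> (\<Sum>j. ennreal (t j \<xi>))" for \<xi>
    proof (cases "1 \<le> norm \<xi>")
      case True
      \<comment> \<open>Rounding up gives R / 2 <= |\<xi>| <= R: the upper bound is for the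
        Gaussian, the lower one for the power weight.\<close>
      define j where "j = nat \<lceil>log 2 (norm \<xi>)\<rceil>"
      have n0: "0 < norm \<xi>" using True by linarith
      then have l0: "0 \<le> log 2 (norm \<xi>)" using True by (subst zero_le_log_cancel_iff) auto
      have j: "log 2 (norm \<xi>) \<le> real j" "real j \<le> log 2 (norm \<xi>) + 1"
        using l0 unfolding j_def by linarith+
      have n1: "norm \<xi> \<le> R j"
        using n0 j(1) by (simp add: R_def log_le_iff powr_realpow)
      have "2 powr real j \<le> 2 powr (log 2 (norm \<xi>) + 1)" using j(2) by (intro powr_mono) auto
      then have n2: "R j \<le> 2 * norm \<xi>"
        using n0 by (simp add: R_def powr_add powr_realpow mult.commute)
      have "exp (- pi) \<le> gauss (\<xi> /\<^sub>R R j)"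
        using n1 R[of j] by (simp add: gauss_def divide_inverse[symmetric] power_le_one inverse_eq_divide)
      then have g: "1 \<le> exp pi * gauss (\<xi> /\<^sub>R R j)" by (simp add: exp_minus field_simps)
      have "(2 * norm \<xi>) powr (- a) \<le> R j powr (- a)"
        using n2 R[of j] a by (intro powr_mono2') auto
      then have "norm \<xi> powr (- a) \<le> 2 powr a * R j powr (- a)"
        using n0 by (simp add: powr_mult powr_minus field_simps)
      then have "norm \<xi> powr (- a) * 1 \<le> (2 powr a * R j powr (- a)) * (exp pi * gauss (\<xi> /\<^sub>R R j))"
        using g by (intro mult_mono) auto
      from mult_right_mono[OF this, of "(norm (F \<xi>))\<^sup>2"]
      have "norm \<xi> powr (- a) * (norm (F \<xi>))\<^sup>2 \<le> t j \<xi>"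
        by (simp add: t_def algebra_simps)
      then have "ennreal (indicator {\<xi>. 1 \<le> norm \<xi>} \<xi> * (norm \<xi> powr (- a) * (norm (F \<xi>))\<^sup>2)) \<le> ennreal (t j \<xi>)"
        using True by (simp add: ennreal_leI)
      also have "\<dots> = sum (\<lambda>j. ennreal (t j \<xi>)) {j}" by simp
      also have "\<dots> \<le> (\<Sum>j. ennreal (t j \<xi>))" by (rule sum_le_suminf) auto
      finally show ?thesis .
    qed simp
    then have "(\<integral>\<^sup>+\<xi>. ennreal (indicator {\<xi>. 1 \<le> norm \<xi>} \<xi> * (norm \<xi> powr (- a) * (norm (F \<xi>))\<^sup>2)) \<partial>lborel)
      \<le> (\<integral>\<^sup>+\<xi>. (\<Sum>j. ennreal (t j \<xi>)) \<partial>lborel)" by (rule nn_integral_mono)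
    also have "\<dots> = (\<Sum>j. \<integral>\<^sup>+\<xi>. ennreal (t j \<xi>) \<partial>lborel)"
      using borel_measurable_integrable[OF ti] by (intro nn_integral_suminf) simp
    also have "\<dots> \<le> (\<Sum>j. ennreal (c * q ^ j * (norm_L2 \<mu> f)\<^sup>2))"
    proof (intro suminf_le summableI)
      fix j
      have "(\<integral>\<^sup>+\<xi>. ennreal (t j \<xi>) \<partial>lborel) = ennreal (LINT \<xi>|lborel. t j \<xi>)"
        using ti t0 by (intro nn_integral_eq_integral) auto
      also have "\<dots> \<le> ennreal (c * q ^ j * (norm_L2 \<mu> f)\<^sup>2)" by (intro ennreal_leI tle)
      finally show "(\<integral>\<^sup>+\<xi>. ennreal (t j \<xi>) \<partial>lborel) \<le> ennreal (c * q ^ j * (norm_L2 \<mu> f)\<^sup>2)" .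
    qed
    also have "\<dots> = ennreal (\<Sum>j. c * q ^ j * (norm_L2 \<mu> f)\<^sup>2)"
      using c q by (intro suminf_ennreal2) (auto intro!: summable_mult summable_mult2 summable_geometric)
    also have "(\<Sum>j. c * q ^ j * (norm_L2 \<mu> f)\<^sup>2) = c / (1 - q) * (norm_L2 \<mu> f)\<^sup>2"
      using q suminf_mult[of "\<lambda>j. q ^ j" "c * (norm_L2 \<mu> f)\<^sup>2"]
      by (simp add: suminf_geometric summable_geometric algebra_simps)
    finally show ?thesis unfolding F_def .
  qed
  then show ?thesis using c q by (intro exI[of _ "c / (1 - q)"] conjI allI impI) auto
qed

lemma high_frequency_energy_integral:
  fixes \<mu> :: "'a::euclidean_space measure"
  assumes \<mu>: "compactly_supported_borel_measure \<mu>" and growth: "growth_condition \<mu> s"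
    and s: "0 < s" and a: "real DIM('a) - s < a" "0 \<le> a"
  shows "\<exists>C\<ge>0. \<forall>f. in_L2 \<mu> f \<longrightarrow>
    integrable lborel (\<lambda>\<xi>. indicator {\<xi>. 1 \<le> norm \<xi>} \<xi> * (norm \<xi> powr (- a) * (norm (ft_measure \<mu> f \<xi>))\<^sup>2)) \<and>
    (LINT \<xi>|lborel. indicator {\<xi>. 1 \<le> norm \<xi>} \<xi> * (norm \<xi> powr (- a) * (norm (ft_measure \<mu> f \<xi>))\<^sup>2))
      \<le> C * (norm_L2 \<mu> f)\<^sup>2"
proof -
  have sets: "sets \<mu> = sets borel" using \<mu> by (simp add: compactly_supported_borel_measure_def)
  have fin: "finite_measure \<mu>" by (rule growth_condition_cball(1)[OF \<mu> growth s])
  obtain C where C: "C \<ge> 0" "\<And>f. in_L2 \<mu> f \<Longrightarrow>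
    (\<integral>\<^sup>+\<xi>. ennreal (indicator {\<xi>. 1 \<le> norm \<xi>} \<xi> * (norm \<xi> powr (- a) * (norm (ft_measure \<mu> f \<xi>))\<^sup>2)) \<partial>lborel)
      \<le> ennreal (C * (norm_L2 \<mu> f)\<^sup>2)"
    using high_frequency_energy[OF assms] by auto
  have "integrable lborel (\<lambda>\<xi>. indicator {\<xi>. 1 \<le> norm \<xi>} \<xi> * (norm \<xi> powr (- a) * (norm (ft_measure \<mu> f \<xi>))\<^sup>2)) \<and>
    (LINT \<xi>|lborel. indicator {\<xi>. 1 \<le> norm \<xi>} \<xi> * (norm \<xi> powr (- a) * (norm (ft_measure \<mu> f \<xi>))\<^sup>2))
      \<le> C * (norm_L2 \<mu> f)\<^sup>2" if f: "in_L2 \<mu> f" for f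
  proof -
    define v where "v = (\<lambda>\<xi>. indicator {\<xi>. 1 \<le> norm \<xi>} \<xi> * (norm \<xi> powr (- a) * (norm (ft_measure \<mu> f \<xi>))\<^sup>2))"
    have v0: "v \<xi> \<ge> 0" for \<xi> by (simp add: v_def)
    have [measurable]: "ft_measure \<mu> f \<in> borel_measurable borel"
      using ft_measure_measurable[OF finite_measure.axioms(1)[OF fin] sets in_L2_integrable[OF fin f]] by simp
    have vm: "v \<in> borel_measurable lborel" unfolding v_def by measurable
    have le: "(\<integral>\<^sup>+\<xi>. ennreal (v \<xi>) \<partial>lborel) \<le> ennreal (C * (norm_L2 \<mu> f)\<^sup>2)"
      unfolding v_def by (rule C(2)[OF f])
    have "integrable lborel v"
      using vm v0 le by (intro integrableI_nonneg) (auto intro: le_less_trans[OF _ ennreal_less_top])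
    moreover have "(LINT \<xi>|lborel. v \<xi>) \<le> C * (norm_L2 \<mu> f)\<^sup>2"
      using vm v0 le C(1) by (subst integral_eq_nn_integral) (auto simp: enn2real_leI)
    ultimately show ?thesis unfolding v_def by simp
  qed
  with C(1) show ?thesis by blast
qed

text \<open>The variable y enters the kernel with a minus sign. Conjugation restores the phase of
  \<open>ft_measure\<close> and changes neither moduli nor L2 norms, so the energy estimates
  apply.\<close>

lemma ft_measure_cnj:
  "(LINT y|\<mu>. cis (2 * pi * (- y \<bullet> \<xi>)) * f y) = cnj (ft_measure \<mu> (\<lambda>y. cnj (f y)) \<xi>)"
  unfolding ft_measure_def Bochner_Integration.integral_cnj[symmetric] by (simp add: cis_cnj)

lemma in_L2_cnj: "in_L2 \<mu> f \<Longrightarrow> in_L2 \<mu> (\<lambda>y. cnj (f y))"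
  unfolding in_L2_def by (auto intro: borel_measurable_continuous_on[where f = cnj] continuous_intros)

lemma norm_L2_cnj: "norm_L2 \<mu> (\<lambda>y. cnj (f y)) = norm_L2 \<mu> f"
  by (simp add: norm_L2_def)

lemma test_function_mollifier:
  assumes "test_function \<rho>" "\<epsilon> > 0"
  shows "test_function (mollifier \<rho> \<epsilon>)"
  using test_function_affine[OF assms(1), of "inverse \<epsilon>" "complex_of_real (1 / \<epsilon> ^ DIM('a))" 0] assms(2)
  by (simp add: mollifier_def[abs_def])

lemma integral_mollifier:
  fixes g :: "'a::euclidean_space \<Rightarrow> 'b::{banach, second_countable_topology, real_normed_algebra_1}"
  assumes g: "integrable lborel g" and \<epsilon>: "\<epsilon> > 0"
  shows "(LINT x|lborel. (1 / \<epsilon> ^ DIM('a)) *\<^sub>R g (x /\<^sub>R \<epsilon>)) = (LINT x|lborel. g x)"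
  using integral_lborel_affine[OF _ g, of "inverse \<epsilon>" 0] \<epsilon>
  by (simp add: power_inverse divide_inverse)

lemma norm_fourier_mollifier_le:
  assumes \<rho>: "test_function \<rho>" and \<epsilon>: "\<epsilon> > 0"
  shows "norm (fourier (mollifier \<rho> \<epsilon>) \<xi>) \<le> (LINT x|lborel. norm (\<rho> x))"
proof -
  have "norm (fourier (mollifier \<rho> \<epsilon>) \<xi>) \<le> (LINT x|lborel. norm (mollifier \<rho> \<epsilon> x))"
    by (rule norm_fourier_le)
  also have "\<dots> = (LINT x|lborel. (1 / \<epsilon> ^ DIM('a)) *\<^sub>R norm (\<rho> (x /\<^sub>R \<epsilon>)))"
    using \<epsilon> by (simp add: mollifier_def norm_mult norm_divide norm_power)
  also have "\<dots> = (LINT x|lborel. norm (\<rho> x))"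
    by (rule integral_mollifier[OF integrable_norm[OF test_function_integrable[OF \<rho>]] \<epsilon>])
  finally show ?thesis .
qed

text \<open>
  The Schwartz function \<open>fourier (\<lambda>y. \<rho>\<^sub>\<epsilon> (x + y))\<close> has Fourier transform \<open>\<lambda>y. \<rho>\<^sub>\<epsilon> (x - y)\<close> by
  Fourier inversion, so testing the Fourier transform of \<open>\<Lambda>\<close> against it gives \<open>\<lambda>\<^sup>\<epsilon> x\<close>.
\<close>
lemma distr_convolution_eq_integral:
  assumes \<rho>: "test_function \<rho>" and \<epsilon>: "\<epsilon> > 0"
    and h: "represented_by (fourier_distr \<Lambda>) h"
  shows "integrable lborel (\<lambda>\<xi>. h \<xi> * fourier (mollifier \<rho> \<epsilon>) \<xi>)"
    and "distr_convolution \<Lambda> (mollifier \<rho> \<epsilon>) x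
      = (LINT \<xi>|lborel. h \<xi> * fourier (mollifier \<rho> \<epsilon>) \<xi> * cis (2 * pi * (x \<bullet> \<xi>)))"
proof -
  have m: "test_function (mollifier \<rho> \<epsilon>)" by (rule test_function_mollifier[OF \<rho> \<epsilon>])
  show "integrable lborel (\<lambda>\<xi>. h \<xi> * fourier (mollifier \<rho> \<epsilon>) \<xi>)"
    using h fourier_in_schwartz[OF m] by (auto simp: represented_by_def has_bochner_integral_iff)
  define \<psi> where "\<psi> = (\<lambda>y. mollifier \<rho> \<epsilon> (x + y))"
  have \<psi>: "test_function \<psi>"
    using test_function_affine[OF m, of 1 1 x] by (simp add: \<psi>_def)
  have "fourier (fourier \<psi>) = (\<lambda>y. mollifier \<rho> \<epsilon> (x - y))"
  proof
    fix y
    have "fourier (fourier \<psi>) y = (LINT \<xi>|lborel. cis (2 * pi * (\<xi> \<bullet> (- y))) * fourier \<psi> \<xi>)"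
      by (simp add: fourier_def[of "fourier \<psi>"])
    also have "\<dots> = \<psi> (- y)" by (rule fourier_inversion[OF \<psi>])
    finally show "fourier (fourier \<psi>) y = mollifier \<rho> \<epsilon> (x - y)" by (simp add: \<psi>_def)
  qed
  then have "distr_convolution \<Lambda> (mollifier \<rho> \<epsilon>) x = fourier_distr \<Lambda> (fourier \<psi>)"
    by (simp add: distr_convolution_def fourier_distr_def)
  also have "\<dots> = (LINT \<xi>|lborel. h \<xi> * fourier \<psi> \<xi>)"
    using h fourier_in_schwartz[OF \<psi>] by (auto simp: represented_by_def has_bochner_integral_iff)
  also have "\<dots> = (LINT \<xi>|lborel. h \<xi> * fourier (mollifier \<rho> \<epsilon>) \<xi> * cis (2 * pi * (x \<bullet> \<xi>)))"
    unfolding \<psi>_def fourier_translate[OF test_function_integrable[OF m]] by (simp add: mult_ac)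
  finally show "distr_convolution \<Lambda> (mollifier \<rho> \<epsilon>) x
      = (LINT \<xi>|lborel. h \<xi> * fourier (mollifier \<rho> \<epsilon>) \<xi> * cis (2 * pi * (x \<bullet> \<xi>)))" .
qed

section \<open>Uniform boundedness\<close>

text \<open>For each fixed \<epsilon> the function T f is bounded, hence in L2 of the second measure
  and a legitimate test function for itself. What remains is to make the constant independent of
  \<epsilon>.\<close>

lemma uniformly_L2_bounded_of_decay:
  fixes \<rho> :: "'a::euclidean_space \<Rightarrow> complex"
  assumes \<rho>: "test_function \<rho>"
    and s\<^sub>\<mu>: "0 < s\<^sub>\<mu>" "s\<^sub>\<mu> \<le> real DIM('a)" and s\<^sub>\<nu>: "0 < s\<^sub>\<nu>" "s\<^sub>\<nu> \<le> real DIM('a)"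
    and \<alpha>: "real DIM('a) - (s\<^sub>\<mu> + s\<^sub>\<nu>) / 2 < \<alpha>"
    and adm: "admissible \<Lambda> \<mu> \<nu> \<alpha> s\<^sub>\<mu> s\<^sub>\<nu>"
  shows "uniformly_L2_bounded \<Lambda> \<rho> \<mu> \<nu>"
proof -
  have \<mu>: "compactly_supported_borel_measure \<mu>" "growth_condition \<mu> s\<^sub>\<mu>"
    and \<nu>: "compactly_supported_borel_measure \<nu>" "growth_condition \<nu> s\<^sub>\<nu>"
    using adm by (auto simp: admissible_def)
  have sets_\<mu>: "sets \<mu> = sets borel" and sets_\<nu>: "sets \<nu> = sets borel"
    using \<mu> \<nu> by (auto simp: compactly_supported_borel_measure_def)
  have fin_\<mu>: "finite_measure \<mu>" by (rule growth_condition_cball(1)[OF \<mu> s\<^sub>\<mu>(1)])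
  have fin_\<nu>: "finite_measure \<nu>" by (rule growth_condition_cball(1)[OF \<nu> s\<^sub>\<nu>(1)])
  interpret M: finite_measure \<mu> by fact
  interpret N: finite_measure \<nu> by fact
  note sf = M.sigma_finite_measure_axioms N.sigma_finite_measure_axioms lborel.sigma_finite_measure_axioms
  obtain h C' where h: "locally_integrable h" "represented_by (fourier_distr \<Lambda>) h"
      "AE \<xi> in lborel. norm (h \<xi>) \<le> C' * norm \<xi> powr (- \<alpha>)"
    using adm unfolding admissible_def fourier_decay_def by blast
  define C\<^sub>h where "C\<^sub>h = max C' 0"
  have C\<^sub>h: "C\<^sub>h \<ge> 0" "AE \<xi> in lborel. norm (h \<xi>) \<le> C\<^sub>h * norm \<xi> powr (- \<alpha>)"
  proof -
    show "AE \<xi> in lborel. norm (h \<xi>) \<le> C\<^sub>h * norm \<xi> powr (- \<alpha>)"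
      using h(3)
    proof eventually_elim
      fix \<xi> assume "norm (h \<xi>) \<le> C' * norm \<xi> powr (- \<alpha>)"
      also have "\<dots> \<le> C\<^sub>h * norm \<xi> powr (- \<alpha>)" by (intro mult_right_mono) (auto simp: C\<^sub>h_def)
      finally show "norm (h \<xi>) \<le> C\<^sub>h * norm \<xi> powr (- \<alpha>)" .
    qed
  qed (simp add: C\<^sub>h_def)
  \<comment> \<open>This choice shares the surplus evenly: \<open>a\<close> exceeds
    \<open>d - s\<^sub>\<mu>\<close> and \<open>b\<close> exceeds \<open>d - s\<^sub>\<nu>\<close>
    by the same amount \<alpha> - (d - s).\<close>
  define a where "a = \<alpha> + (s\<^sub>\<nu> - s\<^sub>\<mu>) / 2"
  define b where "b = \<alpha> + (s\<^sub>\<mu> - s\<^sub>\<nu>) / 2"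
  have a: "real DIM('a) - s\<^sub>\<mu> < a" "0 \<le> a" and b: "real DIM('a) - s\<^sub>\<nu> < b" "0 \<le> b" and ab: "a + b = 2 * \<alpha>"
    using \<alpha> s\<^sub>\<mu> s\<^sub>\<nu> by (auto simp: a_def b_def field_simps)
  obtain C\<^sub>\<mu> where C\<^sub>\<mu>: "C\<^sub>\<mu> \<ge> 0" "\<And>f. in_L2 \<mu> f \<Longrightarrow>
    integrable lborel (\<lambda>\<xi>. indicator {\<xi>. 1 \<le> norm \<xi>} \<xi> * (norm \<xi> powr (- a) * (norm (ft_measure \<mu> f \<xi>))\<^sup>2))"
    "\<And>f. in_L2 \<mu> f \<Longrightarrow>
    (LINT \<xi>|lborel. indicator {\<xi>. 1 \<le> norm \<xi>} \<xi> * (norm \<xi> powr (- a) * (norm (ft_measure \<mu> f \<xi>))\<^sup>2)) \<le> C\<^sub>\<mu> * (norm_L2 \<mu> f)\<^sup>2"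
    using high_frequency_energy_integral[OF \<mu> s\<^sub>\<mu>(1) a] by auto
  obtain C\<^sub>\<nu> where C\<^sub>\<nu>: "C\<^sub>\<nu> \<ge> 0" "\<And>f. in_L2 \<nu> f \<Longrightarrow>
    integrable lborel (\<lambda>\<xi>. indicator {\<xi>. 1 \<le> norm \<xi>} \<xi> * (norm \<xi> powr (- b) * (norm (ft_measure \<nu> f \<xi>))\<^sup>2))"
    "\<And>f. in_L2 \<nu> f \<Longrightarrow>
    (LINT \<xi>|lborel. indicator {\<xi>. 1 \<le> norm \<xi>} \<xi> * (norm \<xi> powr (- b) * (norm (ft_measure \<nu> f \<xi>))\<^sup>2)) \<le> C\<^sub>\<nu> * (norm_L2 \<nu> f)\<^sup>2"
    using high_frequency_energy_integral[OF \<nu> s\<^sub>\<nu>(1) b] by auto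
  \<comment> \<open>The L1 norm of the mollifier is the same for every \<epsilon> and bounds its
    Fourier transform; this is how \<epsilon> disappears from the constant.\<close>
  define P where "P = (LINT x|lborel. norm (\<rho> x))"
  have P: "P \<ge> 0" by (auto simp: P_def intro: Bochner_Integration.integral_nonneg)
  have hi: "integrable lborel (\<lambda>\<xi>. indicator (cball 0 1) \<xi> * norm (h \<xi>))"
    using h(1)[unfolded locally_integrable_def, rule_format, of "cball 0 1", unfolded set_integrable_def, THEN integrable_norm]
    by simp
  define H where "H = (LINT \<xi>|lborel. indicator (cball 0 1) \<xi> * norm (h \<xi>))"
  have H: "H \<ge> 0" unfolding H_def by (intro Bochner_Integration.integral_nonneg) auto
  define M\<^sub>\<mu> where "M\<^sub>\<mu> = measure \<mu> (space \<mu>)"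
  define M\<^sub>\<nu> where "M\<^sub>\<nu> = measure \<nu> (space \<nu>)"
  define K1 where "K1 = P * (H * M\<^sub>\<mu> + C\<^sub>h * C\<^sub>\<mu>) / 2"
  define K2 where "K2 = P * (H * M\<^sub>\<nu> + C\<^sub>h * C\<^sub>\<nu>) / 2"
  \<comment> \<open>The summand 1 makes the constant positive, so that one may divide by t = 2 K
    below.\<close>
  define K where "K = K1 + K2 + 1"
  have K12: "0 \<le> K1" "0 \<le> K2" unfolding K1_def K2_def M\<^sub>\<mu>_def M\<^sub>\<nu>_def using P H C\<^sub>h C\<^sub>\<mu>(1) C\<^sub>\<nu>(1) by auto
  then have K: "0 < K" "K1 \<le> K" "K2 \<le> K" by (auto simp: K_def)
  have main: "in_L2 \<nu> (T_op (distr_convolution \<Lambda> (mollifier \<rho> \<epsilon>)) \<mu> f) \<and>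
      norm_L2 \<nu> (T_op (distr_convolution \<Lambda> (mollifier \<rho> \<epsilon>)) \<mu> f) \<le> 2 * K * norm_L2 \<mu> f"
    if \<epsilon>: "\<epsilon> > 0" and f: "in_L2 \<mu> f" for \<epsilon> f
  proof -
    define m where "m = (\<lambda>\<xi>. h \<xi> * fourier (mollifier \<rho> \<epsilon>) \<xi>)"
    have m: "integrable lborel m" unfolding m_def by (rule distr_convolution_eq_integral(1)[OF \<rho> \<epsilon> h(2)])
    have mh: "norm (m \<xi>) \<le> P * norm (h \<xi>)" for \<xi>
      using norm_fourier_mollifier_le[OF \<rho> \<epsilon>, of \<xi>] by (simp add: m_def P_def norm_mult mult.commute mult_left_mono)
    have fi: "integrable \<mu> f" by (rule in_L2_integrable[OF fin_\<mu> f])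
    define f' where "f' = (\<lambda>y. cnj (f y))"
    have f': "in_L2 \<mu> f'" "norm_L2 \<mu> f' = norm_L2 \<mu> f"
      using in_L2_cnj[OF f] norm_L2_cnj[of \<mu> f] by (auto simp: f'_def)
    define F where "F = (\<lambda>\<xi>. LINT y|\<mu>. cis (2 * pi * (- y \<bullet> \<xi>)) * f y)"
    have F: "F \<xi> = cnj (ft_measure \<mu> f' \<xi>)" for \<xi>
      unfolding F_def f'_def by (rule ft_measure_cnj)
    have F2: "(norm (F \<xi>))\<^sup>2 \<le> M\<^sub>\<mu> * (norm_L2 \<mu> f)\<^sup>2" for \<xi>
      using norm_ft_measure_square_le[OF fin_\<mu> f'(1), of \<xi>] by (simp add: F M\<^sub>\<mu>_def f'(2))
    have [measurable]: "ft_measure \<mu> f' \<in> borel_measurable borel"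
      using ft_measure_measurable[OF sf(1) sets_\<mu> in_L2_integrable[OF fin_\<mu> f'(1)]] by simp
    have Fm: "F \<in> borel_measurable lborel"
      unfolding F[abs_def] using borel_measurable_continuous_on[of cnj "ft_measure \<mu> f'" borel] by (simp add: continuous_intros)
    have mF: "integrable lborel (\<lambda>\<xi>. m \<xi> * F \<xi>)"
    proof (rule Bochner_Integration.integrable_bound[OF integrable_mult_right[OF integrable_norm[OF m], of "LINT y|\<mu>. norm (f' y)"]])
      show "(\<lambda>\<xi>. m \<xi> * F \<xi>) \<in> borel_measurable lborel"
        using Fm borel_measurable_integrable[OF m] by simp
      have "norm (m \<xi> * F \<xi>) \<le> (LINT y|\<mu>. norm (f' y)) * norm (m \<xi>)" for \<xi>
        using norm_ft_measure_le[of \<mu> f' \<xi>] by (simp add: F norm_mult mult.commute mult_left_mono)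
      then show "AE \<xi> in lborel. norm (m \<xi> * F \<xi>) \<le> norm ((LINT y|\<mu>. norm (f' y)) * norm (m \<xi>))"
        by (auto intro!: AE_I2 order_trans[OF _ abs_ge_self])
    qed
    define T where "T = T_op (distr_convolution \<Lambda> (mollifier \<rho> \<epsilon>)) \<mu> f"
    have T_eq: "T x = (LINT \<xi>|lborel. cis (2 * pi * (x \<bullet> \<xi>)) * (m \<xi> * F \<xi>))" for x
    proof -
      have "T x = (LINT y|\<mu>. f y * (LINT \<xi>|lborel. cis (2 * pi * ((x - y) \<bullet> \<xi>)) * m \<xi>))"
        unfolding T_def T_op_def distr_convolution_eq_integral(2)[OF \<rho> \<epsilon> h(2)] m_def
        by (simp add: mult.commute)
      also have "\<dots> = (LINT \<xi>|lborel. m \<xi> * (LINT y|\<mu>. cis (2 * pi * ((x - y) \<bullet> \<xi>)) * f y))"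
      proof (rule integral_swap_bounded[OF sf(1,3) fi m, where B = 1])
        have "(\<lambda>(y, \<xi>). cis (2 * pi * ((x - y) \<bullet> (\<xi>::'a)))) \<in> borel_measurable (borel \<Otimes>\<^sub>M borel)"
          unfolding borel_prod split_beta' by (intro borel_measurable_continuous_onI continuous_intros)
        then show "(\<lambda>(y, \<xi>). cis (2 * pi * ((x - y) \<bullet> \<xi>))) \<in> borel_measurable (\<mu> \<Otimes>\<^sub>M lborel)"
          using measurable_cong_sets[OF sets_pair_measure_cong[OF sets_\<mu> sets_lborel] refl] by blast
      qed auto
      also have "\<dots> = (LINT \<xi>|lborel. cis (2 * pi * (x \<bullet> \<xi>)) * (m \<xi> * F \<xi>))"
      proof (intro Bochner_Integration.integral_cong refl)
        fix \<xi>
        have "2 * pi * ((x - y) \<bullet> \<xi>) = 2 * pi * (x \<bullet> \<xi>) + 2 * pi * (- y \<bullet> \<xi>)" for y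
          by (simp add: inner_diff_left algebra_simps)
        then have "cis (2 * pi * ((x - y) \<bullet> \<xi>)) = cis (2 * pi * (x \<bullet> \<xi>)) * cis (2 * pi * (- y \<bullet> \<xi>))" for y
          by (simp only: cis_mult)
        then have "(LINT y|\<mu>. cis (2 * pi * ((x - y) \<bullet> \<xi>)) * f y) = cis (2 * pi * (x \<bullet> \<xi>)) * F \<xi>"
          by (simp only: F_def mult.assoc integral_mult_right_zero)
        then show "m \<xi> * (LINT y|\<mu>. cis (2 * pi * ((x - y) \<bullet> \<xi>)) * f y) = cis (2 * pi * (x \<bullet> \<xi>)) * (m \<xi> * F \<xi>)"
          by (simp only: mult.left_commute)
      qed
      finally show ?thesis .
    qed
    have T_ft: "T = ft_measure lborel (\<lambda>\<xi>. m \<xi> * F \<xi>)"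
      unfolding fun_eq_iff T_eq ft_measure_def
      by (intro allI Bochner_Integration.integral_cong refl) (simp add: inner_commute)
    have Tm: "T \<in> borel_measurable \<nu>"
      using ft_measure_measurable[OF sf(3) sets_lborel mF]
      unfolding T_ft measurable_cong_sets[OF sets_\<nu> refl] by simp
    define B where "B = (LINT \<xi>|lborel. norm (m \<xi> * F \<xi>))"
    have TB: "norm (T x) \<le> B" for x unfolding T_ft B_def by (rule norm_ft_measure_le)
    have T2: "integrable \<nu> (\<lambda>x. (norm (T x))\<^sup>2)"
      using Tm TB by (intro N.integrable_const_bound[of _ "B\<^sup>2"]) (auto intro!: AE_I2 power_mono)
    have LT: "in_L2 \<nu> T" using Tm T2 by (simp add: in_L2_def)
    \<comment> \<open>Testing with the conjugate of T turns the pairing into the square norm of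
      T.\<close>
    define g where "g = (\<lambda>x. cnj (T x))"
    have g: "in_L2 \<nu> g" "norm_L2 \<nu> g = norm_L2 \<nu> T"
      using in_L2_cnj[OF LT] norm_L2_cnj[of \<nu> T] by (auto simp: g_def)
    have gi: "integrable \<nu> g" by (rule in_L2_integrable[OF fin_\<nu> g(1)])
    define G where "G = ft_measure \<nu> g"
    have G2: "(norm (G \<xi>))\<^sup>2 \<le> M\<^sub>\<nu> * (norm_L2 \<nu> T)\<^sup>2" for \<xi>
      using norm_ft_measure_square_le[OF fin_\<nu> g(1), of \<xi>] by (simp add: G_def M\<^sub>\<nu>_def g(2))
    have "complex_of_real ((norm_L2 \<nu> T)\<^sup>2) = (LINT x|\<nu>. g x * T x)"
      unfolding norm_L2_square integral_complex_of_real[symmetric] g_def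
      by (simp only: complex_norm_square mult.commute)
    also have "\<dots> = (LINT \<xi>|lborel. m \<xi> * F \<xi> * (LINT x|\<nu>. cis (2 * pi * (x \<bullet> \<xi>)) * g x))"
      unfolding T_eq
      by (rule integral_swap_bounded[OF sf(2,3) gi mF, where B = 1])
         (use borel_measurable_cis_inner[of \<nu> lborel] sets_\<nu> in auto)
    also have "\<dots> = (LINT \<xi>|lborel. m \<xi> * F \<xi> * G \<xi>)"
      by (simp only: G_def ft_measure_def)
    finally have N: "complex_of_real ((norm_L2 \<nu> T)\<^sup>2) = (LINT \<xi>|lborel. m \<xi> * F \<xi> * G \<xi>)" .
    have N2: "(norm_L2 \<nu> T)\<^sup>2 = norm (LINT \<xi>|lborel. m \<xi> * F \<xi> * G \<xi>)"
      by (simp only: norm_of_real abs_of_nonneg zero_le_power2 flip: N)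
    define U where "U = (\<lambda>\<xi>. indicator {\<xi>. 1 \<le> norm \<xi>} \<xi> * (norm \<xi> powr (- a) * (norm (ft_measure \<mu> f' \<xi>))\<^sup>2))"
    define V where "V = (\<lambda>\<xi>. indicator {\<xi>. 1 \<le> norm \<xi>} \<xi> * (norm \<xi> powr (- b) * (norm (ft_measure \<nu> g \<xi>))\<^sup>2))"
    have U: "integrable lborel U" "(LINT \<xi>|lborel. U \<xi>) \<le> C\<^sub>\<mu> * (norm_L2 \<mu> f)\<^sup>2"
      using C\<^sub>\<mu>(2,3)[OF f'(1)] by (auto simp: U_def f'(2))
    have V: "integrable lborel V" "(LINT \<xi>|lborel. V \<xi>) \<le> C\<^sub>\<nu> * (norm_L2 \<nu> T)\<^sup>2"
      using C\<^sub>\<nu>(2,3)[OF g(1)] by (auto simp: V_def g(2))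
    have UV0: "U \<xi> \<ge> 0" "V \<xi> \<ge> 0" for \<xi> by (auto simp: U_def V_def)
    \<comment> \<open>With this weight the square norm of T returns with coefficient at most K / t =
      1/2 and can be absorbed.\<close>
    define t where "t = 2 * K"
    have t: "t > 0" using K by (simp add: t_def)
    define n1 where "n1 = (norm_L2 \<mu> f)\<^sup>2"
    define n2 where "n2 = (norm_L2 \<nu> T)\<^sup>2"
    have amgm: "u * v \<le> (t * u\<^sup>2 + v\<^sup>2 / t) / 2" for u v :: real
    proof -
      have "0 \<le> (t * u - v)\<^sup>2 / t" using t by simp
      also have "\<dots> = t * u\<^sup>2 + v\<^sup>2 / t - 2 * (u * v)" using t by (simp add: power2_eq_square field_simps)
      finally show ?thesis by simp
    qed
    \<comment> \<open>The first summand serves the unit ball, where both transforms are bounded by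
      total masses and norms; the second serves its exterior. Each is nonnegative, so in either case
      the other one may simply be added.\<close>
    define W where "W = (\<lambda>\<xi>. P * (indicator (cball 0 1) \<xi> * norm (h \<xi>) * ((t * (M\<^sub>\<mu> * n1) + (M\<^sub>\<nu> * n2) / t) / 2)
          + C\<^sub>h * ((t * U \<xi> + V \<xi> / t) / 2)))"
    have Wi: "integrable lborel W"
      unfolding W_def using hi U(1) V(1) by (intro integrable_mult_right Bochner_Integration.integrable_add integrable_mult_left integrable_divide_zero) auto
    have ptw: "AE \<xi> in lborel. norm (m \<xi> * F \<xi> * G \<xi>) \<le> W \<xi>"
      using C\<^sub>h(2)
    proof eventually_elim
      fix \<xi> assume *: "norm (h \<xi>) \<le> C\<^sub>h * norm \<xi> powr (- \<alpha>)"
      have "norm (m \<xi> * F \<xi> * G \<xi>) = norm (m \<xi>) * (norm (F \<xi>) * norm (G \<xi>))"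
        by (simp add: norm_mult)
      also have "\<dots> \<le> P * norm (h \<xi>) * (norm (F \<xi>) * norm (G \<xi>))"
        by (intro mult_right_mono mh) auto
      also have "\<dots> = P * (norm (h \<xi>) * (norm (F \<xi>) * norm (G \<xi>)))" by simp
      also have "\<dots> \<le> W \<xi>"
        unfolding W_def
      proof (intro mult_left_mono P)
        show "norm (h \<xi>) * (norm (F \<xi>) * norm (G \<xi>))
          \<le> indicator (cball 0 1) \<xi> * norm (h \<xi>) * ((t * (M\<^sub>\<mu> * n1) + (M\<^sub>\<nu> * n2) / t) / 2) + C\<^sub>h * ((t * U \<xi> + V \<xi> / t) / 2)"
        proof (cases "1 \<le> norm \<xi>")
          case True
          have sq: "(norm \<xi> powr (- c / 2))\<^sup>2 = norm \<xi> powr (- c)" for c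
            by (simp add: power2_eq_square powr_add[symmetric])
          have "norm (h \<xi>) * (norm (F \<xi>) * norm (G \<xi>)) \<le> C\<^sub>h * norm \<xi> powr (- \<alpha>) * (norm (F \<xi>) * norm (G \<xi>))"
            by (intro mult_right_mono *) auto
          also have "norm \<xi> powr (- \<alpha>) = norm \<xi> powr (- a / 2) * norm \<xi> powr (- b / 2)"
          proof -
            have "- \<alpha> = - a / 2 + - b / 2" using ab by simp
            then show ?thesis by (simp only: powr_add)
          qed
          also have "C\<^sub>h * (norm \<xi> powr (- a / 2) * norm \<xi> powr (- b / 2)) * (norm (F \<xi>) * norm (G \<xi>))
             = C\<^sub>h * ((norm \<xi> powr (- a / 2) * norm (F \<xi>)) * (norm \<xi> powr (- b / 2) * norm (G \<xi>)))"
            by (simp add: algebra_simps)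
          also have "\<dots> \<le> C\<^sub>h * ((t * (norm \<xi> powr (- a / 2) * norm (F \<xi>))\<^sup>2 + (norm \<xi> powr (- b / 2) * norm (G \<xi>))\<^sup>2 / t) / 2)"
            by (intro mult_left_mono amgm C\<^sub>h(1))
          also have "(norm \<xi> powr (- a / 2) * norm (F \<xi>))\<^sup>2 = U \<xi>"
            using True unfolding power_mult_distrib sq by (simp add: U_def F)
          also have "(norm \<xi> powr (- b / 2) * norm (G \<xi>))\<^sup>2 = V \<xi>"
            using True unfolding power_mult_distrib sq by (simp add: V_def G_def)
          finally have "norm (h \<xi>) * (norm (F \<xi>) * norm (G \<xi>)) \<le> C\<^sub>h * ((t * U \<xi> + V \<xi> / t) / 2)" .
          moreover have "0 \<le> indicator (cball 0 1) \<xi> * norm (h \<xi>) * ((t * (M\<^sub>\<mu> * n1) + (M\<^sub>\<nu> * n2) / t) / 2)"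
            using t by (auto simp: M\<^sub>\<mu>_def M\<^sub>\<nu>_def n1_def n2_def intro!: mult_nonneg_nonneg add_nonneg_nonneg divide_nonneg_nonneg)
          ultimately show ?thesis by linarith
        next
          case False
          have "norm (h \<xi>) * (norm (F \<xi>) * norm (G \<xi>)) \<le> norm (h \<xi>) * ((t * (norm (F \<xi>))\<^sup>2 + (norm (G \<xi>))\<^sup>2 / t) / 2)"
            by (intro mult_left_mono amgm) auto
          also have "\<dots> \<le> norm (h \<xi>) * ((t * (M\<^sub>\<mu> * n1) + (M\<^sub>\<nu> * n2) / t) / 2)"
            using F2[of \<xi>] G2[of \<xi>] t
            by (intro mult_left_mono divide_right_mono add_mono) (auto simp: n1_def n2_def)
          finally have "norm (h \<xi>) * (norm (F \<xi>) * norm (G \<xi>)) \<le> norm (h \<xi>) * ((t * (M\<^sub>\<mu> * n1) + (M\<^sub>\<nu> * n2) / t) / 2)" .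
          moreover have "0 \<le> C\<^sub>h * ((t * U \<xi> + V \<xi> / t) / 2)"
            using t C\<^sub>h(1) UV0 by (intro mult_nonneg_nonneg divide_nonneg_nonneg add_nonneg_nonneg) auto
          moreover have "indicator (cball 0 1) \<xi> = (1::real)" using False by simp
          ultimately show ?thesis by (simp only: mult_1_left)
        qed
      qed
      finally show "norm (m \<xi> * F \<xi> * G \<xi>) \<le> W \<xi>" .
    qed
    have "n2 \<le> (LINT \<xi>|lborel. norm (m \<xi> * F \<xi> * G \<xi>))"
      unfolding n2_def N2 by (rule integral_norm_bound)
    also have "\<dots> \<le> (LINT \<xi>|lborel. W \<xi>)"
    proof (rule integral_mono_AE'[OF Wi ptw])
      show "AE \<xi> in lborel. 0 \<le> W \<xi>" using ptw by eventually_elim (rule order_trans[OF norm_ge_zero])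
    qed
    also have "\<dots> = P * (H * ((t * (M\<^sub>\<mu> * n1) + (M\<^sub>\<nu> * n2) / t) / 2) + C\<^sub>h * ((t * (LINT \<xi>|lborel. U \<xi>) + (LINT \<xi>|lborel. V \<xi>) / t) / 2))"
      unfolding W_def H_def using hi U(1) V(1) by simp
    also have "\<dots> \<le> P * (H * ((t * (M\<^sub>\<mu> * n1) + (M\<^sub>\<nu> * n2) / t) / 2) + C\<^sub>h * ((t * (C\<^sub>\<mu> * n1) + (C\<^sub>\<nu> * n2) / t) / 2))"
      using U(2) V(2) t P C\<^sub>h(1) unfolding n1_def n2_def
      by (intro mult_left_mono add_left_mono divide_right_mono add_mono) auto
    also have "\<dots> = K1 * (t * n1) + K2 * (n2 / t)"
      using t by (simp add: K1_def K2_def field_simps)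
    also have "\<dots> \<le> K * (t * n1) + K * (n2 / t)"
      using K t by (intro add_mono mult_right_mono) (auto simp: n1_def n2_def)
    also have "\<dots> = 2 * K\<^sup>2 * n1 + n2 / 2"
      using K by (simp add: t_def power2_eq_square field_simps)
    finally have "n2 \<le> 4 * K\<^sup>2 * n1" by simp
    then have "(norm_L2 \<nu> T)\<^sup>2 \<le> (2 * K * norm_L2 \<mu> f)\<^sup>2"
      by (simp add: n1_def n2_def power_mult_distrib)
    then have "norm_L2 \<nu> T \<le> 2 * K * norm_L2 \<mu> f"
      by (rule power2_le_imp_le) (use K in simp)
    with LT show ?thesis by (simp add: T_def)
  qed
  then show ?thesis
    unfolding uniformly_L2_bounded_def by (intro exI[of _ "2 * K"]) blast
qed

section \<open>Cantor measures\<close>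

text \<open>Realizes any counting function with increments 0 and 1 by a set of digit
  positions.\<close>

lemma card_jumps:
  fixes N :: "nat \<Rightarrow> nat"
  assumes "N 0 = 0" "\<And>k. N (Suc k) = N k \<or> N (Suc k) = Suc (N k)"
  shows "card ({k. N (Suc k) \<noteq> N k} \<inter> {..<n}) = N n"
proof (induction n)
  case (Suc n)
  define A where "A = {k. N (Suc k) \<noteq> N k}"
  have IH: "card (A \<inter> {..<n}) = N n" using Suc by (simp only: A_def)
  have "card (A \<inter> {..<Suc n}) = N (Suc n)"
  proof (cases "n \<in> A")
    case True
    then have "A \<inter> {..<Suc n} = insert n (A \<inter> {..<n})" by (auto simp: less_Suc_eq)
    moreover have "N (Suc n) = Suc (N n)" using True assms(2)[of n] by (auto simp: A_def)
    ultimately show ?thesis using IH by simp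
  next
    case False
    then have "A \<inter> {..<Suc n} = A \<inter> {..<n}" by (auto simp: less_Suc_eq)
    moreover have "N (Suc n) = N n" using False by (auto simp: A_def)
    ultimately show ?thesis using IH by simp
  qed
  then show ?case by (simp only: A_def)
qed (use assms in simp)

lemma nat_floor_step:
  assumes "0 \<le> x" "x \<le> y" "y \<le> x + (1::real)"
  shows "nat \<lfloor>y\<rfloor> = nat \<lfloor>x\<rfloor> \<or> nat \<lfloor>y\<rfloor> = Suc (nat \<lfloor>x\<rfloor>)"
  using assms by linarith

text \<open>The larger set consists of the jumps of N(n) = floor(n \<sigma>). The smaller one
  consists of the jumps of floor(N(n) \<tau> / \<sigma>), a function of N(n), which can jump only
  where N does: nesting is automatic. Two successive roundings cost an error of 2 instead of
  1.\<close>

lemma nested_digit_sets: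
  fixes \<sigma> \<tau> :: real
  assumes "0 < \<tau>" "\<tau> \<le> \<sigma>" "\<sigma> \<le> 1"
  obtains D D' :: "nat set" where "D' \<subseteq> D"
    "\<And>n. real n * \<sigma> - 1 \<le> real (card (D \<inter> {..<n}))" "\<And>n. real (card (D \<inter> {..<n})) \<le> real n * \<sigma>"
    "\<And>n. real n * \<tau> - 2 \<le> real (card (D' \<inter> {..<n}))" "\<And>n. real (card (D' \<inter> {..<n})) \<le> real n * \<tau>"
proof -
  define N where "N = (\<lambda>n::nat. nat \<lfloor>real n * \<sigma>\<rfloor>)"
  define q where "q = \<tau> / \<sigma>"
  have q: "0 \<le> q" "q \<le> 1" "\<sigma> * q = \<tau>" using assms by (auto simp: q_def)
  define N' where "N' = (\<lambda>n::nat. nat \<lfloor>real (N n) * q\<rfloor>)"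
  define D where "D = {k. N (Suc k) \<noteq> N k}"
  define D' where "D' = {k. N' (Suc k) \<noteq> N' k}"
  have N: "N (Suc k) = N k \<or> N (Suc k) = Suc (N k)" for k
    unfolding N_def using assms by (intro nat_floor_step) (auto simp: algebra_simps)
  have N': "N' (Suc k) = N' k \<or> N' (Suc k) = Suc (N' k)" for k
    unfolding N'_def using N[of k] q by (intro nat_floor_step) (auto simp: algebra_simps)
  have cD: "card (D \<inter> {..<n}) = N n" for n
    unfolding D_def by (intro card_jumps N) (simp add: N_def)
  have cD': "card (D' \<inter> {..<n}) = N' n" for n
    unfolding D'_def by (intro card_jumps N') (simp add: N_def N'_def)
  have n0: "0 \<le> real n * \<sigma>" for n using assms by simp
  have Nb: "real n * \<sigma> - 1 \<le> real (N n)" "real (N n) \<le> real n * \<sigma>" for n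
    using n0[of n] unfolding N_def by linarith+
  have n0': "0 \<le> real (N n) * q" for n using q by simp
  have Nb': "real (N n) * q - 1 \<le> real (N' n)" "real (N' n) \<le> real (N n) * q" for n
    using n0'[of n] unfolding N'_def by linarith+
  show ?thesis
  proof
    show "D' \<subseteq> D" by (auto simp: D_def D'_def N'_def)
    show "real n * \<sigma> - 1 \<le> real (card (D \<inter> {..<n}))" "real (card (D \<inter> {..<n})) \<le> real n * \<sigma>" for n
      using Nb[of n] by (auto simp: cD)
    show "real n * \<tau> - 2 \<le> real (card (D' \<inter> {..<n}))" for n
    proof -
      have "(real n * \<sigma> - 1) * q \<le> real (N n) * q" using Nb(1)[of n] q by (intro mult_right_mono) auto
      moreover have "(real n * \<sigma> - 1) * q = real n * \<tau> - q" using q(3) by (simp add: algebra_simps)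
      ultimately show ?thesis using Nb'(1)[of n] q(2) by (simp add: cD')
    qed
    show "real (card (D' \<inter> {..<n})) \<le> real n * \<tau>" for n
    proof -
      have "real (N n) * q \<le> real n * \<sigma> * q" using Nb(2)[of n] q by (intro mult_right_mono) auto
      then show ?thesis using Nb'(2)[of n] q(3) by (simp add: cD' mult.assoc)
    qed
  qed
qed

section \<open>Random binary digits and Cantor points\<close>

definition fair_bits :: "(nat \<times> 'a \<Rightarrow> bool) measure" where
  "fair_bits = Pi\<^sub>M UNIV (\<lambda>_. measure_pmf (bernoulli_pmf (1 / 2)))"

lemma prob_space_fair_bits: "prob_space fair_bits"
  unfolding fair_bits_def by (intro prob_space_PiM prob_space_measure_pmf)

lemma space_fair_bits [simp]: "space fair_bits = UNIV"
  by (simp add: fair_bits_def space_PiM)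

lemma measurable_fair_bits_component [measurable]:
  "(\<lambda>\<omega>. \<omega> i) \<in> measurable fair_bits (count_space UNIV)"
proof -
  have "(\<lambda>\<omega>. \<omega> i) \<in> measurable fair_bits (measure_pmf (bernoulli_pmf (1 / 2)))"
    unfolding fair_bits_def by (rule measurable_component_singleton) simp
  then show ?thesis by (simp add: measurable_pmf_measure2 cong: measurable_cong_sets)
qed

lemma
  fixes J :: "(nat \<times> 'a) set"
  assumes "finite J"
  shows sets_cylinder: "{\<omega>. \<forall>i\<in>J. \<omega> i = v i} \<in> sets fair_bits"
    and measure_cylinder: "measure fair_bits {\<omega>. \<forall>i\<in>J. \<omega> i = v i} = (1 / 2) ^ card J"
proof -
  interpret product_prob_space "\<lambda>_::nat \<times> 'a. measure_pmf (bernoulli_pmf (1 / 2))" UNIV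
    by standard
  have em: "emeasure fair_bits {\<omega>. \<forall>i\<in>J. \<omega> i = v i} = (\<Prod>i\<in>J. emeasure (measure_pmf (bernoulli_pmf (1 / 2))) {v i})"
    using emeasure_PiM_Collect[of J "\<lambda>i. {v i}"] assms by (simp add: fair_bits_def space_PiM)
  also have "\<dots> = (\<Prod>i\<in>J. ennreal (1 / 2))"
  proof (intro prod.cong refl)
    fix i
    show "emeasure (measure_pmf (bernoulli_pmf (1 / 2))) {v i} = ennreal (1 / 2)"
      by (cases "v i") (simp_all add: emeasure_pmf_single)
  qed
  also have "\<dots> = ennreal ((1 / 2) ^ card J)" by (subst prod_constant, subst ennreal_power) auto
  finally show "measure fair_bits {\<omega>. \<forall>i\<in>J. \<omega> i = v i} = (1 / 2) ^ card J"
    by (simp add: measure_def)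
  have "{\<omega> \<in> space fair_bits. \<forall>i\<in>J. \<omega> i = v i} \<in> sets fair_bits"
    using assms by measurable
  then show "{\<omega>. \<forall>i\<in>J. \<omega> i = v i} \<in> sets fair_bits" by simp
qed

text \<open>
  Only the binary digits at the positions in \<open>D\<close> are random, the others are \<open>0\<close>; the quotient
  \<open>digit_prefix D \<omega> b n / 2 ^ n\<close> truncates the \<open>b\<close>-th coordinate to \<open>n\<close> digits.
\<close>
primrec digit_prefix :: "nat set \<Rightarrow> (nat \<times> 'a \<Rightarrow> bool) \<Rightarrow> 'a \<Rightarrow> nat \<Rightarrow> nat" where
  "digit_prefix D \<omega> b 0 = 0"
| "digit_prefix D \<omega> b (Suc n) = 2 * digit_prefix D \<omega> b n + of_bool (n \<in> D \<and> \<omega> (n, b))"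

definition coord :: "nat set \<Rightarrow> (nat \<times> 'a \<Rightarrow> bool) \<Rightarrow> 'a \<Rightarrow> real" where
  "coord D \<omega> b = (\<Sum>k. of_bool (k \<in> D \<and> \<omega> (k, b)) / 2 ^ Suc k)"

definition cantor_point :: "nat set \<Rightarrow> (nat \<times> 'a \<Rightarrow> bool) \<Rightarrow> 'a::euclidean_space" where
  "cantor_point D \<omega> = (\<Sum>b\<in>Basis. coord D \<omega> b *\<^sub>R b)"

text \<open>Prescribing n digits in each of the d coordinates fixes d times
  \<open>card (D \<inter> {..<n})\<close> fair bits. The dimension is therefore d times the density
  of D.\<close>

definition cantor_measure :: "nat set \<Rightarrow> 'a::euclidean_space measure" where
  "cantor_measure D = distr fair_bits borel (cantor_point D)"

text \<open>The digits after the n-th contribute between 0 and 2^(-n), both ends included. The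
  prefix truncates the bit sequence and not the real number, so double binary expansions cause no
  trouble.\<close>

lemma coord_bounds:
  "real (digit_prefix D \<omega> b n) / 2 ^ n \<le> coord D \<omega> b" "coord D \<omega> b \<le> real (digit_prefix D \<omega> b n) / 2 ^ n + 1 / 2 ^ n"
proof -
  define d where "d = (\<lambda>k. of_bool (k \<in> D \<and> \<omega> (k, b)) / 2 ^ Suc k :: real)"
  have geo: "(\<lambda>k. (1 / 2) ^ n * (1 / 2) ^ Suc k :: real) sums ((1 / 2) ^ n * 1)" for n
    by (intro sums_mult power_half_series)
  have d0: "d k \<ge> 0" and dle: "d (k + n) \<le> (1 / 2) ^ n * (1 / 2) ^ Suc k" for k n
    by (auto simp: d_def power_add power_one_over mult_ac)
  have sd: "summable (\<lambda>k. d (k + n))" for n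
    using d0 dle by (intro summable_comparison_test[OF _ sums_summable[OF geo[of n]]]) auto
  have part: "(\<Sum>k<n. d k) = real (digit_prefix D \<omega> b n) / 2 ^ n" for n
    by (induction n) (auto simp: d_def field_simps)
  have "coord D \<omega> b = (\<Sum>k. d (k + n)) + (\<Sum>k<n. d k)"
    unfolding coord_def d_def[symmetric] using sd[of 0] by (intro suminf_split_initial_segment) simp
  moreover have "0 \<le> (\<Sum>k. d (k + n))" using sd d0 by (intro suminf_nonneg) auto
  moreover have "(\<Sum>k. d (k + n)) \<le> (1 / 2) ^ n * 1"
    unfolding sums_unique[OF geo[of n]] by (rule suminf_le[OF dle sd sums_summable[OF geo]])
  ultimately show "real (digit_prefix D \<omega> b n) / 2 ^ n \<le> coord D \<omega> b" "coord D \<omega> b \<le> real (digit_prefix D \<omega> b n) / 2 ^ n + 1 / 2 ^ n"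
    unfolding part by (auto simp: power_one_over)
qed

lemma cantor_point_inner: "b \<in> Basis \<Longrightarrow> cantor_point D \<omega> \<bullet> b = coord D \<omega> b"
  by (simp add: cantor_point_def)

lemma digit_prefix_eq_iff:
  "digit_prefix D \<omega> b n = digit_prefix D' \<omega>' b n \<longleftrightarrow> (\<forall>k<n. (k \<in> D \<and> \<omega> (k, b)) = (k \<in> D' \<and> \<omega>' (k, b)))"
proof (induction n)
  case (Suc n)
  have "2 * x + of_bool p = 2 * y + of_bool p' \<longleftrightarrow> x = y \<and> p = p'" for x y :: nat and p p'
  proof -
    have "(2 * x + (if p then 1 else 0) = 2 * y + (if p' then 1 else 0)) = (x = y \<and> p = p')"
      by (cases p; cases p'; simp only: if_True if_False simp_thms; presburger)
    then show ?thesis by (simp only: of_bool_def)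
  qed
  then show ?case using Suc by (simp only: digit_prefix.simps) (auto simp: less_Suc_eq)
qed simp

lemma measurable_cantor_point [measurable]:
  "(cantor_point D :: _ \<Rightarrow> 'a::euclidean_space) \<in> borel_measurable fair_bits"
proof -
  have "(\<lambda>\<omega>. of_bool (k \<in> D \<and> \<omega> (k, b)) / 2 ^ Suc k :: real) \<in> borel_measurable fair_bits" for k and b :: 'a
    by measurable
  then show ?thesis
    unfolding cantor_point_def[abs_def] coord_def
    by (intro borel_measurable_sum borel_measurable_scaleR borel_measurable_suminf) auto
qed

lemma prob_space_cantor_measure: "prob_space (cantor_measure D)"
  unfolding cantor_measure_def by (intro prob_space.prob_space_distr prob_space_fair_bits) measurable

lemma sets_cantor_measure [simp, measurable_cong]: "sets (cantor_measure D) = sets borel"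
  by (simp add: cantor_measure_def)

lemma measure_cantor_measure:
  assumes "A \<in> sets borel"
  shows "measure (cantor_measure D) A = measure fair_bits {\<omega>. cantor_point D \<omega> \<in> A}"
  unfolding cantor_measure_def using assms by (subst measure_distr) (auto simp: vimage_def)

lemma AE_cantor_measure:
  assumes "{x. P x} \<in> sets borel" "\<And>\<omega>. P (cantor_point D \<omega>)"
  shows "AE x in cantor_measure D. P x"
  unfolding cantor_measure_def using assms by (subst AE_distr_iff) auto

lemma pow_half_powr: "(2::real) powr (- (real n * u)) = (1 / 2 ^ n) powr u"
  by (simp add: powr_divide powr_minus powr_powr powr_realpow[symmetric] inverse_eq_divide)

lemma power_half_le_powr:
  assumes "real n * u \<le> real m + c"
  shows "(1 / 2) ^ m \<le> 2 powr c * (1 / 2 ^ n) powr u"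
proof -
  have "(1 / 2 :: real) ^ m = 2 powr (- real m)"
    by (simp add: powr_minus powr_realpow power_one_over inverse_eq_divide)
  also have "\<dots> \<le> 2 powr (c + - (real n * u))" using assms by (intro powr_mono) auto
  also have "\<dots> = 2 powr c * (1 / 2 ^ n) powr u" unfolding powr_add pow_half_powr ..
  finally show ?thesis .
qed

lemma powr_le_power_half:
  assumes "real m \<le> real n * u"
  shows "(1 / 2 ^ n) powr u \<le> (1 / 2) ^ m"
proof -
  have "(1 / 2 ^ n) powr u = 2 powr (- (real n * u))" by (simp add: pow_half_powr)
  also have "\<dots> \<le> 2 powr (- real m)" using assms by (intro powr_mono) auto
  also have "\<dots> = (1 / 2) ^ m" by (simp add: powr_minus powr_realpow power_one_over inverse_eq_divide)
  finally show ?thesis .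
qed

section \<open>Masses of balls and coverings\<close>

definition digit_block :: "nat set \<Rightarrow> nat \<Rightarrow> (nat \<times> 'a::euclidean_space) set" where
  "digit_block D n = (D \<inter> {..<n}) \<times> Basis"

lemma finite_digit_block [simp]: "finite (digit_block D n)"
  by (simp add: digit_block_def)

lemma card_digit_block: "card (digit_block D n :: (nat \<times> 'a) set) = DIM('a::euclidean_space) * card (D \<inter> {..<n})"
  by (simp add: digit_block_def card_cartesian_product)

lemma digit_prefix_eq_cylinder:
  assumes "\<forall>b\<in>Basis. digit_prefix D \<omega> b n = digit_prefix D \<omega>' b n"
  shows "\<forall>i\<in>digit_block D n. \<omega> i = \<omega>' i"
  using assms by (auto simp: digit_block_def digit_prefix_eq_iff)

text \<open>A ball of radius 2^(-n) leaves at most four possible prefixes of length n in each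
  coordinate. Every tuple of prefixes fixes all random bits of the digit block, hence has the
  probability of one cylinder.\<close>

lemma cantor_measure_dyadic_ball:
  fixes x :: "'a::euclidean_space"
  assumes r: "r \<le> 1 / 2 ^ n"
  shows "measure (cantor_measure D) (cball x r) \<le> 4 ^ DIM('a) * (1 / 2) ^ (DIM('a) * card (D \<inter> {..<n}))"
proof -
  interpret P: prob_space "fair_bits :: (nat \<times> 'a \<Rightarrow> bool) measure" by (rule prob_space_fair_bits)
  \<comment> \<open>With y = 2^n (x . b), the prefix lies between y - 2 and y + 1: one unit on each
    side is the radius, the other one below is the truncation error. Rounding leaves four
    integers.\<close>
  define I where "I = (\<lambda>b::'a. {z::nat. int z \<in> {\<lfloor>2 ^ n * (x \<bullet> b)\<rfloor> - 2 .. \<lfloor>2 ^ n * (x \<bullet> b)\<rfloor> + 1}})"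
  have I: "finite (I b)" "card (I b) \<le> 4" for b
  proof -
    have sub: "int ` I b \<subseteq> {\<lfloor>2 ^ n * (x \<bullet> b)\<rfloor> - 2 .. \<lfloor>2 ^ n * (x \<bullet> b)\<rfloor> + 1}" by (auto simp: I_def)
    then show "finite (I b)"
      using finite_subset[OF sub] finite_imageD[of int "I b"] by (auto simp: inj_on_def)
    have "card (I b) = card (int ` I b)" by (simp add: card_image)
    also have "\<dots> \<le> card {\<lfloor>2 ^ n * (x \<bullet> b)\<rfloor> - 2 .. \<lfloor>2 ^ n * (x \<bullet> b)\<rfloor> + 1}" by (rule card_mono[OF _ sub]) simp
    finally show "card (I b) \<le> 4" by simp
  qed
  define W where "W = PiE (Basis :: 'a set) I"
  have W: "finite W" unfolding W_def by (intro finite_PiE I finite_Basis)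
  have cW: "card W \<le> 4 ^ DIM('a)"
  proof -
    have "card W = (\<Prod>b\<in>(Basis::'a set). card (I b))" unfolding W_def by (rule card_PiE) simp
    also have "\<dots> \<le> (\<Prod>b\<in>(Basis::'a set). 4)" by (intro prod_mono) (simp add: I)
    finally show ?thesis by simp
  qed
  define good where "good = (\<lambda>w (\<omega>::nat \<times> 'a \<Rightarrow> bool). \<forall>b\<in>Basis. digit_prefix D \<omega> b n = w b)"
  \<comment> \<open>Any bit sequence with the prefixes \<open>w\<close> determines the bits on the
    block, so an arbitrary representative describes the event; prefixes that never occur give the
    empty event.\<close>
  define Cyl where "Cyl = (\<lambda>w. if \<exists>\<omega>. good w \<omega>
      then {\<omega>. \<forall>i\<in>digit_block D n. \<omega> i = (SOME \<omega>. good w \<omega>) i} else {})"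
  have Cyl_sets: "Cyl w \<in> P.events" for w
    by (auto simp: Cyl_def intro: sets_cylinder)
  have Cyl_measure: "P.prob (Cyl w) \<le> (1 / 2) ^ (DIM('a) * card (D \<inter> {..<n}))" for w
    by (auto simp: Cyl_def measure_cylinder card_digit_block)
  have "{\<omega>. cantor_point D \<omega> \<in> cball x r} \<subseteq> (\<Union>w\<in>W. Cyl w)"
  proof
    fix \<omega> assume "\<omega> \<in> {\<omega>. cantor_point D \<omega> \<in> cball x r}"
    then have dist: "norm (cantor_point D \<omega> - x) \<le> r" by (simp add: dist_norm norm_minus_commute)
    define w where "w = restrict (\<lambda>b. digit_prefix D \<omega> b n) Basis"
    have "digit_prefix D \<omega> b n \<in> I b" if b: "b \<in> Basis" for b
    proof -
      have "\<bar>coord D \<omega> b - x \<bullet> b\<bar> \<le> norm (cantor_point D \<omega> - x)"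
        using Basis_le_norm[OF b, of "cantor_point D \<omega> - x"] by (simp add: inner_diff_left cantor_point_inner b)
      also have "\<dots> \<le> 1 / 2 ^ n" using dist r by simp
      finally have "\<bar>coord D \<omega> b - x \<bullet> b\<bar> \<le> 1 / 2 ^ n" .
      then have "real (digit_prefix D \<omega> b n) / 2 ^ n \<le> x \<bullet> b + 1 / 2 ^ n" "x \<bullet> b - 2 / 2 ^ n \<le> real (digit_prefix D \<omega> b n) / 2 ^ n"
        using coord_bounds[of D \<omega> b n] by auto
      then have "2 ^ n * (real (digit_prefix D \<omega> b n) / 2 ^ n) \<le> 2 ^ n * (x \<bullet> b + 1 / 2 ^ n)"
          "2 ^ n * (x \<bullet> b - 2 / 2 ^ n) \<le> 2 ^ n * (real (digit_prefix D \<omega> b n) / 2 ^ n)"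
        by (auto simp only: intro!: mult_left_mono) auto
      then have "real (digit_prefix D \<omega> b n) \<le> 2 ^ n * (x \<bullet> b) + 1" "2 ^ n * (x \<bullet> b) - 2 \<le> real (digit_prefix D \<omega> b n)"
        by (simp_all add: ring_distribs)
      then show ?thesis unfolding I_def by simp linarith
    qed
    then have "w \<in> W" by (auto simp: W_def w_def)
    moreover have "\<omega> \<in> Cyl w"
    proof -
      have "good w \<omega>" by (simp add: good_def w_def)
      moreover from this have "good w (SOME \<omega>. good w \<omega>)" by (rule someI[of "good w"])
      ultimately show ?thesis
        unfolding Cyl_def using digit_prefix_eq_cylinder[of D \<omega> n "SOME \<omega>. good w \<omega>"] by (auto simp: good_def)
    qed
    ultimately show "\<omega> \<in> (\<Union>w\<in>W. Cyl w)" by blast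
  qed
  then have "P.prob {\<omega>. cantor_point D \<omega> \<in> cball x r} \<le> P.prob (\<Union>w\<in>W. Cyl w)"
    using Cyl_sets W by (intro P.finite_measure_mono) auto
  also have "\<dots> \<le> (\<Sum>w\<in>W. P.prob (Cyl w))"
    using Cyl_sets W by (intro P.finite_measure_subadditive_finite) auto
  also have "\<dots> \<le> real (card W) * (1 / 2) ^ (DIM('a) * card (D \<inter> {..<n}))"
    using Cyl_measure by (intro sum_bounded_above)
  also have "\<dots> \<le> 4 ^ DIM('a) * (1 / 2) ^ (DIM('a) * card (D \<inter> {..<n}))"
    using of_nat_mono[OF cW, where 'a = real] by (intro mult_right_mono) auto
  finally show ?thesis by (simp add: measure_cantor_measure)
qed

text \<open>For 0 < r < 1 take n with r <= 2^(-n) <= 2 r; the rounding error \<open>c\<close> of the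
  digit count only enters the constant. Radii from 1 on are covered by total mass 1.\<close>

lemma cantor_measure_growth:
  assumes u: "u > 0" and D: "\<And>n. real n * u - c \<le> real (DIM('a::euclidean_space) * card (D \<inter> {..<n}))"
  shows "\<exists>C>0. \<forall>(x::'a) r. 0 \<le> r \<longrightarrow> measure (cantor_measure D) (cball x r) \<le> C * r powr u"
proof -
  interpret M: prob_space "cantor_measure D :: 'a measure" by (rule prob_space_cantor_measure)
  define C where "C = max 1 (4 ^ DIM('a) * 2 powr c * 2 powr u)"
  have pos: "M.prob (cball x r) \<le> C * r powr u" if r: "r > 0" for x :: 'a and r
  proof (cases "r \<ge> 1")
    case True
    then have "1 * 1 \<le> C * r powr u" using u by (intro mult_mono) (auto simp: C_def ge_one_powr_ge_zero)
    then show ?thesis using M.prob_le_1[of "cball x r"] by linarith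
  next
    case False
    define n where "n = nat \<lfloor>- log 2 r\<rfloor>"
    have l: "0 \<le> - log 2 r" using r False by (simp add: log_le_zero_cancel_iff)
    have n: "real n \<le> - log 2 r" "- log 2 r < real n + 1" using l unfolding n_def by linarith+
    have "r = 2 powr (log 2 r)" using r by simp
    also have "\<dots> \<le> 2 powr (- real n)" using n by (intro powr_mono) auto
    finally have r1: "r \<le> 1 / 2 ^ n" by (simp add: powr_minus powr_realpow inverse_eq_divide)
    have "2 powr (- real n) \<le> 2 powr (1 + log 2 r)" using n by (intro powr_mono) auto
    then have r2: "1 / 2 ^ n \<le> 2 * r" using r by (simp add: powr_minus powr_realpow inverse_eq_divide powr_add)
    have "M.prob (cball x r) \<le> 4 ^ DIM('a) * (1 / 2) ^ (DIM('a) * card (D \<inter> {..<n}))"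
      by (rule cantor_measure_dyadic_ball[OF r1])
    also have "\<dots> \<le> 4 ^ DIM('a) * (2 powr c * (1 / 2 ^ n) powr u)"
      using D[of n] by (intro mult_left_mono power_half_le_powr) auto
    also have "\<dots> \<le> 4 ^ DIM('a) * (2 powr c * (2 * r) powr u)"
      using r2 u by (intro mult_left_mono powr_mono2) auto
    also have "\<dots> = (4 ^ DIM('a) * 2 powr c * 2 powr u) * r powr u"
      using r by (simp add: powr_mult)
    also have "\<dots> \<le> C * r powr u" by (intro mult_right_mono) (auto simp: C_def)
    finally show ?thesis .
  qed
  \<comment> \<open>Closed balls of radius 0 are points, and \<open>0 powr u\<close> is 0: the
    absence of atoms follows by letting the radius decrease to 0.\<close>
  have "M.prob (cball x 0) \<le> C * 0 powr u" for x :: 'a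
  proof -
    have "((\<lambda>r::real. C * r powr u) \<longlongrightarrow> 0) (at_right 0)" using u by real_asymp
    moreover have "\<forall>\<^sub>F r in at_right 0. M.prob (cball x 0) \<le> C * r powr u"
      unfolding eventually_at_right_field
    proof (intro exI[of _ 1] conjI allI impI)
      fix r :: real assume r: "0 < r" "r < 1"
      have "M.prob (cball x 0) \<le> M.prob (cball x r)"
        using r by (intro M.finite_measure_mono subset_cball) auto
      with pos[OF r(1), of x] show "M.prob (cball x 0) \<le> C * r powr u" by simp
    qed simp
    ultimately have "M.prob (cball x 0) \<le> 0" by (rule tendsto_lowerbound) simp
    then show ?thesis by simp
  qed
  with pos show ?thesis by (intro exI[of _ C]) (auto simp: C_def le_less)
qed

text \<open>A point of the smaller Cantor set is also one of the larger, with digits 0 at the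
  additional positions. All points sharing its first n digits form a cylinder inside the ball; the
  factor d in the radius comes from bounding the norm by the sum of the coordinates.\<close>

lemma cantor_measure_ball_lower:
  fixes \<omega>\<^sub>0 :: "nat \<times> 'a::euclidean_space \<Rightarrow> bool"
  assumes sub: "D' \<subseteq> D"
  shows "(1 / 2) ^ (DIM('a) * card (D \<inter> {..<n}))
    \<le> measure (cantor_measure D) (cball (cantor_point D' \<omega>\<^sub>0) (real DIM('a) / 2 ^ n))"
proof -
  interpret P: prob_space "fair_bits :: (nat \<times> 'a \<Rightarrow> bool) measure" by (rule prob_space_fair_bits)
  \<comment> \<open>The bits at positions in D outside D' are required to be false, which makes the
    two prefixes agree.\<close>
  define v where "v = (\<lambda>i. fst i \<in> D' \<and> \<omega>\<^sub>0 i)"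
  have "(1 / 2) ^ (DIM('a) * card (D \<inter> {..<n})) = P.prob {\<omega>. \<forall>i\<in>digit_block D n. \<omega> i = v i}"
    by (simp add: measure_cylinder card_digit_block)
  also have "\<dots> \<le> P.prob {\<omega>. cantor_point D \<omega> \<in> cball (cantor_point D' \<omega>\<^sub>0) (real DIM('a) / 2 ^ n)}"
  proof (rule P.finite_measure_mono)
    show "{\<omega>. \<forall>i\<in>digit_block D n. \<omega> i = v i} \<subseteq> {\<omega>. cantor_point D \<omega> \<in> cball (cantor_point D' \<omega>\<^sub>0) (real DIM('a) / 2 ^ n)}"
    proof safe
      fix \<omega> assume *: "\<forall>i\<in>digit_block D n. \<omega> i = v i"
      have "\<bar>(cantor_point D' \<omega>\<^sub>0 - cantor_point D \<omega>) \<bullet> b\<bar> \<le> 1 / 2 ^ n" if b: "b \<in> Basis" for b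
      proof -
        have "digit_prefix D \<omega> b n = digit_prefix D' \<omega>\<^sub>0 b n"
          using * b sub by (auto simp: digit_prefix_eq_iff digit_block_def v_def)
        then show ?thesis
          using coord_bounds[of D \<omega> b n] coord_bounds[of D' \<omega>\<^sub>0 b n] b
          by (simp add: inner_diff_left cantor_point_inner)
      qed
      then have "norm (cantor_point D' \<omega>\<^sub>0 - cantor_point D \<omega>) \<le> (\<Sum>b\<in>(Basis::'a set). 1 / 2 ^ n)"
        by (intro order_trans[OF norm_le_l1] sum_mono)
      then show "cantor_point D \<omega> \<in> cball (cantor_point D' \<omega>\<^sub>0) (real DIM('a) / 2 ^ n)"
        by (simp add: dist_norm)
    qed
    have "cantor_point D -` cball (cantor_point D' \<omega>\<^sub>0) (real DIM('a) / 2 ^ n) \<inter> space fair_bits \<in> P.events"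
      by (rule measurable_sets[OF measurable_cantor_point]) simp
    then show "{\<omega>. cantor_point D \<omega> \<in> cball (cantor_point D' \<omega>\<^sub>0) (real DIM('a) / 2 ^ n)} \<in> P.events"
      by (simp add: vimage_def)
  qed
  finally show ?thesis by (simp add: measure_cantor_measure)
qed

text \<open>The centres are the points obtained by truncation to n digits; they are indexed by the
  subsets of the digit block.\<close>

lemma cantor_point_cover:
  "\<exists>Q::'a::euclidean_space set. finite Q \<and> card Q \<le> 2 ^ (DIM('a) * card (D \<inter> {..<n})) \<and>
    (\<forall>\<omega>. \<exists>p\<in>Q. dist p (cantor_point D \<omega>) \<le> real DIM('a) / 2 ^ n)"
proof -
  define p :: "(nat \<times> 'a) set \<Rightarrow> 'a"
    where "p = (\<lambda>S. \<Sum>b\<in>Basis. (real (digit_prefix D (\<lambda>i. i \<in> S) b n) / 2 ^ n) *\<^sub>R b)"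
  have "\<exists>q\<in>p ` Pow (digit_block D n). dist q (cantor_point D \<omega>) \<le> real DIM('a) / 2 ^ n" for \<omega>
  proof -
    define S where "S = {i \<in> digit_block D n. \<omega> i}"
    have "\<bar>(p S - cantor_point D \<omega>) \<bullet> b\<bar> \<le> 1 / 2 ^ n" if b: "b \<in> Basis" for b
    proof -
      have "digit_prefix D (\<lambda>i. i \<in> S) b n = digit_prefix D \<omega> b n"
        using b by (auto simp: digit_prefix_eq_iff S_def digit_block_def)
      then show ?thesis
        using coord_bounds[of D \<omega> b n] b
        by (simp add: p_def inner_diff_left cantor_point_inner)
    qed
    then have "norm (p S - cantor_point D \<omega>) \<le> (\<Sum>b\<in>(Basis::'a set). 1 / 2 ^ n)"
      by (intro order_trans[OF norm_le_l1] sum_mono)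
    then show ?thesis by (intro bexI[of _ "p S"]) (auto simp: dist_norm S_def)
  qed
  moreover have "card (p ` Pow (digit_block D n)) \<le> 2 ^ (DIM('a) * card (D \<inter> {..<n}))"
    using card_image_le[of "Pow (digit_block D n)" p] by (simp add: card_Pow card_digit_block)
  ultimately show ?thesis
    by (intro exI[of _ "p ` Pow (digit_block D n)"]) auto
qed

lemma compactly_supported_cantor_measure:
  "compactly_supported_borel_measure (cantor_measure D :: 'a::euclidean_space measure)"
proof -
  have "cantor_point D \<omega> \<in> cball (0::'a) (real DIM('a))" for \<omega>
  proof -
    have "\<bar>cantor_point D \<omega> \<bullet> b\<bar> \<le> 1" if "b \<in> (Basis::'a set)" for b
      using that coord_bounds[of D \<omega> b 0] by (simp add: cantor_point_inner)
    then have "norm (cantor_point D \<omega>) \<le> (\<Sum>b\<in>(Basis::'a set). 1)"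
      by (intro order_trans[OF norm_le_l1] sum_mono)
    then show ?thesis by simp
  qed
  then have "emeasure (cantor_measure D) (- cball (0::'a) (real DIM('a))) = 0"
    by (simp add: cantor_measure_def emeasure_distr vimage_def)
  then have "msupp (cantor_measure D) \<subseteq> cball (0::'a) (real DIM('a))"
    by (auto simp: msupp_def dest: spec[of _ "- cball (0::'a) (real DIM('a))"])
  then have "compact (msupp (cantor_measure D :: 'a measure))"
    unfolding compact_eq_bounded_closed using closed_msupp bounded_subset[OF bounded_cball] by auto
  then show ?thesis by (simp add: compactly_supported_borel_measure_def)
qed

lemma growth_conditionI:
  fixes M :: "'a::euclidean_space measure"
  assumes "prob_space M" "\<And>x r. 0 \<le> r \<Longrightarrow> measure M (cball x r) \<le> C * r powr u"
  shows "growth_condition M u"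
proof -
  interpret prob_space M by fact
  show ?thesis
    unfolding growth_condition_def emeasure_eq_measure
    by (intro exI[of _ C] ballI ennreal_leI assms) auto
qed

text \<open>All that the counterexample uses of the Cantor measures: the large measure charges balls
  around E fully, at rate u, while a neighbourhood of E at scale 2^(-n) is covered by about 2^(n t)
  balls of mass about 2^(-n u) and so has mass at most C 2^(-n (u - t)). That E carries N is phrased
  through Borel properties, so that E may be the plain range of a parametrization.\<close>

lemma fractal_pair:
  fixes t u :: real
  assumes t: "0 < t" "t \<le> u" and u: "u \<le> real DIM('a::euclidean_space)"
  obtains M N :: "'a::euclidean_space measure" and E :: "'a::euclidean_space set" and c C :: real
  where "prob_space M" "prob_space N"
    "compactly_supported_borel_measure M" "compactly_supported_borel_measure N"
    "growth_condition M u" "growth_condition N t"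
    "c > 0" "C > 0"
    "\<And>P. {x. P x} \<in> sets borel \<Longrightarrow> (\<And>x. x \<in> E \<Longrightarrow> P x) \<Longrightarrow> AE x in N. P x"
    "\<And>x n. x \<in> E \<Longrightarrow> c * (1 / 2 ^ n) powr u \<le> measure M (cball x (real DIM('a) / 2 ^ n))"
    "\<And>n. \<exists>S \<in> sets borel. measure M S \<le> C * (1 / 2 ^ n) powr (u - t) \<and>
      (\<forall>x\<in>E. cball x (real DIM('a) / 2 ^ n) \<subseteq> S)"
proof -
  define d where "d = real DIM('a)"
  have d: "d \<ge> 1" by (simp add: d_def Suc_leI)
  \<comment> \<open>Every digit position carries d bits, one for each coordinate, so the densities
    of positions are the dimensions divided by d.\<close>
  have pre: "0 < t / d" "t / d \<le> u / d" "u / d \<le> 1" using t u d by (auto simp: d_def divide_simps)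
  obtain D D' :: "nat set" where sub: "D' \<subseteq> D"
    and D: "\<And>n. real n * (u / d) - 1 \<le> real (card (D \<inter> {..<n}))" "\<And>n. real (card (D \<inter> {..<n})) \<le> real n * (u / d)"
    and D': "\<And>n. real n * (t / d) - 2 \<le> real (card (D' \<inter> {..<n}))" "\<And>n. real (card (D' \<inter> {..<n})) \<le> real n * (t / d)"
    by (rule nested_digit_sets[OF pre]) (rule that)
  have d': "d * (real n * (x / d) - y) = real n * x - y * d" "d * (real n * (x / d)) = real n * x" for n x y
    using d by (auto simp: right_diff_distrib)
  have D2: "real n * u - d \<le> real (DIM('a) * card (D \<inter> {..<n}))" "real (DIM('a) * card (D \<inter> {..<n})) \<le> real n * u" for n
    using mult_left_mono[OF D(1)[of n], of d] mult_left_mono[OF D(2)[of n], of d] d unfolding d' by (auto simp: d_def)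
  have D2': "real n * t - 2 * d \<le> real (DIM('a) * card (D' \<inter> {..<n}))" "real (DIM('a) * card (D' \<inter> {..<n})) \<le> real n * t" for n
    using mult_left_mono[OF D'(1)[of n], of d] mult_left_mono[OF D'(2)[of n], of d] d unfolding d' by (auto simp: d_def)
  define M where "M = (cantor_measure D :: 'a measure)"
  define N where "N = (cantor_measure D' :: 'a measure)"
  interpret M: prob_space M unfolding M_def by (rule prob_space_cantor_measure)
  have "\<exists>C>0. \<forall>(x::'a) r. 0 \<le> r \<longrightarrow> measure M (cball x r) \<le> C * r powr u"
    unfolding M_def by (rule cantor_measure_growth[OF _ D2(1)]) (use t in simp)
  then obtain C where C: "C > 0" "\<And>(x::'a) r. 0 \<le> r \<Longrightarrow> measure M (cball x r) \<le> C * r powr u"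
    by auto
  have "\<exists>C>0. \<forall>(x::'a) r. 0 \<le> r \<longrightarrow> measure N (cball x r) \<le> C * r powr t"
    unfolding N_def by (rule cantor_measure_growth[OF t(1) D2'(1)])
  then obtain C' where C': "C' > 0" "\<And>(x::'a) r. 0 \<le> r \<Longrightarrow> measure N (cball x r) \<le> C' * r powr t"
    by auto
  have setsM: "sets M = sets borel" by (simp add: M_def)
  show ?thesis
  proof (rule that[of M N 1 "C * (2 * d) powr u" "range (cantor_point D')"])
    show "prob_space M" "prob_space N"
      unfolding M_def N_def by (rule prob_space_cantor_measure)+
    show "compactly_supported_borel_measure M" "compactly_supported_borel_measure N"
      unfolding M_def N_def by (rule compactly_supported_cantor_measure)+
    show "growth_condition M u"
      by (rule growth_conditionI[OF M.prob_space_axioms C(2)])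
    show "growth_condition N t"
      by (rule growth_conditionI[OF _ C'(2)]) (simp_all add: N_def prob_space_cantor_measure)
    show "0 < C * (2 * d) powr u" using C(1) d by simp
    show "AE x in N. P x" if "{x. P x} \<in> sets borel" "\<And>x. x \<in> range (cantor_point D') \<Longrightarrow> P x" for P
      unfolding N_def using that by (intro AE_cantor_measure) auto
    show "1 * (1 / 2 ^ n) powr u \<le> measure M (cball x (real DIM('a) / 2 ^ n))" if x: "x \<in> range (cantor_point D')" for x n
    proof -
      obtain \<omega> where "x = cantor_point D' \<omega>" using x by auto
      then show ?thesis
        using powr_le_power_half[OF D2(2)[of n]] cantor_measure_ball_lower[OF sub, of n \<omega>] by (simp add: M_def)
    qed
    fix n
    obtain Q :: "'a set" where Q: "finite Q" "card Q \<le> 2 ^ (DIM('a) * card (D' \<inter> {..<n}))"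
        "\<And>\<omega>. \<exists>p\<in>Q. dist p (cantor_point D' \<omega>) \<le> real DIM('a) / 2 ^ n"
      using cantor_point_cover[where D = D' and n = n and 'a = 'a] by (elim exE conjE) (rule that, assumption+, erule spec)
    \<comment> \<open>The doubled radius allows d / 2^n for the distance from E to the covering
      points and d / 2^n for the neighbourhood.\<close>
    define S where "S = (\<Union>p\<in>Q. cball p (2 * d / 2 ^ n))"
    have "measure M S \<le> (\<Sum>p\<in>Q. measure M (cball p (2 * d / 2 ^ n)))"
      unfolding S_def by (intro M.finite_measure_subadditive_finite Q(1)) (auto simp: setsM)
    also have "\<dots> \<le> real (card Q) * (C * (2 * d / 2 ^ n) powr u)"
      using d by (intro sum_bounded_above C(2)) auto
    also have "\<dots> \<le> 2 powr (real n * t) * (C * (2 * d / 2 ^ n) powr u)"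
    proof (intro mult_right_mono)
      have "real (card Q) \<le> 2 ^ (DIM('a) * card (D' \<inter> {..<n}))" using of_nat_mono[OF Q(2), where 'a = real] by simp
      also have "\<dots> = 2 powr real (DIM('a) * card (D' \<inter> {..<n}))"
        by (rule powr_realpow[symmetric]) simp
      also have "\<dots> \<le> 2 powr (real n * t)" using D2'(2)[of n] by (intro powr_mono) auto
      finally show "real (card Q) \<le> 2 powr (real n * t)" .
    qed (use C(1) in simp)
    also have "2 powr (real n * t) = (1 / 2 ^ n) powr (- t)"
      using pow_half_powr[of n "- t"] by simp
    also have "(1 / 2 ^ n) powr (- t) * (C * (2 * d / 2 ^ n) powr u) = C * (2 * d) powr u * (1 / 2 ^ n) powr (u - t)"
    proof -
      have "(2 * d / 2 ^ n) powr u = (2 * d) powr u * (1 / 2 ^ n) powr u"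
        using d by (subst powr_mult[symmetric]) auto
      moreover have "(1 / 2 ^ n) powr (u - t) = (1 / 2 ^ n) powr u * (1 / 2 ^ n :: real) powr (- t)"
        unfolding powr_add[symmetric] by simp
      ultimately show ?thesis by simp
    qed
    finally have mS: "measure M S \<le> C * (2 * d) powr u * (1 / 2 ^ n) powr (u - t)" .
    have sub': "cball x (real DIM('a) / 2 ^ n) \<subseteq> S" if x: "x \<in> range (cantor_point D')" for x
    proof
      fix y assume y: "y \<in> cball x (real DIM('a) / 2 ^ n)"
      obtain \<omega> where "x = cantor_point D' \<omega>" using x by auto
      then obtain p where p: "p \<in> Q" "dist p x \<le> d / 2 ^ n" using Q(3)[of \<omega>] by (auto simp: d_def)
      have "dist p y \<le> dist p x + dist x y" by (rule dist_triangle)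
      also have "\<dots> \<le> 2 * d / 2 ^ n" using y p by (simp add: d_def)
      finally show "y \<in> S" using p(1) by (auto simp: S_def)
    qed
    have "S \<in> sets borel" unfolding S_def by (intro sets.finite_UN Q(1) borel_closed closed_cball)
    then show "\<exists>S \<in> sets borel. measure M S \<le> C * (2 * d) powr u * (1 / 2 ^ n) powr (u - t) \<and>
        (\<forall>x\<in>range (cantor_point D'). cball x (real DIM('a) / 2 ^ n) \<subseteq> S)"
      by (intro bexI[of _ S] conjI ballI mS sub')
  qed simp
qed

section \<open>Lacunary kernels\<close>

text \<open>The exponent m^i makes each scale the m-th power of the preceding one. With a fixed
  ratio between scales the tail of the kernel could not be made negligible against a high power of
  the current scale.\<close>

definition scale :: "nat \<Rightarrow> nat \<Rightarrow> real" where
  "scale m i = 1 / 2 ^ (m ^ i)"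

text \<open>The height r^(-s) gives the transform r^(d - s) gauss(r \<xi>), which for |\<xi>| about
  1 / r has the critical size |\<xi>|^(-(d - s)).\<close>

definition bump :: "nat \<Rightarrow> real \<Rightarrow> nat \<Rightarrow> 'a::euclidean_space \<Rightarrow> real" where
  "bump m s i x = scale m i powr (- s) * gauss (x /\<^sub>R scale m i)"

lemma scale_pos [simp]: "0 < scale m i" and scale_nonneg [simp]: "0 \<le> scale m i"
  and scale_le_1: "scale m i \<le> 1"
  by (simp_all add: scale_def)

lemma scale_nonzero [simp]: "scale m i \<noteq> 0"
  using scale_pos[of m i] by linarith

lemma scale_Suc: "scale m (Suc i) = scale m i ^ m"
  by (simp add: scale_def power_one_over power_mult[symmetric] mult.commute)

lemma scale_Suc_le: "2 \<le> m \<Longrightarrow> scale m (Suc i) \<le> scale m i / 2"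
proof -
  assume m: "2 \<le> m"
  have "m ^ i + 1 \<le> m ^ i + m ^ i" using m by (simp add: Suc_leI)
  also have "\<dots> \<le> m ^ Suc i" using mult_le_mono1[OF m, of "m ^ i"] by (simp only: power_Suc mult_2)
  finally have "(2::real) ^ (m ^ i + 1) \<le> 2 ^ (m ^ Suc i)" by (intro power_increasing) auto
  then show ?thesis by (simp add: scale_def field_simps)
qed

lemma scale_antimono: "i \<le> j \<Longrightarrow> 2 \<le> m \<Longrightarrow> scale m j \<le> scale m i"
proof (induction rule: dec_induct)
  case (step j)
  have "scale m (Suc j) \<le> scale m j / 2" by (rule scale_Suc_le) fact
  also have "\<dots> \<le> scale m j" by simp
  finally show ?case using step by simp
qed simp

lemma scale_add_le: "2 \<le> m \<Longrightarrow> scale m (i + j) \<le> scale m j * (1 / 2) ^ i"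
proof (induction i)
  case (Suc i)
  have "scale m (Suc i + j) \<le> scale m (i + j) / 2" using scale_Suc_le[OF Suc.prems] by simp
  also have "\<dots> \<le> scale m j * (1 / 2) ^ i / 2" using Suc by simp
  finally show ?case by simp
qed simp

text \<open>Lets one factor 1 / r_j absorb the number j + 1 of bumps in a partial sum.\<close>

lemma Suc_times_scale_le: "2 \<le> m \<Longrightarrow> real (Suc j) * scale m j \<le> 1"
proof -
  assume m: "2 \<le> m"
  have "Suc j \<le> 2 ^ (m ^ j)"
  proof -
    have "j < 2 ^ j" by (rule less_exp)
    also have "(2::nat) ^ j \<le> m ^ j" using m by (rule power_mono) simp
    also have "\<dots> < 2 ^ (m ^ j)" by (rule less_exp)
    finally show ?thesis by simp
  qed
  then have "real (Suc j) \<le> 2 ^ (m ^ j)" using of_nat_mono[where 'a = real] by fastforce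
  then show ?thesis by (simp add: scale_def)
qed

lemma
  assumes m: "2 \<le> m" and \<delta>: "0 < \<delta>"
  shows summable_scale_powr: "summable (\<lambda>i. scale m (i + j) powr \<delta>)"
    and suminf_scale_powr_le: "(\<Sum>i. scale m (i + j) powr \<delta>) \<le> scale m j powr \<delta> / (1 - (1 / 2) powr \<delta>)"
proof -
  define q where "q = (1 / 2 :: real) powr \<delta>"
  have q: "0 < q" "q < 1" using \<delta> by (auto simp: q_def powr01_less_one)
  have le: "scale m (i + j) powr \<delta> \<le> scale m j powr \<delta> * q ^ i" for i
  proof -
    have "scale m (i + j) powr \<delta> \<le> (scale m j * (1 / 2) ^ i) powr \<delta>"
      using scale_add_le[OF m] \<delta> by (intro powr_mono2) auto
    also have "\<dots> = scale m j powr \<delta> * q ^ i"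
      by (simp add: powr_mult q_def powr_realpow[symmetric] powr_powr mult.commute)
    finally show ?thesis .
  qed
  have sg: "summable (\<lambda>i. scale m j powr \<delta> * q ^ i)"
    using q by (intro summable_mult summable_geometric) auto
  show s: "summable (\<lambda>i. scale m (i + j) powr \<delta>)"
    using le by (intro summable_comparison_test[OF _ sg]) auto
  have "(\<Sum>i. scale m (i + j) powr \<delta>) \<le> (\<Sum>i. scale m j powr \<delta> * q ^ i)"
    by (rule suminf_le[OF le s sg])
  also have "\<dots> = scale m j powr \<delta> / (1 - q)"
    using q by (simp add: suminf_mult summable_geometric suminf_geometric)
  finally show "(\<Sum>i. scale m (i + j) powr \<delta>) \<le> scale m j powr \<delta> / (1 - (1 / 2) powr \<delta>)"
    by (simp add: q_def)
qed

lemma bump_nonneg [simp]: "0 \<le> bump m s i x"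
  by (simp add: bump_def)

lemma bump_minus [simp]: "bump m s i (- x) = bump m s i x"
  by (simp add: bump_def)

lemma borel_measurable_bump [measurable]: "bump m s i \<in> borel_measurable borel"
  unfolding bump_def by measurable

lemma scale_powr_mult_power: "scale m i powr (- s) * scale m i ^ n = scale m i powr (real n - s)"
  by (simp add: powr_diff powr_minus powr_realpow field_simps)

lemma
  fixes \<xi> :: "'a::euclidean_space"
  shows integrable_bump: "integrable lborel (bump m s i :: 'a \<Rightarrow> real)"
    and integral_bump: "(LINT x|lborel. bump m s i (x::'a)) = scale m i powr (real DIM('a) - s)"
    and integral_cis_bump: "(LINT x|lborel. cis (- 2 * pi * (x \<bullet> \<xi>)) * complex_of_real (bump m s i x))
      = complex_of_real (scale m i powr (real DIM('a) - s) * gauss (scale m i *\<^sub>R \<xi>))"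
proof -
  show "integrable lborel (bump m s i :: 'a \<Rightarrow> real)"
    unfolding bump_def using integrable_gauss_affine[of "inverse (scale m i)" 0] by simp
  have *: "(LINT x|lborel. cis (- 2 * pi * (x \<bullet> \<xi>)) * complex_of_real (bump m s i x))
      = complex_of_real (scale m i powr (real DIM('a) - s) * gauss (scale m i *\<^sub>R \<xi>))" for \<xi> :: 'a
  proof -
    have "(LINT x|lborel. cis (- 2 * pi * (x \<bullet> \<xi>)) * complex_of_real (bump m s i x))
      = (LINT x|lborel. complex_of_real (scale m i powr (- s)) * (cis (2 * pi * (x \<bullet> (- \<xi>))) * complex_of_real (gauss (x /\<^sub>R scale m i))))"
      by (intro Bochner_Integration.integral_cong) (auto simp: bump_def)
    also have "\<dots> = complex_of_real (scale m i powr (- s)) * complex_of_real (scale m i ^ DIM('a) * gauss (scale m i *\<^sub>R (- \<xi>)))"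
      unfolding integral_mult_right_zero by (subst integral_cis_gauss_scaled) simp_all
    also have "\<dots> = complex_of_real ((scale m i powr (- s) * scale m i ^ DIM('a)) * gauss (scale m i *\<^sub>R \<xi>))"
      by simp
    finally show ?thesis unfolding scale_powr_mult_power .
  qed
  then show "(LINT x|lborel. cis (- 2 * pi * (x \<bullet> \<xi>)) * complex_of_real (bump m s i x))
      = complex_of_real (scale m i powr (real DIM('a) - s) * gauss (scale m i *\<^sub>R \<xi>))" .
  have "complex_of_real (LINT x|lborel. bump m s i (x::'a)) = complex_of_real (scale m i powr (real DIM('a) - s))"
    using *[of 0] by (simp add: gauss_def)
  then show "(LINT x|lborel. bump m s i (x::'a)) = scale m i powr (real DIM('a) - s)"
    by (simp only: of_real_eq_iff)
qed

text \<open>With j = 0 this is the full kernel. Where the series diverges, as at the origin for s >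
  0, the value is an unspecified default; \<open>AE_summable_bump\<close> confines this to a null
  set.\<close>

definition kernel_tail :: "nat \<Rightarrow> real \<Rightarrow> nat \<Rightarrow> 'a::euclidean_space \<Rightarrow> real" where
  "kernel_tail m s j x = (\<Sum>i. bump m s (i + j) x)"

definition kernel_partial :: "nat \<Rightarrow> real \<Rightarrow> nat \<Rightarrow> 'a::euclidean_space \<Rightarrow> real" where
  "kernel_partial m s j x = (\<Sum>i<j. bump m s i x)"

text \<open>The bumps are nonnegative with integrals r_i^(d - s), which are summable for s < d, so
  their sum has finite integral and is finite almost everywhere.\<close>

lemma AE_summable_bump:
  assumes m: "2 \<le> m" and s: "s < real DIM('a::euclidean_space)"
  shows "AE x in lborel. summable (\<lambda>i. bump m s (i + j) (x::'a))"
proof -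
  have "(\<integral>\<^sup>+x. (\<Sum>i. ennreal (bump m s (i + j) (x::'a))) \<partial>lborel) = (\<Sum>i. ennreal (scale m (i + j) powr (real DIM('a) - s)))"
    by (subst nn_integral_suminf) (auto simp: nn_integral_eq_integral integrable_bump integral_bump)
  also have "\<dots> \<noteq> \<infinity>"
    using summable_scale_powr[OF m, of "real DIM('a) - s" j] s by (subst suminf_ennreal2) auto
  finally have "AE x in lborel. (\<Sum>i. ennreal (bump m s (i + j) (x::'a))) \<noteq> \<infinity>"
    by (intro nn_integral_PInf_AE) auto
  then show ?thesis
    by eventually_elim (auto intro: summable_suminf_not_top)
qed

lemma
  assumes m: "2 \<le> m" and s: "s < real DIM('a::euclidean_space)"
  shows integrable_kernel_tail: "integrable lborel (kernel_tail m s j :: 'a \<Rightarrow> real)"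
    and integral_kernel_tail_le: "(LINT x|lborel. kernel_tail m s j (x::'a))
      \<le> scale m j powr (real DIM('a) - s) / (1 - (1 / 2) powr (real DIM('a) - s))"
    and fourier_kernel_tail: "fourier (\<lambda>x. complex_of_real (kernel_tail m s j x)) (\<xi>::'a) =
      complex_of_real (\<Sum>i. scale m (i + j) powr (real DIM('a) - s) * gauss (scale m (i + j) *\<^sub>R \<xi>))"
proof -
  define \<delta> where "\<delta> = real DIM('a) - s"
  have \<delta>: "\<delta> > 0" using s by (simp add: \<delta>_def)
  have 1: "AE x in lborel. summable (\<lambda>i. norm (bump m s (i + j) (x::'a)))"
    using AE_summable_bump[OF m s] by simp
  have 2: "summable (\<lambda>i. LINT x|lborel. norm (bump m s (i + j) (x::'a)))"
    using summable_scale_powr[OF m \<delta>, of j] by (simp add: integral_bump \<delta>_def)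
  show "integrable lborel (kernel_tail m s j :: 'a \<Rightarrow> real)"
    unfolding kernel_tail_def by (rule integrable_suminf[OF integrable_bump 1 2])
  have "(LINT x|lborel. kernel_tail m s j (x::'a)) = (\<Sum>i. scale m (i + j) powr \<delta>)"
    unfolding kernel_tail_def by (subst integral_suminf[OF integrable_bump 1 2]) (simp add: integral_bump \<delta>_def)
  also have "\<dots> \<le> scale m j powr \<delta> / (1 - (1 / 2) powr \<delta>)"
    by (rule suminf_scale_powr_le[OF m \<delta>])
  finally show "(LINT x|lborel. kernel_tail m s j (x::'a))
      \<le> scale m j powr (real DIM('a) - s) / (1 - (1 / 2) powr (real DIM('a) - s))"
    unfolding \<delta>_def .
  define g where "g = (\<lambda>i (x::'a). cis (- 2 * pi * (x \<bullet> \<xi>)) * complex_of_real (bump m s (i + j) x))"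
  have gi: "integrable lborel (g i)" for i
    unfolding g_def by (intro integrable_cis_mult integrable_of_real integrable_bump continuous_intros) simp
  have ng: "norm (g i x) = norm (bump m s (i + j) x)" for i x by (simp add: g_def norm_mult)
  have eq: "AE x in lborel. cis (- 2 * pi * (x \<bullet> \<xi>)) * complex_of_real (kernel_tail m s j x) = (\<Sum>i. g i x)"
    using AE_summable_bump[OF m s]
  proof eventually_elim
    fix x :: 'a assume "summable (\<lambda>i. bump m s (i + j) x)"
    then have "(\<lambda>i. bump m s (i + j) x) sums kernel_tail m s j x"
      unfolding kernel_tail_def by (rule summable_sums)
    then have "(\<lambda>i. g i x) sums (cis (- 2 * pi * (x \<bullet> \<xi>)) * complex_of_real (kernel_tail m s j x))"
      unfolding g_def by (intro sums_mult sums_of_real)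
    then show "cis (- 2 * pi * (x \<bullet> \<xi>)) * complex_of_real (kernel_tail m s j x) = (\<Sum>i. g i x)"
      by (simp add: sums_unique)
  qed
  have tm: "(\<lambda>x::'a. kernel_tail m s j x) \<in> borel_measurable borel"
    unfolding kernel_tail_def by measurable
  have cm: "(\<lambda>x. cis (- 2 * pi * (x \<bullet> \<xi>))) \<in> borel_measurable borel"
    by (intro borel_measurable_continuous_onI continuous_intros)
  have gm: "(\<lambda>x. \<Sum>i. g i x) \<in> borel_measurable lborel"
    using borel_measurable_integrable[OF gi] by (rule borel_measurable_suminf)
  have "fourier (\<lambda>x. complex_of_real (kernel_tail m s j x)) \<xi> = (LINT x|lborel. (\<Sum>i. g i x))"
    unfolding fourier_def by (rule integral_cong_AE) (use tm cm gm eq in auto)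
  also have "\<dots> = (\<Sum>i. LINT x|lborel. g i x)"
    using 1 2 by (intro integral_suminf gi) (simp_all only: ng)
  also have "\<dots> = (\<Sum>i. complex_of_real (scale m (i + j) powr (real DIM('a) - s) * gauss (scale m (i + j) *\<^sub>R \<xi>)))"
    unfolding g_def integral_cis_bump ..
  also have "\<dots> = complex_of_real (\<Sum>i. scale m (i + j) powr (real DIM('a) - s) * gauss (scale m (i + j) *\<^sub>R \<xi>))"
  proof (intro suminf_of_real[symmetric] summable_comparison_test[OF _ summable_scale_powr[OF m \<delta>, of j]] exI[of _ 0] allI impI)
    fix i
    show "norm (scale m (i + j) powr (real DIM('a) - s) * gauss (scale m (i + j) *\<^sub>R \<xi>)) \<le> scale m (i + j) powr \<delta>"
      by (auto simp: abs_mult \<delta>_def intro!: mult_left_le)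
  qed
  finally show "fourier (\<lambda>x. complex_of_real (kernel_tail m s j x)) (\<xi>::'a) =
      complex_of_real (\<Sum>i. scale m (i + j) powr (real DIM('a) - s) * gauss (scale m (i + j) *\<^sub>R \<xi>))" .
qed

text \<open>
  With \<open>v = t powr \<delta>\<close> and \<open>q = (1 / 2) powr \<delta>\<close>, the term \<open>v * gauss t\<close> is dominated by the
  increment of \<open>v / (1 + v)\<close> between \<open>t / 2\<close> and \<open>t\<close>, so that lacunary sums telescope.
\<close>
lemma powr_gauss_le_increment:
  fixes d :: nat
  assumes \<delta>: "0 < \<delta>" "\<delta> \<le> real d" and t: "t > 0" and q: "q = (1 / 2) powr \<delta>"
  shows "t powr \<delta> * exp (- pi * t\<^sup>2)
    \<le> (8 + 2 * real d ^ d) / (1 - q) * (t powr \<delta> / (1 + t powr \<delta>) - (t / 2) powr \<delta> / (1 + (t / 2) powr \<delta>))"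
proof -
  define v where "v = t powr \<delta>"
  have v: "v > 0" using t by (simp add: v_def)
  have q01: "0 < q" "q < 1" using \<delta> q by (auto simp: powr01_less_one)
  have d: "d > 0" using \<delta> by (cases d) auto
  have half: "(t / 2) powr \<delta> = v * q" using t by (simp add: v_def q powr_mult[symmetric])
  have "v \<le> 1 + t ^ d"
  proof (cases "t \<le> 1")
    case True
    then have "v \<le> 1" using t \<delta> by (simp add: v_def powr_le1)
    then show ?thesis using t zero_le_power[of t d] by linarith
  next
    case False
    then have "v \<le> t powr real d" unfolding v_def using \<delta> by (intro powr_mono) auto
    then show ?thesis using t by (simp add: powr_realpow)
  qed
  \<comment> \<open>Origin of the constant: (2 + t^d)^2 <= 8 + 2 t^(2 d), and t^(2 d) = d^d (t^2 /
    d)^d <= d^d exp(t^2).\<close>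
  then have "(1 + v)\<^sup>2 \<le> (2 + t ^ d)\<^sup>2" using v by (intro power_mono) auto
  also have "\<dots> \<le> 8 + 2 * (t ^ d)\<^sup>2"
    using sum_squares_bound[of 2 "t ^ d"] by (simp add: power2_eq_square algebra_simps)
  also have "(t ^ d)\<^sup>2 = real d ^ d * (t\<^sup>2 / real d) ^ d"
    using d by (simp add: power_divide power_mult[symmetric] mult.commute)
  also have "8 + 2 * (real d ^ d * (t\<^sup>2 / real d) ^ d) \<le> 8 * exp (t\<^sup>2) + 2 * (real d ^ d * exp (t\<^sup>2))"
  proof (intro add_mono mult_left_mono)
    have "(t\<^sup>2 / real d) ^ d \<le> (1 + t\<^sup>2 / real d) ^ d" by (intro power_mono) auto
    also have "\<dots> \<le> exp (t\<^sup>2)" using d zero_le_power2[of t] by (intro exp_ge_one_plus_x_over_n_power_n) linarith+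
    finally show "(t\<^sup>2 / real d) ^ d \<le> exp (t\<^sup>2)" .
    show "8 \<le> 8 * exp (t\<^sup>2)" by simp
  qed auto
  also have "\<dots> = (8 + 2 * real d ^ d) * exp (t\<^sup>2)" by (simp add: algebra_simps)
  also have "\<dots> \<le> (8 + 2 * real d ^ d) * exp (pi * t\<^sup>2)"
    using pi_gt3 by (intro mult_left_mono) (auto simp: mult_le_cancel_right1)
  finally have "(1 + v)\<^sup>2 * exp (- pi * t\<^sup>2) \<le> 8 + 2 * real d ^ d"
    by (simp add: exp_minus field_simps)
  then have "exp (- pi * t\<^sup>2) \<le> (8 + 2 * real d ^ d) / (1 + v)\<^sup>2"
    using v by (simp add: pos_le_divide_eq mult.commute)
  then have "v * exp (- pi * t\<^sup>2) \<le> v * ((8 + 2 * real d ^ d) / (1 + v)\<^sup>2)"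
    using v by (intro mult_left_mono) auto
  also have "\<dots> = (8 + 2 * real d ^ d) / (1 - q) * (v * (1 - q) / ((1 + v) * (1 + v)))"
  proof -
    have "v * (K / Y) = K / (1 - q) * (v * (1 - q) / Y)" for K Y
      using q01 by simp
    then show ?thesis unfolding power2_eq_square .
  qed
  \<comment> \<open>Replacing one factor 1 + v by the smaller 1 + v q turns the quotient into an
    exact difference of two fractions, the values at t and t / 2.\<close>
  also have "\<dots> \<le> (8 + 2 * real d ^ d) / (1 - q) * (v * (1 - q) / ((1 + v) * (1 + v * q)))"
  proof (intro mult_left_mono divide_left_mono)
    show "1 + v * q \<le> 1 + v" using q01 v by simp
  qed (use q01 v in \<open>auto intro!: mult_pos_pos add_pos_pos\<close>)
  also have "v * (1 - q) / ((1 + v) * (1 + v * q)) = v / (1 + v) - v * q / (1 + v * q)"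
  proof -
    have "1 + v \<noteq> 0" "1 + v * q \<noteq> 0" using q01 v by (auto simp: add_pos_pos less_imp_neq[symmetric])
    then show ?thesis by (simp add: diff_frac_eq) (simp add: algebra_simps)
  qed
  finally show ?thesis unfolding half v_def .
qed

lemma summable_scale_gauss:
  assumes m: "2 \<le> m" and \<delta>: "0 < \<delta>"
  shows "summable (\<lambda>i. scale m i powr \<delta> * gauss (scale m i *\<^sub>R \<xi>))"
proof (rule summable_comparison_test'[where N = 0])
  show "summable (\<lambda>i. scale m i powr \<delta>)" using summable_scale_powr[OF m \<delta>, of 0] by simp
  show "norm (scale m i powr \<delta> * gauss (scale m i *\<^sub>R \<xi>)) \<le> scale m i powr \<delta>" for i
    by (simp add: abs_mult mult_left_le)
qed

text \<open>In terms of t_i = r_i |\<xi>| the i-th summand is |\<xi>|^(-\<delta>) t_i^\<delta>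
  exp(-pi t_i^2). As t_(i+1) <= t_i / 2 and v / (1 + v) is increasing with values in [0, 1], the
  increments telescope to at most 1.\<close>

lemma lacunary_gauss_sum_le:
  fixes \<xi> :: "'a::euclidean_space"
  assumes m: "2 \<le> m" and \<delta>: "0 < \<delta>" "\<delta> \<le> real DIM('a)" and \<xi>: "\<xi> \<noteq> 0"
  shows "(\<Sum>i. scale m i powr \<delta> * gauss (scale m i *\<^sub>R \<xi>))
    \<le> (8 + 2 * real DIM('a) ^ DIM('a)) / (1 - (1 / 2) powr \<delta>) * norm \<xi> powr (- \<delta>)"
proof (rule suminf_le_const)
  show "summable (\<lambda>i. scale m i powr \<delta> * gauss (scale m i *\<^sub>R \<xi>))"
    by (rule summable_scale_gauss[OF m \<delta>(1)])
  fix n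
  define \<psi> where "\<psi> = (\<lambda>t. t powr \<delta> / (1 + t powr \<delta>))"
  define c where "c = (8 + 2 * real DIM('a) ^ DIM('a)) / (1 - (1 / 2) powr \<delta>)"
  have c: "c \<ge> 0" using \<delta> by (auto simp: c_def powr01_less_one less_imp_le)
  define t where "t = (\<lambda>i. scale m i * norm \<xi>)"
  have t: "t i > 0" for i using \<xi> by (simp add: t_def)
  have mono: "\<psi> x \<le> \<psi> y" if "0 < x" "x \<le> y" for x y
  proof -
    have "x powr \<delta> \<le> y powr \<delta>" using that \<delta> by (intro powr_mono2) auto
    then show ?thesis unfolding \<psi>_def by (simp add: divide_simps add_pos_nonneg) (simp add: algebra_simps)
  qed
  have step: "scale m i powr \<delta> * gauss (scale m i *\<^sub>R \<xi>) \<le> norm \<xi> powr (- \<delta>) * (c * (\<psi> (t i) - \<psi> (t (Suc i))))" for i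
  proof -
    have "scale m i powr \<delta> * gauss (scale m i *\<^sub>R \<xi>) = norm \<xi> powr (- \<delta>) * (t i powr \<delta> * exp (- pi * (t i)\<^sup>2))"
      using \<xi> by (simp add: t_def gauss_def powr_mult powr_minus)
    also have "\<dots> \<le> norm \<xi> powr (- \<delta>) * (c * (\<psi> (t i) - \<psi> (t i / 2)))"
      unfolding c_def \<psi>_def by (intro mult_left_mono powr_gauss_le_increment[OF \<delta> t]) auto
    also have "\<dots> \<le> norm \<xi> powr (- \<delta>) * (c * (\<psi> (t i) - \<psi> (t (Suc i))))"
    proof (intro mult_left_mono diff_left_mono mono c t)
      show "t (Suc i) \<le> t i / 2"
        using mult_right_mono[OF scale_Suc_le[OF m, of i], of "norm \<xi>"] by (simp add: t_def)
    qed auto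
    finally show ?thesis .
  qed
  have "(\<Sum>i<n. scale m i powr \<delta> * gauss (scale m i *\<^sub>R \<xi>)) \<le> (\<Sum>i<n. norm \<xi> powr (- \<delta>) * (c * (\<psi> (t i) - \<psi> (t (Suc i)))))"
    by (rule sum_mono) (rule step)
  also have "\<dots> = norm \<xi> powr (- \<delta>) * (c * (\<psi> (t 0) - \<psi> (t n)))"
    by (simp only: sum_distrib_left[symmetric] sum_lessThan_telescope'[of "\<lambda>i. \<psi> (t i)" n])
  also have "\<dots> \<le> norm \<xi> powr (- \<delta>) * (c * 1)"
  proof (intro mult_left_mono c)
    have "\<psi> (t 0) \<le> 1" "0 \<le> \<psi> (t n)" by (auto simp: \<psi>_def divide_simps add_pos_nonneg)
    then show "\<psi> (t 0) - \<psi> (t n) \<le> 1" by linarith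
  qed auto
  finally show "(\<Sum>i<n. scale m i powr \<delta> * gauss (scale m i *\<^sub>R \<xi>))
    \<le> (8 + 2 * real DIM('a) ^ DIM('a)) / (1 - (1 / 2) powr \<delta>) * norm \<xi> powr (- \<delta>)"
    by (simp add: c_def mult.commute)
qed

section \<open>The kernel as a tempered distribution\<close>

definition kernel_distr :: "nat \<Rightarrow> real \<Rightarrow> ('a::euclidean_space \<Rightarrow> complex) \<Rightarrow> complex" where
  "kernel_distr m s \<phi> = (LINT x|lborel. complex_of_real (kernel_tail m s 0 x) * \<phi> x)"

lemma schwartz_measurable: "f \<in> schwartz \<Longrightarrow> f \<in> borel_measurable borel"
  by (auto simp: schwartz_def intro: smooth_measurable)

lemma integrable_mult_schwartz:
  fixes k :: "'a::euclidean_space \<Rightarrow> complex"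
  assumes k: "integrable lborel k" and f: "f \<in> schwartz"
  shows "integrable lborel (\<lambda>x. k x * f x)"
proof -
  obtain B where B: "B \<ge> 0" "\<And>x. norm (f x) \<le> B" using schwartz_bounded[OF f, of 0] by auto
  show ?thesis
  proof (rule Bochner_Integration.integrable_bound[OF integrable_mult_left[OF integrable_norm[OF k], of B]])
    show "(\<lambda>x. k x * f x) \<in> borel_measurable lborel"
      using borel_measurable_integrable[OF k] schwartz_measurable[OF f] by simp
    show "AE x in lborel. norm (k x * f x) \<le> norm (norm (k x) * B)"
      using B by (auto simp: norm_mult abs_mult intro!: AE_I2 mult_left_mono)
  qed
qed

text \<open>Integration against an integrable function is continuous already for uniform
  convergence, that is, for the zeroth seminorm.\<close>

lemma tempered_distribution_integral:
  fixes k :: "'a::euclidean_space \<Rightarrow> complex"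
  assumes k: "integrable lborel k"
  shows "tempered_distribution (\<lambda>\<phi>. LINT x|lborel. k x * \<phi> x)"
  unfolding tempered_distribution_def
proof (intro conjI ballI allI impI)
  fix \<phi> \<psi> :: "'a \<Rightarrow> complex" assume "\<phi> \<in> schwartz" "\<psi> \<in> schwartz"
  then show "(LINT x|lborel. k x * (\<phi> x + \<psi> x)) = (LINT x|lborel. k x * \<phi> x) + (LINT x|lborel. k x * \<psi> x)"
    by (simp add: distrib_left integrable_mult_schwartz[OF k])
next
  fix c and \<phi> :: "'a \<Rightarrow> complex"
  show "(LINT x|lborel. k x * (c * \<phi> x)) = c * (LINT x|lborel. k x * \<phi> x)"
    by (simp add: mult.left_commute)
next
  fix \<phi> :: "nat \<Rightarrow> 'a \<Rightarrow> complex" and \<psi> :: "'a \<Rightarrow> complex"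
  assume \<phi>: "\<forall>n. \<phi> n \<in> schwartz" and \<psi>: "\<psi> \<in> schwartz" and lim: "schwartz_tendsto \<phi> \<psi>"
  define e where "e = (\<lambda>n. schwartz_seminorm 0 [] (\<lambda>x. \<phi> n x - \<psi> x))"
  have e0: "e \<longlonglongrightarrow> 0"
    unfolding e_def using lim[unfolded schwartz_tendsto_def, THEN spec[of _ 0], THEN bspec[of _ _ "[]"]] by simp
  have e: "norm (\<phi> n x - \<psi> x) \<le> e n" for n x
  proof -
    obtain B1 where B1: "\<And>x. norm (\<phi> n x) \<le> B1" using schwartz_bounded[of "\<phi> n" 0] \<phi> by auto
    obtain B2 where B2: "\<And>x. norm (\<psi> x) \<le> B2" using schwartz_bounded[OF \<psi>, of 0] by auto
    have "bdd_above (range (\<lambda>x. norm (\<phi> n x - \<psi> x)))"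
      by (intro bdd_aboveI2[of _ _ "B1 + B2"] order_trans[OF norm_triangle_ineq4] add_mono B1 B2)
    from cSUP_upper[OF _ this, of x] show ?thesis by (simp add: e_def schwartz_seminorm_def)
  qed
  define I where "I = (LINT x|lborel. norm (k x))"
  have diff_le: "norm ((LINT x|lborel. k x * \<phi> n x) - (LINT x|lborel. k x * \<psi> x)) \<le> I * e n" for n
  proof -
    have "(LINT x|lborel. k x * \<phi> n x) - (LINT x|lborel. k x * \<psi> x) = (LINT x|lborel. k x * \<phi> n x - k x * \<psi> x)"
      using \<phi> \<psi> by (intro Bochner_Integration.integral_diff[symmetric] integrable_mult_schwartz[OF k]) auto
    also have "norm \<dots> \<le> (LINT x|lborel. norm (k x) * e n)"
    proof (rule order_trans[OF integral_norm_bound integral_mono])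
      show "integrable lborel (\<lambda>x. norm (k x * \<phi> n x - k x * \<psi> x))"
        using \<phi> \<psi> by (intro integrable_norm Bochner_Integration.integrable_diff integrable_mult_schwartz[OF k]) auto
      show "integrable lborel (\<lambda>x. norm (k x) * e n)" using k by simp
      show "norm (k x * \<phi> n x - k x * \<psi> x) \<le> norm (k x) * e n" for x
        using e[of n x] by (simp add: right_diff_distrib[symmetric] norm_mult mult_left_mono)
    qed
    finally show ?thesis by (simp add: I_def)
  qed
  have "(\<lambda>n. I * e n) \<longlonglongrightarrow> 0" by (rule tendsto_mult_right_zero[OF e0])
  then have "(\<lambda>n. (LINT x|lborel. k x * \<phi> n x) - (LINT x|lborel. k x * \<psi> x)) \<longlonglongrightarrow> 0"
    by (rule Lim_null_comparison[rotated]) (intro always_eventually allI diff_le)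
  then show "(\<lambda>n. LINT x|lborel. k x * \<phi> n x) \<longlonglongrightarrow> (LINT x|lborel. k x * \<psi> x)"
    by (simp add: LIM_zero_iff)
qed

lemma fourier_measurable:
  fixes k :: "'a::euclidean_space \<Rightarrow> complex"
  assumes k: "integrable lborel k"
  shows "fourier k \<in> borel_measurable borel"
proof -
  have "fourier k = (\<lambda>\<xi>. ft_measure lborel k (- \<xi>))"
    by (simp add: fun_eq_iff fourier_def ft_measure_def)
  also have "\<dots> \<in> borel_measurable borel"
    using ft_measure_measurable[OF lborel.sigma_finite_measure_axioms sets_lborel k] by simp
  finally show ?thesis .
qed

text \<open>The multiplication formula: by Fubini the Fourier transform moves from one factor of the
  integral to the other.\<close>

lemma represented_by_fourier:
  fixes k :: "'a::euclidean_space \<Rightarrow> complex"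
  assumes k: "integrable lborel k"
  shows "represented_by (fourier_distr (\<lambda>\<phi>. LINT x|lborel. k x * \<phi> x)) (fourier k)"
  unfolding represented_by_def fourier_distr_def has_bochner_integral_iff
proof (intro ballI conjI)
  fix \<phi> :: "'a \<Rightarrow> complex" assume \<phi>: "\<phi> \<in> schwartz"
  have \<phi>i: "integrable lborel \<phi>" by (rule schwartz_integrable[OF \<phi>])
  show "integrable lborel (\<lambda>x. fourier k x * \<phi> x)"
  proof (rule Bochner_Integration.integrable_bound[OF integrable_mult_right[OF integrable_norm[OF \<phi>i], of "LINT x|lborel. norm (k x)"]])
    show "(\<lambda>x. fourier k x * \<phi> x) \<in> borel_measurable lborel"
      using fourier_measurable[OF k] borel_measurable_integrable[OF \<phi>i] by simp
    show "AE x in lborel. norm (fourier k x * \<phi> x) \<le> norm ((LINT x|lborel. norm (k x)) * norm (\<phi> x))"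
      using norm_fourier_le[of k] by (auto simp: norm_mult abs_mult intro!: AE_I2 mult_right_mono order_trans[OF _ abs_ge_self])
  qed
  have "(LINT x|lborel. k x * fourier \<phi> x) = (LINT y|lborel. \<phi> y * (LINT x|lborel. cis (- 2 * pi * (y \<bullet> x)) * k x))"
    unfolding fourier_def
  proof (rule integral_swap_bounded[OF _ _ k \<phi>i, where B = 1])
    show "(\<lambda>(x, y). cis (- 2 * pi * (y \<bullet> x))) \<in> borel_measurable (lborel \<Otimes>\<^sub>M lborel)"
      unfolding split_beta' lborel_prod
      by (simp, intro borel_measurable_continuous_onI continuous_intros)
  qed (auto intro: lborel.sigma_finite_measure_axioms)
  also have "\<dots> = (LINT y|lborel. fourier k y * \<phi> y)"
    by (simp add: fourier_def inner_commute mult.commute)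
  finally show "integral\<^sup>L lborel (\<lambda>x. fourier k x * \<phi> x) = (LINT x|lborel. k x * fourier \<phi> x)" by simp
qed

lemma locally_integrable_fourier:
  fixes k :: "'a::euclidean_space \<Rightarrow> complex"
  assumes k: "integrable lborel k"
  shows "locally_integrable (fourier k)"
  unfolding locally_integrable_def set_integrable_def
proof (intro allI impI)
  fix K :: "'a set" assume K: "compact K"
  have Ki: "integrable lborel (\<lambda>x. indicator K x * (LINT x|lborel. norm (k x)) :: real)"
    using borel_compact[OF K] emeasure_compact_finite[OF K] by (intro integrable_mult_left integrable_real_indicator) auto
  show "integrable lborel (\<lambda>x. indicator K x *\<^sub>R fourier k x)"
  proof (rule Bochner_Integration.integrable_bound[OF Ki])
    show "(\<lambda>x. indicator K x *\<^sub>R fourier k x) \<in> borel_measurable lborel"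
      using fourier_measurable[OF k] borel_compact[OF K] by simp
    show "AE x in lborel. norm (indicator K x *\<^sub>R fourier k x) \<le> norm (indicator K x * (LINT x|lborel. norm (k x)))"
      using norm_fourier_le[of k] by (auto simp: indicator_def intro!: AE_I2 order_trans[OF _ abs_ge_self])
  qed
qed

text \<open>For |\<xi>| >= 1 the lacunary sum gives decay of order d - s, which is at least
  \<alpha>. For smaller |\<xi>| the transform is bounded by the L1 norm of the kernel while
  |\<xi>|^(-\<alpha>) >= 1. So one kernel serves every \<alpha> up to d - s.\<close>

lemma
  assumes m: "2 \<le> m" and s: "0 < s" "s < real DIM('a::euclidean_space)"
    and \<alpha>: "0 \<le> \<alpha>" "\<alpha> \<le> real DIM('a) - s"
  shows tempered_kernel_distr: "tempered_distribution (kernel_distr m s :: ('a \<Rightarrow> complex) \<Rightarrow> complex)"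
    and fourier_decay_kernel_distr: "fourier_decay (kernel_distr m s :: ('a \<Rightarrow> complex) \<Rightarrow> complex) \<alpha>"
proof -
  define k where "k = (\<lambda>x::'a. complex_of_real (kernel_tail m s 0 x))"
  have k: "integrable lborel k" unfolding k_def by (intro integrable_of_real integrable_kernel_tail[OF m s(2)])
  have eq: "(kernel_distr m s :: ('a \<Rightarrow> complex) \<Rightarrow> complex) = (\<lambda>\<phi>. LINT x|lborel. k x * \<phi> x)"
    by (simp add: fun_eq_iff kernel_distr_def k_def)
  show "tempered_distribution (kernel_distr m s :: ('a \<Rightarrow> complex) \<Rightarrow> complex)"
    unfolding eq by (rule tempered_distribution_integral[OF k])
  define \<delta> where "\<delta> = real DIM('a) - s"
  have \<delta>: "0 < \<delta>" "\<delta> \<le> real DIM('a)" using s by (auto simp: \<delta>_def)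
  define c1 where "c1 = (8 + 2 * real DIM('a) ^ DIM('a)) / (1 - (1 / 2) powr \<delta>)"
  define c2 where "c2 = (LINT x|lborel. norm (k x))"
  define c where "c = max c1 c2"
  have c: "c \<ge> 0" unfolding c_def c2_def by (auto simp: le_max_iff_disj intro: Bochner_Integration.integral_nonneg)
  have "norm (fourier k \<xi>) \<le> c * norm \<xi> powr (- \<alpha>)" if \<xi>: "\<xi> \<noteq> 0" for \<xi>
  proof (cases "1 \<le> norm \<xi>")
    case True
    have nonneg: "0 \<le> (\<Sum>i. scale m i powr \<delta> * gauss (scale m i *\<^sub>R \<xi>))"
    proof (rule suminf_nonneg)
      show "summable (\<lambda>i. scale m i powr \<delta> * gauss (scale m i *\<^sub>R \<xi>))"
        by (rule summable_scale_gauss[OF m \<delta>(1)])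
    qed simp
    have "norm (fourier k \<xi>) = (\<Sum>i. scale m i powr \<delta> * gauss (scale m i *\<^sub>R \<xi>))"
      using fourier_kernel_tail[OF m s(2), of 0 \<xi>] nonneg by (simp add: k_def \<delta>_def)
    also have "\<dots> \<le> c1 * norm \<xi> powr (- \<delta>)"
      unfolding c1_def by (rule lacunary_gauss_sum_le[OF m \<delta> \<xi>])
    also have "\<dots> \<le> c * norm \<xi> powr (- \<alpha>)"
      using True \<alpha> c by (intro mult_mono powr_mono) (auto simp: c_def \<delta>_def)
    finally show ?thesis .
  next
    case False
    have "norm (fourier k \<xi>) \<le> c2 * 1" using norm_fourier_le[of k \<xi>] by (simp add: c2_def)
    also have "\<dots> \<le> c * norm \<xi> powr (- \<alpha>)"
    proof (intro mult_mono)
      have "norm \<xi> powr \<alpha> \<le> 1" using False \<xi> \<alpha>(1) by (intro powr_le1) auto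
      then show "1 \<le> norm \<xi> powr (- \<alpha>)" using \<xi> by (simp add: powr_minus one_le_inverse_iff)
    qed (use c in \<open>auto simp: c_def\<close>)
    finally show ?thesis .
  qed
  then have "AE \<xi> in lborel. norm (fourier k \<xi>) \<le> c * norm \<xi> powr (- \<alpha>)"
    using AE_lborel_singleton[of "0::'a"] by (auto elim: eventually_mono)
  then show "fourier_decay (kernel_distr m s :: ('a \<Rightarrow> complex) \<Rightarrow> complex) \<alpha>"
    unfolding fourier_decay_def eq
    using represented_by_fourier[OF k] locally_integrable_fourier[OF k] by blast
qed

section \<open>The mollified kernel compared with its partial sums\<close>

lemma gauss_lipschitz: "\<bar>gauss x - gauss y\<bar> \<le> 2 * pi * norm (x - y)"
proof -
  define \<phi> where "\<phi> = (\<lambda>t::real. exp (- pi * t\<^sup>2))"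
  have tb: "\<bar>t\<bar> * exp (- pi * t\<^sup>2) \<le> 1" for t :: real
  proof -
    have "\<bar>t\<bar> \<le> 1 + t\<^sup>2"
      using zero_le_power2[of "\<bar>t\<bar> - 1"] by (simp add: power2_eq_square algebra_simps)
    also have "\<dots> \<le> exp (t\<^sup>2)" by (rule exp_ge_add_one_self)
    also have "\<dots> \<le> exp (pi * t\<^sup>2)" using pi_gt3 by (auto simp: mult_le_cancel_right1)
    finally show ?thesis by (simp add: exp_minus field_simps)
  qed
  have "norm (\<phi> a - \<phi> b) \<le> 2 * pi * norm (a - b)" for a b
  proof (rule differentiable_bound[of UNIV \<phi> "\<lambda>t h. h * (- 2 * pi * t * exp (- pi * t\<^sup>2))"])
    show "(\<phi> has_derivative (\<lambda>h. h * (- 2 * pi * t * exp (- pi * t\<^sup>2)))) (at t within UNIV)" for t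
      unfolding \<phi>_def by (auto intro!: derivative_eq_intros simp: algebra_simps)
    show "onorm (\<lambda>h. h * (- 2 * pi * t * exp (- pi * t\<^sup>2))) \<le> 2 * pi" for t
    proof (rule onorm_le)
      fix h :: real
      have "norm (h * (- 2 * pi * t * exp (- pi * t\<^sup>2))) = (2 * pi * \<bar>h\<bar>) * (\<bar>t\<bar> * exp (- pi * t\<^sup>2))"
        by (simp add: abs_mult)
      also have "\<dots> \<le> (2 * pi * \<bar>h\<bar>) * 1" by (intro mult_left_mono tb) simp
      finally show "norm (h * (- 2 * pi * t * exp (- pi * t\<^sup>2))) \<le> 2 * pi * norm h" by simp
    qed
  qed simp_all
  from this[of "norm x" "norm y"] have "\<bar>gauss x - gauss y\<bar> \<le> 2 * pi * \<bar>norm x - norm y\<bar>"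
    by (simp add: \<phi>_def gauss_def)
  also have "\<dots> \<le> 2 * pi * norm (x - y)" by (intro mult_left_mono norm_triangle_ineq3) simp
  finally show ?thesis .
qed

text \<open>The i-th bump has Lipschitz constant 2 pi r_i^(-(s + 1)), at most 2 pi r_j^(-(d + 1))
  for i <= j. Summing j + 1 of them costs one further factor 1 / r_j.\<close>

lemma kernel_partial_lipschitz:
  fixes x y :: "'a::euclidean_space"
  assumes m: "2 \<le> m" and s: "0 < s" "s < real DIM('a)"
  shows "\<bar>kernel_partial m s (Suc j) x - kernel_partial m s (Suc j) y\<bar>
    \<le> 2 * pi / scale m j ^ (DIM('a) + 2) * norm (x - y)"
proof -
  define r where "r = scale m j"
  have r: "0 < r" "r \<le> 1" by (auto simp: r_def scale_le_1)
  have "\<bar>bump m s i x - bump m s i y\<bar> \<le> 1 / r ^ (DIM('a) + 1) * (2 * pi * norm (x - y))" if i: "i < Suc j" for i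
  proof -
    have ri: "r \<le> scale m i" unfolding r_def using i m by (intro scale_antimono) auto
    have "\<bar>bump m s i x - bump m s i y\<bar> = scale m i powr (- s) * \<bar>gauss (x /\<^sub>R scale m i) - gauss (y /\<^sub>R scale m i)\<bar>"
      by (simp add: bump_def right_diff_distrib[symmetric] abs_mult)
    also have "\<dots> \<le> scale m i powr (- s) * (2 * pi * norm (x /\<^sub>R scale m i - y /\<^sub>R scale m i))"
      by (intro mult_left_mono gauss_lipschitz) simp
    also have "norm (x /\<^sub>R scale m i - y /\<^sub>R scale m i) = scale m i powr (- 1) * norm (x - y)"
      by (simp add: scaleR_diff_right[symmetric] powr_minus)
    also have "scale m i powr (- s) * (2 * pi * (scale m i powr (- 1) * norm (x - y)))
      = scale m i powr (- (s + 1)) * (2 * pi * norm (x - y))"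
      by (simp add: powr_add powr_minus divide_inverse powr_diff)
    also have "\<dots> \<le> 1 / r ^ (DIM('a) + 1) * (2 * pi * norm (x - y))"
    proof (intro mult_right_mono)
      have "scale m i powr (- (s + 1)) \<le> r powr (- (s + 1))"
        using ri r s by (intro powr_mono2') auto
      also have "\<dots> \<le> r powr (- real (DIM('a) + 1))"
        using r s by (intro powr_mono') auto
      also have "\<dots> = 1 / r ^ (DIM('a) + 1)"
        unfolding powr_minus powr_realpow[OF r(1)] by (simp add: inverse_eq_divide)
      finally show "scale m i powr (- (s + 1)) \<le> 1 / r ^ (DIM('a) + 1)" .
    qed simp
    finally show ?thesis .
  qed
  then have "(\<Sum>i<Suc j. \<bar>bump m s i x - bump m s i y\<bar>) \<le> real (card {..<Suc j}) * (1 / r ^ (DIM('a) + 1) * (2 * pi * norm (x - y)))"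
    by (intro sum_bounded_above) auto
  also have "\<dots> = real (Suc j) * (1 / r ^ (DIM('a) + 1) * (2 * pi * norm (x - y)))" by simp
  also have "\<dots> \<le> (1 / r) * (1 / r ^ (DIM('a) + 1) * (2 * pi * norm (x - y)))"
    using Suc_times_scale_le[OF m, of j] r
    by (intro mult_right_mono) (auto simp: r_def pos_le_divide_eq)
  also have "\<dots> = 2 * pi / r ^ (DIM('a) + 2) * norm (x - y)" by simp
  finally show ?thesis
    unfolding kernel_partial_def sum_subtractf[symmetric] r_def by (rule order_trans[OF sum_abs])
qed

lemma kernel_partial_nonneg [simp]: "0 \<le> kernel_partial m s j x"
  by (simp add: kernel_partial_def sum_nonneg)

lemma kernel_partial_minus [simp]: "kernel_partial m s j (- x) = kernel_partial m s j x"
  by (simp add: kernel_partial_def)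

lemma borel_measurable_kernel_partial [measurable]: "kernel_partial m s j \<in> borel_measurable borel"
  unfolding kernel_partial_def by measurable

lemma borel_measurable_kernel_tail [measurable]: "kernel_tail m s j \<in> borel_measurable borel"
  unfolding kernel_tail_def by measurable

lemma kernel_partial_bounded: "\<exists>B\<ge>0. \<forall>x. kernel_partial m s j x \<le> B"
proof (intro exI conjI allI)
  show "0 \<le> (\<Sum>i<j. scale m i powr (- s))" by (intro sum_nonneg) simp
  show "kernel_partial m s j x \<le> (\<Sum>i<j. scale m i powr (- s))" for x
    unfolding kernel_partial_def bump_def by (intro sum_mono mult_left_le) auto
qed

text \<open>With \<epsilon> = r_j^(d + 2) the partial sum has Lipschitz constant 2 pi / \<epsilon>,
  and the mollifier has first absolute moment \<epsilon> G, so mollifying the partial sum changes it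
  by at most 2 pi G. The tail is estimated by the supremum B / \<epsilon>^d of the mollifier times
  its own mass, which is O(\<epsilon>^d).\<close>

lemma mollified_kernel_approx:
  fixes \<rho> :: "'a::euclidean_space \<Rightarrow> complex"
  assumes \<rho>: "test_function \<rho>" "(LINT x|lborel. \<rho> x) = 1"
    and m: "2 \<le> m" and s: "0 < s" "s < real DIM('a)"
    and md: "real (DIM('a) * (DIM('a) + 2)) \<le> real m * (real DIM('a) - s)"
  shows "\<exists>C\<ge>0. \<forall>j x. norm (distr_convolution (kernel_distr m s) (mollifier \<rho> (scale m j ^ (DIM('a) + 2))) x
      - complex_of_real (kernel_partial m s (Suc j) x)) \<le> C"
proof -
  obtain B where B: "B \<ge> 0" "\<And>x. norm (\<rho> x) \<le> B" using test_function_bounded[OF \<rho>(1)] by auto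
  define \<delta> where "\<delta> = real DIM('a) - s"
  have \<delta>: "\<delta> > 0" using s by (simp add: \<delta>_def)
  define q where "q = (1 / 2 :: real) powr \<delta>"
  have q: "q < 1" using \<delta> by (simp add: q_def powr01_less_one)
  have Gi: "integrable lborel (\<lambda>z. norm z * norm (\<rho> z))"
    using integrable_norm[OF test_function_mult_integrable[OF \<rho>(1), of "\<lambda>z. complex_of_real (norm z)"]]
    by (simp add: norm_mult continuous_intros)
  define G where "G = (LINT z|lborel. norm z * norm (\<rho> z))"
  have G: "G \<ge> 0" unfolding G_def by (intro Bochner_Integration.integral_nonneg) auto
  have "norm (distr_convolution (kernel_distr m s) (mollifier \<rho> (scale m j ^ (DIM('a) + 2))) x
      - complex_of_real (kernel_partial m s (Suc j) x)) \<le> 2 * pi * G + B / (1 - q)" for j x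
  proof -
    define r where "r = scale m j"
    have r: "0 < r" "r \<le> 1" by (auto simp: r_def scale_le_1)
    define \<epsilon> where "\<epsilon> = r ^ (DIM('a) + 2)"
    have \<epsilon>: "\<epsilon> > 0" using r by (simp add: \<epsilon>_def)
    define \<phi> where "\<phi> = mollifier \<rho> \<epsilon>"
    have \<phi>: "test_function \<phi>" unfolding \<phi>_def by (rule test_function_mollifier[OF \<rho>(1) \<epsilon>])
    have \<phi>i: "integrable lborel \<phi>" by (rule test_function_integrable[OF \<phi>])
    have \<phi>m: "\<phi> \<in> borel_measurable borel" using smooth_measurable[OF test_function_smooth[OF \<phi>]] .
    have \<phi>x: "test_function (\<lambda>y. \<phi> (x - y))"
      using test_function_affine[OF \<phi>, of "- 1" 1 x] by simp
    have \<phi>xm: "(\<lambda>y. \<phi> (x - y)) \<in> borel_measurable borel" using smooth_measurable[OF test_function_smooth[OF \<phi>x]] .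
    have \<phi>B: "norm (\<phi> y) \<le> B / \<epsilon> ^ DIM('a)" for y
      using B(2)[of "y /\<^sub>R \<epsilon>"] \<epsilon> by (simp add: \<phi>_def mollifier_def norm_mult norm_divide norm_power divide_right_mono)
    define K where "K = (kernel_partial m s (Suc j) :: 'a \<Rightarrow> real)"
    define T where "T = (kernel_tail m s (Suc j) :: 'a \<Rightarrow> real)"
    have Ti: "integrable lborel T" unfolding T_def by (rule integrable_kernel_tail[OF m s(2)])
    have T0: "AE y in lborel. 0 \<le> T y"
      using AE_summable_bump[OF m s(2), of "Suc j"] unfolding T_def kernel_tail_def
      by eventually_elim (intro suminf_nonneg, auto)
    have Ki: "integrable lborel K" unfolding K_def kernel_partial_def
      by (intro Bochner_Integration.integrable_sum integrable_bump)
    have bd: "integrable lborel (\<lambda>y. complex_of_real (k y) * \<phi> (x - y))" if k: "integrable lborel k" for k :: "'a \<Rightarrow> real"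
    proof (rule Bochner_Integration.integrable_bound[OF integrable_mult_left[OF integrable_norm[OF k], of "B / \<epsilon> ^ DIM('a)"]])
      show "(\<lambda>y. complex_of_real (k y) * \<phi> (x - y)) \<in> borel_measurable lborel"
        using borel_measurable_integrable[OF k] \<phi>xm by simp
      show "AE y in lborel. norm (complex_of_real (k y) * \<phi> (x - y)) \<le> norm (norm (k y) * (B / \<epsilon> ^ DIM('a)))"
      proof (rule AE_I2)
        fix y
        have "\<bar>k y\<bar> * norm (\<phi> (x - y)) \<le> \<bar>k y\<bar> * (B / \<epsilon> ^ DIM('a))" by (intro mult_left_mono \<phi>B) simp
        then show "norm (complex_of_real (k y) * \<phi> (x - y)) \<le> norm (norm (k y) * (B / \<epsilon> ^ DIM('a)))"
          using B(1) \<epsilon> by (simp add: norm_mult abs_mult)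
      qed
    qed
    have "distr_convolution (kernel_distr m s) \<phi> x = (LINT y|lborel. complex_of_real (kernel_tail m s 0 y) * \<phi> (x - y))"
      by (simp add: distr_convolution_def kernel_distr_def)
    also have "\<dots> = (LINT y|lborel. complex_of_real (K y) * \<phi> (x - y) + complex_of_real (T y) * \<phi> (x - y))"
    proof (rule integral_cong_AE)
      show "AE y in lborel. complex_of_real (kernel_tail m s 0 y) * \<phi> (x - y)
          = complex_of_real (K y) * \<phi> (x - y) + complex_of_real (T y) * \<phi> (x - y)"
        using AE_summable_bump[OF m s(2), of 0]
      proof eventually_elim
        fix y :: 'a assume "summable (\<lambda>i. bump m s (i + 0) y)"
        then have "kernel_tail m s 0 y = T y + K y"
          unfolding kernel_tail_def T_def K_def kernel_partial_def
          using suminf_split_initial_segment[of "\<lambda>i. bump m s i y" "Suc j"] by simp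
        then show "complex_of_real (kernel_tail m s 0 y) * \<phi> (x - y)
          = complex_of_real (K y) * \<phi> (x - y) + complex_of_real (T y) * \<phi> (x - y)"
          by (simp add: algebra_simps)
      qed
    qed (use \<phi>xm in \<open>simp_all add: K_def T_def\<close>)
    also have "\<dots> = (LINT y|lborel. complex_of_real (K y) * \<phi> (x - y)) + (LINT y|lborel. complex_of_real (T y) * \<phi> (x - y))"
      by (intro Bochner_Integration.integral_add bd Ki Ti)
    also have "(LINT y|lborel. complex_of_real (K y) * \<phi> (x - y)) = (LINT z|lborel. complex_of_real (K (x - z)) * \<phi> z)"
      using integral_lborel_affine[OF _ bd[OF Ki], of "- 1" x] by simp
    finally have split: "distr_convolution (kernel_distr m s) \<phi> x
      = (LINT z|lborel. complex_of_real (K (x - z)) * \<phi> z) + (LINT y|lborel. complex_of_real (T y) * \<phi> (x - y))" .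
    have KLi: "integrable lborel (\<lambda>z. complex_of_real (K (x - z)) * \<phi> z)"
      using integrable_lborel_affine[OF _ bd[OF Ki], of "- 1" x] by simp
    have mass: "(LINT z|lborel. \<phi> z) = 1"
      using integral_mollifier[OF test_function_integrable[OF \<rho>(1)] \<epsilon>] \<rho>(2)
      by (simp add: \<phi>_def mollifier_def scaleR_conv_of_real)
    have zi: "integrable lborel (\<lambda>z. norm z * norm (\<phi> z))"
      using integrable_norm[OF test_function_mult_integrable[OF \<phi>, of "\<lambda>z. complex_of_real (norm z)"]]
      by (simp add: norm_mult continuous_intros)
    have zeq: "(LINT z|lborel. norm z * norm (\<phi> z)) = \<epsilon> * G"
    proof -
      have "norm z * norm (\<phi> z) = \<epsilon> * ((1 / \<epsilon> ^ DIM('a)) *\<^sub>R (norm (z /\<^sub>R \<epsilon>) * norm (\<rho> (z /\<^sub>R \<epsilon>))))" for z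
        using \<epsilon> by (simp add: \<phi>_def mollifier_def norm_mult norm_divide norm_power)
      then have "(LINT z|lborel. norm z * norm (\<phi> z)) = \<epsilon> * (LINT z|lborel. (1 / \<epsilon> ^ DIM('a)) *\<^sub>R (norm (z /\<^sub>R \<epsilon>) * norm (\<rho> (z /\<^sub>R \<epsilon>))))"
        by (simp only: integral_mult_right_zero)
      also have "\<dots> = \<epsilon> * G" unfolding G_def by (subst integral_mollifier[OF Gi \<epsilon>]) (rule refl)
      finally show ?thesis .
    qed
    have "(LINT z|lborel. complex_of_real (K (x - z)) * \<phi> z) - complex_of_real (K x)
        = (LINT z|lborel. complex_of_real (K (x - z)) * \<phi> z) - (LINT z|lborel. complex_of_real (K x) * \<phi> z)"
      using mass by simp
    also have "\<dots> = (LINT z|lborel. complex_of_real (K (x - z)) * \<phi> z - complex_of_real (K x) * \<phi> z)"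
      by (intro Bochner_Integration.integral_diff[symmetric] KLi integrable_mult_right \<phi>i)
    also have "norm \<dots> \<le> (LINT z|lborel. 2 * pi / \<epsilon> * (norm z * norm (\<phi> z)))"
    proof (rule order_trans[OF integral_norm_bound integral_mono])
      show "integrable lborel (\<lambda>z. norm (complex_of_real (K (x - z)) * \<phi> z - complex_of_real (K x) * \<phi> z))"
        by (intro integrable_norm Bochner_Integration.integrable_diff KLi integrable_mult_right \<phi>i)
      show "integrable lborel (\<lambda>z. 2 * pi / \<epsilon> * (norm z * norm (\<phi> z)))" using zi by simp
      fix z
      have "norm (complex_of_real (K (x - z)) * \<phi> z - complex_of_real (K x) * \<phi> z) = \<bar>K (x - z) - K x\<bar> * norm (\<phi> z)"
        by (simp only: left_diff_distrib[symmetric] of_real_diff[symmetric] norm_mult norm_of_real)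
      also have "\<dots> \<le> (2 * pi / \<epsilon> * norm z) * norm (\<phi> z)"
        using kernel_partial_lipschitz[OF m s, of j "x - z" x]
        by (intro mult_right_mono) (auto simp: K_def \<epsilon>_def r_def)
      finally show "norm (complex_of_real (K (x - z)) * \<phi> z - complex_of_real (K x) * \<phi> z) \<le> 2 * pi / \<epsilon> * (norm z * norm (\<phi> z))"
        by (simp only: mult.assoc)
    qed
    also have "\<dots> = 2 * pi * G"
      unfolding integral_mult_right_zero zeq using \<epsilon> by simp
    finally have e1: "norm ((LINT z|lborel. complex_of_real (K (x - z)) * \<phi> z) - complex_of_real (K x)) \<le> 2 * pi * G" .
    have "norm (LINT y|lborel. complex_of_real (T y) * \<phi> (x - y)) \<le> (LINT y|lborel. T y * (B / \<epsilon> ^ DIM('a)))"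
    proof (rule order_trans[OF integral_norm_bound integral_mono_AE])
      show "integrable lborel (\<lambda>y. norm (complex_of_real (T y) * \<phi> (x - y)))" by (intro integrable_norm bd Ti)
      show "integrable lborel (\<lambda>y. T y * (B / \<epsilon> ^ DIM('a)))" using Ti by simp
      show "AE y in lborel. norm (complex_of_real (T y) * \<phi> (x - y)) \<le> T y * (B / \<epsilon> ^ DIM('a))"
        using T0
      proof eventually_elim
        fix y assume "0 \<le> T y"
        then show "norm (complex_of_real (T y) * \<phi> (x - y)) \<le> T y * (B / \<epsilon> ^ DIM('a))"
          unfolding norm_mult norm_of_real by (simp only: abs_of_nonneg) (intro mult_left_mono \<phi>B)
      qed
    qed
    also have "\<dots> = (LINT y|lborel. T y) * (B / \<epsilon> ^ DIM('a))" by (rule integral_mult_left_zero)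
    also have "\<dots> \<le> (scale m (Suc j) powr \<delta> / (1 - q)) * (B / \<epsilon> ^ DIM('a))"
      using integral_kernel_tail_le[OF m s(2), of "Suc j"] B(1) \<epsilon>
      by (intro mult_right_mono) (auto simp: T_def \<delta>_def q_def)
    also have "\<dots> \<le> (\<epsilon> ^ DIM('a) / (1 - q)) * (B / \<epsilon> ^ DIM('a))"
    proof (intro mult_right_mono divide_right_mono)
      \<comment> \<open>Here the size of \<open>m\<close> enters: m (d - s) >= d (d + 2) makes the
        next scale to the power d - s at most \<epsilon>^d.\<close>
      have "scale m (Suc j) powr \<delta> = r powr (real m * \<delta>)"
        using r by (simp add: scale_Suc r_def powr_realpow[symmetric] powr_powr)
      also have "\<dots> \<le> r powr real (DIM('a) * (DIM('a) + 2))"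
        using r md by (intro powr_mono') (auto simp: \<delta>_def)
      also have "\<dots> = \<epsilon> ^ DIM('a)"
        unfolding powr_realpow[OF r(1)] \<epsilon>_def by (simp only: power_mult[symmetric] mult.commute)
      finally show "scale m (Suc j) powr \<delta> \<le> \<epsilon> ^ DIM('a)" .
    qed (use q B(1) \<epsilon> in auto)
    also have "\<dots> = B / (1 - q)" using \<epsilon> by simp
    finally have e2: "norm (LINT y|lborel. complex_of_real (T y) * \<phi> (x - y)) \<le> B / (1 - q)" .
    have "distr_convolution (kernel_distr m s) \<phi> x - complex_of_real (K x)
       = ((LINT z|lborel. complex_of_real (K (x - z)) * \<phi> z) - complex_of_real (K x)) + (LINT y|lborel. complex_of_real (T y) * \<phi> (x - y))"
      unfolding split by simp
    also have "norm \<dots> \<le> 2 * pi * G + B / (1 - q)"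
      by (rule order_trans[OF norm_triangle_ineq add_mono[OF e1 e2]])
    finally show ?thesis by (simp only: \<phi>_def \<epsilon>_def r_def K_def)
  qed
  moreover have "0 \<le> 2 * pi * G + B / (1 - q)" using G B(1) q by simp
  ultimately show ?thesis by (intro exI[of _ "2 * pi * G + B / (1 - q)"] conjI allI)
qed

lemma distr_convolution_kernel_measurable:
  fixes \<phi> :: "'a::euclidean_space \<Rightarrow> complex"
  assumes \<phi>: "\<phi> \<in> borel_measurable borel"
  shows "distr_convolution (kernel_distr m s) \<phi> \<in> borel_measurable borel"
proof -
  have "(\<lambda>p. \<phi> (fst p - snd p)) \<in> borel_measurable (borel \<Otimes>\<^sub>M borel)"
    by (rule measurable_compose[OF _ \<phi>]) measurable
  then have "(\<lambda>(x, y). complex_of_real (kernel_tail m s 0 y) * \<phi> (x - y)) \<in> borel_measurable (borel \<Otimes>\<^sub>M lborel)"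
    unfolding split_beta' measurable_cong_sets[OF sets_pair_measure_cong[OF refl sets_lborel] refl]
    by (intro borel_measurable_times) measurable
  then show ?thesis
    unfolding distr_convolution_def[abs_def] kernel_distr_def
    by (rule lborel.borel_measurable_lebesgue_integral)
qed

section \<open>Failure of uniform boundedness\<close>

text \<open>A uniform error C in the kernel changes the bilinear form by at most C times the product
  of the L1 norms. The bound on \<open>K\<close> ensures that all double integrals exist.\<close>

lemma double_integral_perturbation:
  fixes \<mu> \<nu> :: "'a::euclidean_space measure" and \<kappa> :: "'a \<Rightarrow> complex" and f g K :: "'a \<Rightarrow> real"
  assumes \<mu>: "prob_space \<mu>" "sets \<mu> = sets borel" and \<nu>: "prob_space \<nu>" "sets \<nu> = sets borel"
    and f: "integrable \<mu> f" "\<And>y. 0 \<le> f y" and g: "integrable \<nu> g" "\<And>x. 0 \<le> g x"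
    and \<kappa>: "\<kappa> \<in> borel_measurable borel" and K: "K \<in> borel_measurable borel" "\<And>x. \<bar>K x\<bar> \<le> B"
    and close: "\<And>x. norm (\<kappa> x - complex_of_real (K x)) \<le> C"
  shows "(LINT x|\<nu>. g x * (LINT y|\<mu>. K (x - y) * f y)) - C * ((LINT y|\<mu>. f y) * (LINT x|\<nu>. g x))
    \<le> norm (LINT x|\<nu>. complex_of_real (g x) * (LINT y|\<mu>. \<kappa> (x - y) * complex_of_real (f y)))"
proof -
  interpret M: prob_space \<mu> by fact
  interpret N: prob_space \<nu> by fact
  define I where "I = (LINT y|\<mu>. f y)"
  have I0: "I \<ge> 0" unfolding I_def using f by (intro Bochner_Integration.integral_nonneg)
  have \<kappa>B: "norm (\<kappa> x) \<le> B + C" for x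
    using norm_triangle_ineq[of "\<kappa> x - complex_of_real (K x)" "complex_of_real (K x)"] close[of x] K(2)[of x] by simp
  have diff_m: "(\<lambda>p. fst p - snd p) \<in> measurable (\<nu> \<Otimes>\<^sub>M \<mu>) borel"
    unfolding measurable_cong_sets[OF sets_pair_measure_cong[OF \<nu>(2) \<mu>(2)] refl] by measurable
  have cf: "(\<lambda>y. complex_of_real (f y)) \<in> borel_measurable \<mu>"
    by (rule borel_measurable_integrable[OF integrable_of_real[OF f(1)]])
  have cg: "(\<lambda>x. complex_of_real (g x)) \<in> borel_measurable \<nu>"
    by (rule borel_measurable_integrable[OF integrable_of_real[OF g(1)]])
  have fm: "(\<lambda>p. complex_of_real (f (snd p))) \<in> borel_measurable (\<nu> \<Otimes>\<^sub>M \<mu>)"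
    by (rule measurable_compose[OF measurable_snd cf])
  have Tm: "(\<lambda>x. LINT y|\<mu>. k (x - y) * complex_of_real (f y)) \<in> borel_measurable \<nu>"
    if k: "k \<in> borel_measurable borel" for k :: "'a \<Rightarrow> complex"
  proof (rule M.borel_measurable_lebesgue_integral)
    show "(\<lambda>(x, y). k (x - y) * complex_of_real (f y)) \<in> borel_measurable (\<nu> \<Otimes>\<^sub>M \<mu>)"
      unfolding split_beta' using measurable_compose[OF diff_m k] fm
      by (rule borel_measurable_times)
  qed
  have minus_m: "(\<lambda>y. x - y) \<in> measurable \<mu> borel" for x
    unfolding measurable_cong_sets[OF \<mu>(2) refl] by measurable
  have ki: "integrable \<mu> (\<lambda>y. k (x - y) * complex_of_real (f y))"
    if k: "k \<in> borel_measurable borel" "\<And>x. norm (k x) \<le> D" for k :: "'a \<Rightarrow> complex" and x D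
  proof (rule Bochner_Integration.integrable_bound[OF integrable_mult_right[OF f(1), of D]])
    show "(\<lambda>y. k (x - y) * complex_of_real (f y)) \<in> borel_measurable \<mu>"
      using measurable_compose[OF minus_m k(1)] cf by (rule borel_measurable_times)
    show "AE y in \<mu>. norm (k (x - y) * complex_of_real (f y)) \<le> norm (D * f y)"
    proof (rule AE_I2)
      fix y
      have "norm (k (x - y)) * f y \<le> D * f y" by (intro mult_right_mono k f)
      also have "\<dots> \<le> norm (D * f y)" by simp
      finally show "norm (k (x - y) * complex_of_real (f y)) \<le> norm (D * f y)" using f(2)[of y] by (simp add: norm_mult)
    qed
  qed
  have kle: "norm (LINT y|\<mu>. k (x - y) * complex_of_real (f y)) \<le> D * I"
    if k: "k \<in> borel_measurable borel" "\<And>x. norm (k x) \<le> D" for k :: "'a \<Rightarrow> complex" and x D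
  proof -
    have "norm (LINT y|\<mu>. k (x - y) * complex_of_real (f y)) \<le> (LINT y|\<mu>. D * f y)"
    proof (rule order_trans[OF integral_norm_bound integral_mono])
      show "integrable \<mu> (\<lambda>y. norm (k (x - y) * complex_of_real (f y)))" by (rule integrable_norm[OF ki[OF k]])
      show "integrable \<mu> (\<lambda>y. D * f y)" using f(1) by simp
      show "norm (k (x - y) * complex_of_real (f y)) \<le> D * f y" for y
        using mult_right_mono[OF k(2)[of "x - y"] f(2)[of y]] f(2)[of y] by (simp add: norm_mult)
    qed
    then show ?thesis by (simp add: I_def)
  qed
  have oi: "integrable \<nu> (\<lambda>x. complex_of_real (g x) * (LINT y|\<mu>. k (x - y) * complex_of_real (f y)))"
    if k: "k \<in> borel_measurable borel" "\<And>x. norm (k x) \<le> D" for k :: "'a \<Rightarrow> complex" and D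
  proof (rule Bochner_Integration.integrable_bound[OF integrable_mult_left[OF g(1), of "D * I"]])
    show "(\<lambda>x. complex_of_real (g x) * (LINT y|\<mu>. k (x - y) * complex_of_real (f y))) \<in> borel_measurable \<nu>"
      using cg Tm[OF k(1)] by (rule borel_measurable_times)
    show "AE x in \<nu>. norm (complex_of_real (g x) * (LINT y|\<mu>. k (x - y) * complex_of_real (f y))) \<le> norm (g x * (D * I))"
    proof (rule AE_I2)
      fix x
      have "g x * norm (LINT y|\<mu>. k (x - y) * complex_of_real (f y)) \<le> g x * (D * I)" by (intro mult_left_mono kle[OF k] g)
      also have "\<dots> \<le> norm (g x * (D * I))" by simp
      finally show "norm (complex_of_real (g x) * (LINT y|\<mu>. k (x - y) * complex_of_real (f y))) \<le> norm (g x * (D * I))"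
        using g(2)[of x] by (simp only: norm_mult norm_of_real abs_of_nonneg)
    qed
  qed
  define K' where "K' = (\<lambda>x. complex_of_real (K x))"
  have K': "K' \<in> borel_measurable borel" "\<And>x. norm (K' x) \<le> B" using K by (auto simp: K'_def)
  have \<kappa>K: "(\<lambda>x. \<kappa> x - K' x) \<in> borel_measurable borel" "\<And>x. norm (\<kappa> x - K' x) \<le> C"
    using \<kappa> K'(1) close by (auto simp: K'_def)
  define S1 where "S1 = (LINT x|\<nu>. complex_of_real (g x) * (LINT y|\<mu>. \<kappa> (x - y) * complex_of_real (f y)))"
  define S2 where "S2 = (LINT x|\<nu>. complex_of_real (g x) * (LINT y|\<mu>. K' (x - y) * complex_of_real (f y)))"
  have S2: "S2 = complex_of_real (LINT x|\<nu>. g x * (LINT y|\<mu>. K (x - y) * f y))"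
    unfolding S2_def K'_def of_real_mult[symmetric] integral_complex_of_real ..
  have "S1 - S2 = (LINT x|\<nu>. complex_of_real (g x) * (LINT y|\<mu>. (\<kappa> (x - y) - K' (x - y)) * complex_of_real (f y)))"
  proof -
    have "S1 - S2 = (LINT x|\<nu>. complex_of_real (g x) * (LINT y|\<mu>. \<kappa> (x - y) * complex_of_real (f y))
        - complex_of_real (g x) * (LINT y|\<mu>. K' (x - y) * complex_of_real (f y)))"
      unfolding S1_def S2_def by (rule Bochner_Integration.integral_diff[symmetric]) (rule oi[OF \<kappa> \<kappa>B] oi[OF K'])+
    also have "\<dots> = (LINT x|\<nu>. complex_of_real (g x) * (LINT y|\<mu>. (\<kappa> (x - y) - K' (x - y)) * complex_of_real (f y)))"
      unfolding right_diff_distrib[symmetric] left_diff_distrib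
      by (subst Bochner_Integration.integral_diff[OF ki[OF \<kappa> \<kappa>B] ki[OF K']]) (rule refl)
    finally show ?thesis .
  qed
  also have "norm \<dots> \<le> (LINT x|\<nu>. g x * (C * I))"
  proof (rule order_trans[OF integral_norm_bound integral_mono])
    show "integrable \<nu> (\<lambda>x. norm (complex_of_real (g x) * (LINT y|\<mu>. (\<kappa> (x - y) - K' (x - y)) * complex_of_real (f y))))"
      by (intro integrable_norm oi[OF \<kappa>K])
    show "integrable \<nu> (\<lambda>x. g x * (C * I))" using g(1) by simp
    show "norm (complex_of_real (g x) * (LINT y|\<mu>. (\<kappa> (x - y) - K' (x - y)) * complex_of_real (f y))) \<le> g x * (C * I)" for x
      using mult_left_mono[OF kle[OF \<kappa>K, of x] g(2)[of x]] g(2)[of x] by (simp add: norm_mult)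
  qed
  finally have "norm (S1 - S2) \<le> C * (I * (LINT x|\<nu>. g x))" by (simp add: mult_ac)
  moreover have "norm S2 \<le> norm S1 + norm (S1 - S2)"
    using norm_triangle_ineq4[of S1 "S1 - S2"] by simp
  moreover have "(LINT x|\<nu>. g x * (LINT y|\<mu>. K (x - y) * f y)) \<le> norm S2" unfolding S2 by simp
  ultimately show ?thesis unfolding S1_def I_def by linarith
qed

text \<open>Cauchy-Schwarz in additive form; the weight \<open>t\<close> will balance a factor of
  bounded norm against one whose square norm grows like j.\<close>

lemma L2_pairing_le:
  fixes T g :: "'a \<Rightarrow> _"
  assumes T: "in_L2 \<nu> T" and g: "g \<in> borel_measurable \<nu>" "integrable \<nu> (\<lambda>x. (g x)\<^sup>2)"
    and t: "t > 0"
  shows "norm (LINT x|\<nu>. complex_of_real (g x) * T x) \<le> (t * (norm_L2 \<nu> T)\<^sup>2 + (LINT x|\<nu>. (g x)\<^sup>2) / t) / 2"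
proof -
  have T2: "integrable \<nu> (\<lambda>x. (norm (T x))\<^sup>2)" using T by (simp add: in_L2_def)
  have "norm (LINT x|\<nu>. complex_of_real (g x) * T x) \<le> (LINT x|\<nu>. (t * (norm (T x))\<^sup>2 + (g x)\<^sup>2 / t) / 2)"
  proof (rule order_trans[OF integral_norm_bound integral_mono_AE'])
    show "integrable \<nu> (\<lambda>x. (t * (norm (T x))\<^sup>2 + (g x)\<^sup>2 / t) / 2)" using T2 g(2) by simp
    show "AE x in \<nu>. norm (complex_of_real (g x) * T x) \<le> (t * (norm (T x))\<^sup>2 + (g x)\<^sup>2 / t) / 2"
    proof (rule AE_I2)
      fix x
      have "0 \<le> (t * norm (T x) - \<bar>g x\<bar>)\<^sup>2 / t" using t by simp
      also have "\<dots> = t * (norm (T x))\<^sup>2 + (g x)\<^sup>2 / t - 2 * (\<bar>g x\<bar> * norm (T x))"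
        using t by (simp add: power2_diff field_simps power2_eq_square)
      finally show "norm (complex_of_real (g x) * T x) \<le> (t * (norm (T x))\<^sup>2 + (g x)\<^sup>2 / t) / 2"
        by (simp add: norm_mult)
    qed
    show "AE x in \<nu>. 0 \<le> (t * (norm (T x))\<^sup>2 + (g x)\<^sup>2 / t) / 2" using t by simp
  qed
  also have "\<dots> = (t * (norm_L2 \<nu> T)\<^sup>2 + (LINT x|\<nu>. (g x)\<^sup>2) / t) / 2"
    using T2 g(2) by (simp add: norm_L2_square)
  finally show ?thesis .
qed

text \<open>At \<epsilon> = r_j^(d + 2) a uniform bound A would limit the form with the mollified
  kernel, and hence by \<open>mollified_kernel_approx\<close> the one with the partial sum, to a
  multiple of sqrt(j + 1). The test functions force it to be at least c (j + 1). The weight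
  \<open>t\<close> in the hypothesis leaves open which of the two functions is the large
  one.\<close>

lemma not_uniformly_L2_bounded:
  fixes \<rho> :: "'a::euclidean_space \<Rightarrow> complex" and \<mu> \<nu> :: "'a measure"
  assumes \<rho>: "test_function \<rho>" "(LINT x|lborel. \<rho> x) = 1"
    and m: "2 \<le> m" and s: "0 < s" "s < real DIM('a)"
    and md: "real (DIM('a) * (DIM('a) + 2)) \<le> real m * (real DIM('a) - s)"
    and \<mu>: "prob_space \<mu>" "sets \<mu> = sets borel" and \<nu>: "prob_space \<nu>" "sets \<nu> = sets borel"
    and c: "c > 0"
    and test: "\<And>j. \<exists>f g t. t > 0 \<and> f \<in> borel_measurable borel \<and> g \<in> borel_measurable borel \<and>
      (\<forall>x. 0 \<le> f x) \<and> (\<forall>x. 0 \<le> g x) \<and>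
      integrable \<mu> (\<lambda>x. (f x)\<^sup>2) \<and> integrable \<nu> (\<lambda>x. (g x)\<^sup>2) \<and>
      t * (LINT x|\<mu>. (f x)\<^sup>2) \<le> C * sqrt (real (Suc j)) \<and> (LINT x|\<nu>. (g x)\<^sup>2) / t \<le> C * sqrt (real (Suc j)) \<and>
      c * real (Suc j) \<le> (LINT x|\<nu>. g x * (LINT y|\<mu>. kernel_partial m s (Suc j) (x - y) * f y))"
  shows "\<not> uniformly_L2_bounded (kernel_distr m s) \<rho> \<mu> \<nu>"
proof
  interpret M: prob_space \<mu> by fact
  interpret N: prob_space \<nu> by fact
  assume "uniformly_L2_bounded (kernel_distr m s) \<rho> \<mu> \<nu>"
  then obtain A where A: "\<And>\<epsilon> f. \<epsilon> > 0 \<Longrightarrow> in_L2 \<mu> f \<Longrightarrow>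
        in_L2 \<nu> (T_op (distr_convolution (kernel_distr m s) (mollifier \<rho> \<epsilon>)) \<mu> f) \<and>
        norm_L2 \<nu> (T_op (distr_convolution (kernel_distr m s) (mollifier \<rho> \<epsilon>)) \<mu> f) \<le> A * norm_L2 \<mu> f"
    unfolding uniformly_L2_bounded_def by auto
  obtain C0 where C0: "C0 \<ge> 0" "\<And>j x. norm (distr_convolution (kernel_distr m s) (mollifier \<rho> (scale m j ^ (DIM('a) + 2))) x
      - complex_of_real (kernel_partial m s (Suc j) x)) \<le> C0"
    using mollified_kernel_approx[OF \<rho> m s md] by auto
  \<comment> \<open>The first part comes from the assumed bound \<open>A\<close>, the second from
    replacing the mollified kernel by the partial sum.\<close>
  define D where "D = (A\<^sup>2 * C + C) / 2 + C0 * C"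
  have main: "c * real (Suc j) \<le> D * sqrt (real (Suc j))" for j
  proof -
    define n where "n = sqrt (real (Suc j))"
    obtain f g t where t: "t > 0" and fm: "f \<in> borel_measurable borel" and gm: "g \<in> borel_measurable borel"
      and f0: "\<And>x. 0 \<le> f x" and g0: "\<And>x. 0 \<le> g x"
      and f2: "integrable \<mu> (\<lambda>x. (f x)\<^sup>2)" and g2: "integrable \<nu> (\<lambda>x. (g x)\<^sup>2)"
      and fC: "t * (LINT x|\<mu>. (f x)\<^sup>2) \<le> C * n" and gC: "(LINT x|\<nu>. (g x)\<^sup>2) / t \<le> C * n"
      and low: "c * real (Suc j) \<le> (LINT x|\<nu>. g x * (LINT y|\<mu>. kernel_partial m s (Suc j) (x - y) * f y))"
      using test[of j] unfolding n_def by auto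
    have fm': "f \<in> borel_measurable \<mu>" and gm': "g \<in> borel_measurable \<nu>"
      using fm gm unfolding measurable_cong_sets[OF \<mu>(2) refl] measurable_cong_sets[OF \<nu>(2) refl] .
    define \<epsilon> where "\<epsilon> = scale m j ^ (DIM('a) + 2)"
    have \<epsilon>: "\<epsilon> > 0" by (simp add: \<epsilon>_def)
    define \<kappa> where "\<kappa> = distr_convolution (kernel_distr m s) (mollifier \<rho> \<epsilon>)"
    have \<kappa>m: "\<kappa> \<in> borel_measurable borel"
      unfolding \<kappa>_def by (intro distr_convolution_kernel_measurable smooth_measurable test_function_smooth test_function_mollifier \<rho> \<epsilon>)
    define f' where "f' = (\<lambda>x. complex_of_real (f x))"
    have f': "in_L2 \<mu> f'" using fm' f2 by (simp add: in_L2_def f'_def)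
    have Nf: "(norm_L2 \<mu> f')\<^sup>2 = (LINT x|\<mu>. (f x)\<^sup>2)" by (simp add: norm_L2_square f'_def)
    have g': "in_L2 \<nu> (\<lambda>x. complex_of_real (g x))" using gm' g2 by (simp add: in_L2_def)
    have fi: "integrable \<mu> f"
      using integrable_Re[OF in_L2_integrable[OF M.finite_measure_axioms f']] by (simp add: f'_def)
    have gi: "integrable \<nu> g"
      using integrable_Re[OF in_L2_integrable[OF N.finite_measure_axioms g']] by simp
    define T where "T = T_op \<kappa> \<mu> f'"
    have T: "in_L2 \<nu> T" "norm_L2 \<nu> T \<le> A * norm_L2 \<mu> f'"
      using A[OF \<epsilon> f'] by (auto simp: T_def \<kappa>_def)
    have "(norm_L2 \<nu> T)\<^sup>2 \<le> (A * norm_L2 \<mu> f')\<^sup>2" by (rule power_mono[OF T(2)]) simp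
    then have T2: "(norm_L2 \<nu> T)\<^sup>2 \<le> A\<^sup>2 * (LINT x|\<mu>. (f x)\<^sup>2)" by (simp add: power_mult_distrib Nf)
    obtain B where B: "\<And>x::'a. kernel_partial m s (Suc j) x \<le> B" using kernel_partial_bounded by blast
    have "(LINT x|\<nu>. g x * (LINT y|\<mu>. kernel_partial m s (Suc j) (x - y) * f y)) - C0 * ((LINT y|\<mu>. f y) * (LINT x|\<nu>. g x))
      \<le> norm (LINT x|\<nu>. complex_of_real (g x) * (LINT y|\<mu>. \<kappa> (x - y) * complex_of_real (f y)))"
      by (rule double_integral_perturbation[OF \<mu> \<nu> fi f0 gi g0 \<kappa>m borel_measurable_kernel_partial, of _ _ _ B])
         (use C0(2)[of j] B in \<open>auto simp: \<kappa>_def \<epsilon>_def\<close>)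
    also have "\<dots> = norm (LINT x|\<nu>. complex_of_real (g x) * T x)" by (simp only: T_def T_op_def f'_def)
    also have "\<dots> \<le> (t * (norm_L2 \<nu> T)\<^sup>2 + (LINT x|\<nu>. (g x)\<^sup>2) / t) / 2"
      by (rule L2_pairing_le[OF T(1) gm' g2 t])
    also have "\<dots> \<le> (A\<^sup>2 * (C * n) + C * n) / 2"
    proof (intro divide_right_mono add_mono gC)
      have "t * (norm_L2 \<nu> T)\<^sup>2 \<le> t * (A\<^sup>2 * (LINT x|\<mu>. (f x)\<^sup>2))" using t by (intro mult_left_mono T2) simp
      also have "\<dots> = A\<^sup>2 * (t * (LINT x|\<mu>. (f x)\<^sup>2))" by simp
      also have "\<dots> \<le> A\<^sup>2 * (C * n)" by (intro mult_left_mono fC) simp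
      finally show "t * (norm_L2 \<nu> T)\<^sup>2 \<le> A\<^sup>2 * (C * n)" .
    qed simp
    finally have 1: "c * real (Suc j) - C0 * ((LINT y|\<mu>. f y) * (LINT x|\<nu>. g x)) \<le> (A\<^sup>2 * (C * n) + C * n) / 2"
      using low by linarith
    \<comment> \<open>On probability spaces L1 norms are at most L2 norms, so the perturbation costs
      only O(sqrt(j + 1)), less than the growth of the form.\<close>
    have "(LINT y|\<mu>. f y) * (LINT x|\<nu>. g x) \<le> C * n"
    proof -
      define p where "p = (LINT y|\<mu>. f y)"
      define q where "q = (LINT x|\<nu>. g x)"
      have "p\<^sup>2 \<le> (LINT x|\<mu>. (f x)\<^sup>2)" "q\<^sup>2 \<le> (LINT x|\<nu>. (g x)\<^sup>2)"
        using square_integral_le[OF M.finite_measure_axioms fi f2] square_integral_le[OF N.finite_measure_axioms gi g2]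
        by (simp_all add: p_def q_def M.prob_space N.prob_space)
      then have "t * p\<^sup>2 \<le> t * (LINT x|\<mu>. (f x)\<^sup>2)" "q\<^sup>2 / t \<le> (LINT x|\<nu>. (g x)\<^sup>2) / t"
        using t by (simp_all add: divide_right_mono)
      then have "t * p\<^sup>2 \<le> C * n" "q\<^sup>2 / t \<le> C * n"
        using fC gC by linarith+
      moreover have "0 \<le> (t * p - q)\<^sup>2 / t" using t by simp
      moreover have "(t * p - q)\<^sup>2 / t = t * p\<^sup>2 + q\<^sup>2 / t - 2 * (p * q)"
        using t by (simp add: power2_diff field_simps power2_eq_square)
      ultimately show ?thesis unfolding p_def[symmetric] q_def[symmetric] by linarith
    qed
    from mult_left_mono[OF this C0(1)] 1 have "c * real (Suc j) \<le> (A\<^sup>2 * (C * n) + C * n) / 2 + C0 * (C * n)"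
      by linarith
    also have "\<dots> = D * n" by (simp add: D_def field_simps)
    finally show ?thesis unfolding n_def .
  qed
  have sq: "c * sqrt (real (Suc j)) \<le> D" for j
  proof -
    have "sqrt (real (Suc j)) > 0" by simp
    moreover have "c * sqrt (real (Suc j)) * sqrt (real (Suc j)) \<le> D * sqrt (real (Suc j))"
      using main[of j] by (simp add: mult.assoc)
    ultimately show ?thesis by (simp only: mult_le_cancel_right)
  qed
  obtain j :: nat where j: "(D / c)\<^sup>2 < real j" using reals_Archimedean2 by blast
  have "\<bar>D / c\<bar>\<^sup>2 < real (Suc j)" unfolding power2_abs of_nat_Suc using j by linarith
  then have "\<bar>D / c\<bar> < sqrt (real (Suc j))" by (rule real_less_rsqrt)
  then have "D < c * sqrt (real (Suc j))" using c by (simp add: pos_divide_less_eq mult.commute abs_less_iff)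
  with sq[of j] show False by simp
qed

text \<open>In F^2 the i-th weight is the inverse of the mass bound for the i-th neighbourhood, so
  every scale adds at most C to the square norm. Near a point of E the i-th bump, paired with the
  i-th part of F on a ball of radius d r_i, yields a constant independent of i.\<close>

lemma fractal_test_function:
  fixes M N :: "'a::euclidean_space measure" and E :: "'a set"
  assumes M: "prob_space M" "sets M = sets borel" and N: "prob_space N" "sets N = sets borel"
    and s: "s = (u + t) / 2"
    and AE: "\<And>P. {x. P x} \<in> sets borel \<Longrightarrow> (\<And>x. x \<in> E \<Longrightarrow> P x) \<Longrightarrow> AE x in N. P x"
    and low: "\<And>x n. x \<in> E \<Longrightarrow> c * (1 / 2 ^ n) powr u \<le> measure M (cball x (real DIM('a) / 2 ^ n))"
    and cover: "\<And>n. \<exists>S \<in> sets borel. measure M S \<le> C * (1 / 2 ^ n) powr (u - t) \<and>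
      (\<forall>x\<in>E. cball x (real DIM('a) / 2 ^ n) \<subseteq> S)"
  shows "\<exists>F. F \<in> borel_measurable borel \<and> (\<forall>x. 0 \<le> F x) \<and> integrable M F \<and>
    integrable M (\<lambda>x. (F x)\<^sup>2) \<and> (LINT x|M. (F x)\<^sup>2) \<le> C * real (Suc j) \<and>
    c * exp (- pi * (real DIM('a))\<^sup>2) * real (Suc j)
      \<le> (LINT x|N. (LINT y|M. kernel_partial m s (Suc j) (x - y) * F y))"
proof -
  interpret M: prob_space M by fact
  interpret N: prob_space N by fact
  define d where "d = real DIM('a)"
  define r where "r = scale m"
  have r: "r i > 0" "r i = 1 / 2 ^ (m ^ i)" for i by (simp_all add: r_def scale_def)
  have "\<forall>i. \<exists>S. S \<in> sets borel \<and> measure M S \<le> C * r i powr (u - t) \<and> (\<forall>x\<in>E. cball x (d * r i) \<subseteq> S)"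
    using cover[of "m ^ i" for i] unfolding r(2) d_def by (simp add: Bex_def)
  from choice[OF this] obtain S where "\<forall>i. S i \<in> sets borel \<and> measure M (S i) \<le> C * r i powr (u - t) \<and> (\<forall>x\<in>E. cball x (d * r i) \<subseteq> S i)"
    by (elim exE) (rule that)
  then have S: "S i \<in> sets borel" "measure M (S i) \<le> C * r i powr (u - t)" and sub: "x \<in> E \<Longrightarrow> cball x (d * r i) \<subseteq> S i" for i x
    by auto
  have SM: "S i \<in> M.events" for i using S(1) M(2) by simp
  \<comment> \<open>Inverse to the bound for the measure of \<open>S i\<close>, up to the constant
    C.\<close>
  define w where "w = (\<lambda>i. r i powr (- (u - t)))"
  have w: "w i \<ge> 0" for i by (simp add: w_def)
  define Q where "Q = (\<lambda>y. \<Sum>i<Suc j. w i * indicator (S i) y)"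
  have Q0: "Q y \<ge> 0" for y unfolding Q_def by (intro sum_nonneg mult_nonneg_nonneg w) simp
  \<comment> \<open>The square root makes the square norm additive over the scales, while F still
    dominates the root of each single summand.\<close>
  define F where "F = (\<lambda>y. sqrt (Q y))"
  have F0: "F y \<ge> 0" for y using Q0 by (simp add: F_def)
  have F2: "(F y)\<^sup>2 = Q y" for y using Q0 by (simp add: F_def)
  have Qm: "Q \<in> borel_measurable borel" unfolding Q_def
    using S(1) by (intro borel_measurable_sum borel_measurable_times borel_measurable_const borel_measurable_indicator)
  then have Fm: "F \<in> borel_measurable borel" unfolding F_def by measurable
  have Qi: "integrable M Q"
    unfolding Q_def using SM by (intro Bochner_Integration.integrable_sum integrable_mult_right integrable_real_indicator) (auto simp: M.emeasure_eq_measure)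
  have "(LINT x|M. Q x) = (\<Sum>i<Suc j. w i * measure M (S i))"
    unfolding Q_def using SM by (subst Bochner_Integration.integral_sum) (auto simp: M.emeasure_eq_measure)
  also have "\<dots> \<le> real (card {..<Suc j}) * C"
  proof (rule sum_bounded_above)
    fix i
    have "w i * measure M (S i) \<le> w i * (C * r i powr (u - t))" by (intro mult_left_mono S w)
    also have "\<dots> = C * (w i * r i powr (u - t))" by (simp only: mult.left_commute)
    also have "w i * r i powr (u - t) = 1" using r(1)[of i] unfolding w_def by (simp add: powr_add[symmetric])
    finally show "w i * measure M (S i) \<le> C" by simp
  qed
  finally have QC: "(LINT x|M. (F x)\<^sup>2) \<le> C * real (Suc j)" by (simp add: F2 mult.commute)
  have fin: "in_L2 M (\<lambda>x. complex_of_real (F x))"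
    using Fm Qi by (simp add: in_L2_def F2 measurable_cong_sets[OF M(2) refl])
  have Fi: "integrable M F"
    using integrable_Re[OF in_L2_integrable[OF M.finite_measure_axioms fin]] by simp
  define K where "K = (kernel_partial m s (Suc j) :: 'a \<Rightarrow> real)"
  obtain B where B: "B \<ge> 0" "\<And>x. K x \<le> B" using kernel_partial_bounded unfolding K_def by blast
  have K0: "K x \<ge> 0" for x by (simp add: K_def)
  have Km: "K \<in> borel_measurable borel" unfolding K_def by simp
  have KFi: "integrable M (\<lambda>y. K (x - y) * F y)" for x
  proof (rule Bochner_Integration.integrable_bound[OF integrable_mult_right[OF Fi, of B]])
    have "(\<lambda>y. x - y) \<in> measurable M borel" unfolding measurable_cong_sets[OF M(2) refl] by measurable
    from measurable_compose[OF this Km] show "(\<lambda>y. K (x - y) * F y) \<in> borel_measurable M"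
      using borel_measurable_integrable[OF Fi] by (rule borel_measurable_times)
    show "AE y in M. norm (K (x - y) * F y) \<le> norm (B * F y)"
      using B K0 F0 by (intro AE_I2) (simp add: abs_mult mult_right_mono)
  qed
  define \<Phi> where "\<Phi> = (\<lambda>x. LINT y|M. K (x - y) * F y)"
  have \<Phi>m: "\<Phi> \<in> borel_measurable borel"
    unfolding \<Phi>_def
  proof (rule M.borel_measurable_lebesgue_integral)
    have "(\<lambda>p. fst p - snd p) \<in> measurable (borel \<Otimes>\<^sub>M M) borel"
      unfolding measurable_cong_sets[OF sets_pair_measure_cong[OF refl M(2)] refl] by measurable
    from borel_measurable_times[OF measurable_compose[OF this Km] measurable_compose[OF measurable_snd borel_measurable_integrable[OF Fi]]]
    show "(\<lambda>(x, y). K (x - y) * F y) \<in> borel_measurable (borel \<Otimes>\<^sub>M M)"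
      unfolding split_beta' .
  qed
  have \<Phi>B: "\<bar>\<Phi> x\<bar> \<le> B * (LINT y|M. F y)" for x
  proof -
    have "0 \<le> \<Phi> x" unfolding \<Phi>_def using K0 F0 by (intro Bochner_Integration.integral_nonneg mult_nonneg_nonneg)
    moreover have "\<Phi> x \<le> (LINT y|M. B * F y)"
      unfolding \<Phi>_def using KFi Fi B F0 by (intro integral_mono integrable_mult_right mult_right_mono)
    ultimately show ?thesis by simp
  qed
  have \<Phi>i: "integrable N \<Phi>"
  proof (rule N.integrable_const_bound)
    show "AE x in N. norm (\<Phi> x) \<le> B * (LINT y|M. F y)" using \<Phi>B by simp
    show "\<Phi> \<in> borel_measurable N" unfolding measurable_cong_sets[OF N(2) refl] by (rule \<Phi>m)
  qed
  \<comment> \<open>The value of the Gaussian at distance d, hence a lower bound for the rescaled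
    i-th bump on the ball of radius d r_i.\<close>
  define e where "e = exp (- pi * d\<^sup>2)"
  have \<Phi>low: "c * e * real (Suc j) \<le> \<Phi> x" if x: "x \<in> E" for x
  proof -
    have ball: "cball x (d * r i) \<in> M.events" for i using M(2) by simp
    have ind: "integrable M (\<lambda>y. \<Sum>i<Suc j. (e * r i powr (- u)) * indicator (cball x (d * r i)) y)"
      using ball by (intro Bochner_Integration.integrable_sum integrable_mult_right integrable_real_indicator) (auto simp: M.emeasure_eq_measure)
    have "c * e * real (Suc j) = (\<Sum>i<Suc j. c * e)" by simp
    also have "\<dots> \<le> (\<Sum>i<Suc j. (e * r i powr (- u)) * measure M (cball x (d * r i)))"
    proof (rule sum_mono)
      fix i
      have "c * e = (e * r i powr (- u)) * (c * r i powr u)"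
        using r(1)[of i] by (simp add: powr_minus)
      also have "\<dots> \<le> (e * r i powr (- u)) * measure M (cball x (d * r i))"
        using low[OF x, of "m ^ i"] by (intro mult_left_mono) (auto simp: r(2) d_def e_def)
      finally show "c * e \<le> (e * r i powr (- u)) * measure M (cball x (d * r i))" .
    qed
    also have "\<dots> = (LINT y|M. (\<Sum>i<Suc j. (e * r i powr (- u)) * indicator (cball x (d * r i)) y))"
      using ball by (subst Bochner_Integration.integral_sum) (auto simp: M.emeasure_eq_measure)
    also have "\<dots> \<le> \<Phi> x"
      unfolding \<Phi>_def
    proof (rule integral_mono[OF ind KFi])
      fix y
      \<comment> \<open>Only diagonal pairs are kept: against the i-th bump, F is bounded below by
        its i-th summand alone. The exponents -s and -(u - t) / 2 add up to -u, which the mass of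
        the ball compensates.\<close>
      have "(\<Sum>i<Suc j. (e * r i powr (- u)) * indicator (cball x (d * r i)) y) \<le> (\<Sum>i<Suc j. bump m s i (x - y) * F y)"
      proof (rule sum_mono)
        fix i assume i: "i \<in> {..<Suc j}"
        show "(e * r i powr (- u)) * indicator (cball x (d * r i)) y \<le> bump m s i (x - y) * F y"
        proof (cases "y \<in> cball x (d * r i)")
          case True
          then have "norm (x - y) / r i \<le> d" using r(1)[of i] by (simp add: dist_norm pos_divide_le_eq)
          then have "(norm (x - y) / r i)\<^sup>2 \<le> d\<^sup>2" using r(1)[of i] by (intro power_mono) auto
          then have "e \<le> gauss ((x - y) /\<^sub>R r i)"
            using r(1)[of i] by (simp add: e_def gauss_def divide_inverse mult.commute)
          then have 1: "r i powr (- s) * e \<le> bump m s i (x - y)"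
            unfolding bump_def r_def by (intro mult_left_mono) auto
          have "w i * 1 \<le> Q y"
          proof -
            have "y \<in> S i" using sub[OF x, of i] True by auto
            then have "w i * 1 = w i * indicator (S i) y" by simp
            also have "\<dots> \<le> Q y" unfolding Q_def
              by (rule member_le_sum[OF i]) (auto intro: mult_nonneg_nonneg w)
            finally show ?thesis .
          qed
          then have "sqrt (w i) \<le> F y" unfolding F_def by (intro real_sqrt_le_mono) simp
          moreover have "sqrt (w i) = r i powr (- (u - t) / 2)"
            using r(1)[of i] by (simp add: w_def powr_half_sqrt_powr[symmetric] powr_powr powr_half_sqrt[symmetric])
          ultimately have 2: "r i powr (- (u - t) / 2) \<le> F y" by simp
          have "- u = - s + - (u - t) / 2" by (simp add: s field_simps)
          then have "e * r i powr (- u) = (r i powr (- s) * e) * r i powr (- (u - t) / 2)"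
            by (simp only: powr_add mult_ac)
          also have "\<dots> \<le> bump m s i (x - y) * F y"
            by (intro mult_mono 1 2) auto
          finally show ?thesis using True by simp
        qed (use F0 in simp)
      qed
      also have "\<dots> = K (x - y) * F y" unfolding K_def kernel_partial_def by (rule sum_distrib_right[symmetric])
      finally show "(\<Sum>i<Suc j. (e * r i powr (- u)) * indicator (cball x (d * r i)) y) \<le> K (x - y) * F y" .
    qed
    finally show ?thesis .
  qed
  have "AE x in N. c * e * real (Suc j) \<le> \<Phi> x"
  proof (rule AE)
    show "{x. c * e * real (Suc j) \<le> \<Phi> x} \<in> sets borel" using \<Phi>m by measurable
  qed (rule \<Phi>low)
  then have "(LINT x|N. c * e * real (Suc j)) \<le> (LINT x|N. \<Phi> x)"
    by (intro integral_mono_AE \<Phi>i) simp_all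
  then have "c * e * real (Suc j) \<le> (LINT x|N. \<Phi> x)" by (simp add: N.prob_space)
  then show ?thesis
    unfolding \<Phi>_def K_def e_def d_def
    by (intro exI[of _ F] conjI allI Fm F0 Fi QC) (use Qi in \<open>simp_all only: F2\<close>)
qed

text \<open>The two exponents may come in either order, whereas the test function lives on the
  measure of larger dimension; the two orders are transposes of each other because the kernel is
  even.\<close>

lemma exists_not_uniformly_L2_bounded:
  fixes \<rho> :: "'a::euclidean_space \<Rightarrow> complex"
  assumes \<rho>: "test_function \<rho>" "(LINT x|lborel. \<rho> x) = 1"
    and s\<^sub>\<mu>: "0 < s\<^sub>\<mu>" "s\<^sub>\<mu> \<le> real DIM('a)" and s\<^sub>\<nu>: "0 < s\<^sub>\<nu>" "s\<^sub>\<nu> \<le> real DIM('a)"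
    and s: "s = (s\<^sub>\<mu> + s\<^sub>\<nu>) / 2" "s < real DIM('a)" and \<alpha>: "0 \<le> \<alpha>" "\<alpha> \<le> real DIM('a) - s"
  shows "\<exists>\<Lambda> \<mu> \<nu>. admissible \<Lambda> \<mu> \<nu> \<alpha> s\<^sub>\<mu> s\<^sub>\<nu> \<and> \<not> uniformly_L2_bounded \<Lambda> \<rho> \<mu> \<nu>"
proof -
  have s0: "0 < s" using s s\<^sub>\<mu> s\<^sub>\<nu> by simp
  \<comment> \<open>The quotient achieves m (d - s) >= d (d + 2), as
    \<open>mollified_kernel_approx\<close> demands; the summand 2 makes the scales at least
    halve.\<close>
  define m where "m = nat \<lceil>real (DIM('a) * (DIM('a) + 2)) / (real DIM('a) - s)\<rceil> + 2"
  have m: "2 \<le> m" by (simp add: m_def)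
  have "real (DIM('a) * (DIM('a) + 2)) / (real DIM('a) - s) \<le> real m"
    unfolding m_def of_nat_add by (rule order_trans[OF real_nat_ceiling_ge]) simp
  then have md: "real (DIM('a) * (DIM('a) + 2)) \<le> real m * (real DIM('a) - s)"
    using s(2) by (simp add: pos_divide_le_eq)
  define u where "u = max s\<^sub>\<mu> s\<^sub>\<nu>"
  define t where "t = min s\<^sub>\<mu> s\<^sub>\<nu>"
  have ut: "0 < t" "t \<le> u" "u \<le> real DIM('a)" "s = (u + t) / 2"
    using s\<^sub>\<mu> s\<^sub>\<nu> s(1) by (auto simp: u_def t_def)
  show ?thesis
  proof (rule fractal_pair[OF ut(1,2,3)])
    fix M N :: "'a measure" and E :: "'a set" and c C :: real
    assume MN: "prob_space M" "prob_space N" and comp: "compactly_supported_borel_measure M" "compactly_supported_borel_measure N"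
      and growth: "growth_condition M u" "growth_condition N t" and c: "c > 0" and C: "C > 0"
      and E: "\<And>P. {x. P x} \<in> sets borel \<Longrightarrow> (\<And>x. x \<in> E \<Longrightarrow> P x) \<Longrightarrow> AE x in N. P x"
      and low: "\<And>x n. x \<in> E \<Longrightarrow> c * (1 / 2 ^ n) powr u \<le> measure M (cball x (real DIM('a) / 2 ^ n))"
      and cover: "\<And>n. \<exists>S \<in> sets borel. measure M S \<le> C * (1 / 2 ^ n) powr (u - t) \<and>
        (\<forall>x\<in>E. cball x (real DIM('a) / 2 ^ n) \<subseteq> S)"
    have sets: "sets M = sets borel" "sets N = sets borel"
      using comp by (auto simp: compactly_supported_borel_measure_def)
    interpret M: prob_space M by fact
    interpret N: prob_space N by fact
    define c' where "c' = c * exp (- pi * (real DIM('a))\<^sup>2)"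
    have c': "c' > 0" using c by (simp add: c'_def)
    define C' where "C' = max C 1"
    have ex: "\<exists>F. F \<in> borel_measurable borel \<and> (\<forall>x. 0 \<le> F x) \<and> integrable M F \<and>
      integrable M (\<lambda>x. (F x)\<^sup>2) \<and> (LINT x|M. (F x)\<^sup>2) \<le> C * real (Suc j) \<and>
      c' * real (Suc j) \<le> (LINT x|N. (LINT y|M. kernel_partial m s (Suc j) (x - y) * F y))" for j
      unfolding c'_def by (rule fractal_test_function[OF MN(1) sets(1) MN(2) sets(2) ut(4) E low cover])
    define \<Lambda> where "\<Lambda> = (kernel_distr m s :: ('a \<Rightarrow> complex) \<Rightarrow> complex)"
    have \<Lambda>: "tempered_distribution \<Lambda>" "fourier_decay \<Lambda> \<alpha>"
      unfolding \<Lambda>_def by (rule tempered_kernel_distr[OF m s0 s(2) \<alpha>] fourier_decay_kernel_distr[OF m s0 s(2) \<alpha>])+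
    have bounds: "a / sqrt (real (Suc j)) \<le> C' * sqrt (real (Suc j))" if "a \<le> C * real (Suc j)" for a j
    proof -
      have "a \<le> C' * real (Suc j)" using that by (rule order_trans) (auto simp: C'_def intro: mult_right_mono)
      also have "\<dots> = C' * sqrt (real (Suc j)) * sqrt (real (Suc j))" by (simp add: mult.assoc)
      finally show ?thesis by (simp add: pos_divide_le_eq)
    qed
    have one: "sqrt (real (Suc j)) \<le> C' * sqrt (real (Suc j))" for j
      using mult_right_mono[of 1 C' "sqrt (real (Suc j))"] by (simp add: C'_def)
    show ?thesis
    \<comment> \<open>F goes with the measure of larger dimension and the constant 1 with the other.
      The weight is 1 / sqrt(j + 1) if F is the input and sqrt(j + 1) if it is the dual function, so
      that both weighted square norms are O(sqrt(j + 1)).\<close>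
    proof (cases "s\<^sub>\<nu> \<le> s\<^sub>\<mu>")
      case True
      then have "u = s\<^sub>\<mu>" "t = s\<^sub>\<nu>" by (auto simp: u_def t_def)
      then have adm: "admissible \<Lambda> M N \<alpha> s\<^sub>\<mu> s\<^sub>\<nu>"
        using \<Lambda> comp growth by (simp add: admissible_def)
      have "\<not> uniformly_L2_bounded \<Lambda> \<rho> M N"
        unfolding \<Lambda>_def
      proof (rule not_uniformly_L2_bounded[OF \<rho> m s0 s(2) md MN(1) sets(1) MN(2) sets(2) c', where C = C'])
        fix j
        obtain F where F: "F \<in> borel_measurable borel" "\<And>x. 0 \<le> F x" "integrable M F"
          "integrable M (\<lambda>x. (F x)\<^sup>2)" "(LINT x|M. (F x)\<^sup>2) \<le> C * real (Suc j)"
          "c' * real (Suc j) \<le> (LINT x|N. (LINT y|M. kernel_partial m s (Suc j) (x - y) * F y))"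
          using ex[of j] by (elim exE conjE) (rule that, auto)
        show "\<exists>f g t. t > 0 \<and> f \<in> borel_measurable borel \<and> g \<in> borel_measurable borel \<and>
          (\<forall>x. 0 \<le> f x) \<and> (\<forall>x. 0 \<le> g x) \<and> integrable M (\<lambda>x. (f x)\<^sup>2) \<and> integrable N (\<lambda>x. (g x)\<^sup>2) \<and>
          t * (LINT x|M. (f x)\<^sup>2) \<le> C' * sqrt (real (Suc j)) \<and> (LINT x|N. (g x)\<^sup>2) / t \<le> C' * sqrt (real (Suc j)) \<and>
          c' * real (Suc j) \<le> (LINT x|N. g x * (LINT y|M. kernel_partial m s (Suc j) (x - y) * f y))"
        proof (rule exI[of _ F], rule exI[of _ "\<lambda>_. 1"], rule exI[of _ "1 / sqrt (real (Suc j))"], intro conjI allI F(1,2,4))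
          show "1 / sqrt (real (Suc j)) * (LINT x|M. (F x)\<^sup>2) \<le> C' * sqrt (real (Suc j))"
            using bounds[OF F(5)] by simp
          show "(LINT x|N. 1\<^sup>2) / (1 / sqrt (real (Suc j))) \<le> C' * sqrt (real (Suc j))"
            using one[of j] by (simp add: N.prob_space)
          show "c' * real (Suc j) \<le> (LINT x|N. 1 * (LINT y|M. kernel_partial m s (Suc j) (x - y) * F y))"
            using F(6) by simp
        qed simp_all
      qed
      with adm show ?thesis by blast
    next
      case False
      then have "t = s\<^sub>\<mu>" "u = s\<^sub>\<nu>" by (auto simp: u_def t_def)
      then have adm: "admissible \<Lambda> N M \<alpha> s\<^sub>\<mu> s\<^sub>\<nu>"
        using \<Lambda> comp growth by (simp add: admissible_def)
      have "\<not> uniformly_L2_bounded \<Lambda> \<rho> N M"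
        unfolding \<Lambda>_def
      proof (rule not_uniformly_L2_bounded[OF \<rho> m s0 s(2) md MN(2) sets(2) MN(1) sets(1) c', where C = C'])
        fix j
        obtain F where F: "F \<in> borel_measurable borel" "\<And>x. 0 \<le> F x" "integrable M F"
          "integrable M (\<lambda>x. (F x)\<^sup>2)" "(LINT x|M. (F x)\<^sup>2) \<le> C * real (Suc j)"
          "c' * real (Suc j) \<le> (LINT x|N. (LINT y|M. kernel_partial m s (Suc j) (x - y) * F y))"
          using ex[of j] by (elim exE conjE) (rule that, auto)
        define K where "K = (kernel_partial m s (Suc j) :: 'a \<Rightarrow> real)"
        obtain B where B: "B \<ge> 0" "\<And>x. K x \<le> B" using kernel_partial_bounded unfolding K_def by blast
        have Keven: "K (x - y) = K (y - x)" for x y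
          using kernel_partial_minus[of m s "Suc j" "x - y"] by (simp add: K_def)
        \<comment> \<open>The lower bound integrates F first, but here F is the dual function and is
          integrated last. Fubini and the evenness of the kernel exchange the roles.\<close>
        have swap: "(LINT x|M. F x * (LINT y|N. K (x - y) * 1)) = (LINT y|N. 1 * (LINT x|M. K (x - y) * F x))"
        proof (rule integral_swap_bounded[OF M.sigma_finite_measure_axioms N.sigma_finite_measure_axioms F(3), where B = B])
          have "(\<lambda>p. fst p - snd p) \<in> measurable (M \<Otimes>\<^sub>M N) borel"
            unfolding measurable_cong_sets[OF sets_pair_measure_cong[OF sets] refl] by measurable
          then show "(\<lambda>(x, y). K (x - y)) \<in> borel_measurable (M \<Otimes>\<^sub>M N)"
            unfolding split_beta' K_def by (rule measurable_compose) simp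
          show "norm (K (x - y)) \<le> B" for x y using B by (simp add: K_def)
        qed simp
        show "\<exists>f g t. t > 0 \<and> f \<in> borel_measurable borel \<and> g \<in> borel_measurable borel \<and>
          (\<forall>x. 0 \<le> f x) \<and> (\<forall>x. 0 \<le> g x) \<and> integrable N (\<lambda>x. (f x)\<^sup>2) \<and> integrable M (\<lambda>x. (g x)\<^sup>2) \<and>
          t * (LINT x|N. (f x)\<^sup>2) \<le> C' * sqrt (real (Suc j)) \<and> (LINT x|M. (g x)\<^sup>2) / t \<le> C' * sqrt (real (Suc j)) \<and>
          c' * real (Suc j) \<le> (LINT x|M. g x * (LINT y|N. kernel_partial m s (Suc j) (x - y) * f y))"
        proof (rule exI[of _ "\<lambda>_. 1"], rule exI[of _ F], rule exI[of _ "sqrt (real (Suc j))"], intro conjI allI F(1,2,4) bounds[OF F(5)])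
          show "sqrt (real (Suc j)) * (LINT x|N. 1\<^sup>2) \<le> C' * sqrt (real (Suc j))"
            using one[of j] by (simp add: N.prob_space)
          have "(LINT x|M. F x * (LINT y|N. K (x - y) * 1)) = (LINT x|N. (LINT y|M. K (x - y) * F y))"
            unfolding swap mult_1_left
            by (intro Bochner_Integration.integral_cong refl arg_cong2[where f = "(*)"] Keven)
          then show "c' * real (Suc j) \<le> (LINT x|M. F x * (LINT y|N. kernel_partial m s (Suc j) (x - y) * 1))"
            using F(6) unfolding K_def by simp
        qed simp_all
      qed
      with adm show ?thesis by blast
    qed
  qed
qed

text \<open>Part (ii) is claimed for s < d. If s = d, then both exponents equal d and \<alpha> = 0:
  the measures have bounded densities, the multiplier is bounded uniformly in \<epsilon>, and
  Plancherel's theorem gives the uniform bound, so no counterexample exists. "In general" is read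
  as: for every admissible choice of exponents and mollifier there are a distribution and measures
  for which the uniform bound fails.\<close>

theorem theorem2p1:
  fixes \<rho> :: "'a::euclidean_space \<Rightarrow> complex"
    and \<alpha> s\<^sub>\<mu> s\<^sub>\<nu> s :: real
  assumes "test_function \<rho>"
    and "(LINT x|lborel. \<rho> x) = 1"
    and "0 \<le> \<alpha>" and "\<alpha> < real DIM('a) / 2"
    and "0 < s\<^sub>\<mu>" and "s\<^sub>\<mu> \<le> real DIM('a)"
    and "0 < s\<^sub>\<nu>" and "s\<^sub>\<nu> \<le> real DIM('a)"
    and "s = (s\<^sub>\<mu> + s\<^sub>\<nu>) / 2"
  shows "(\<alpha> > real DIM('a) - s \<longrightarrow>
            (\<forall>\<Lambda> \<mu> \<nu>. admissible \<Lambda> \<mu> \<nu> \<alpha> s\<^sub>\<mu> s\<^sub>\<nu> \<longrightarrow> uniformly_L2_bounded \<Lambda> \<rho> \<mu> \<nu>)) \<and>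
         (\<alpha> \<le> real DIM('a) - s \<and> s < real DIM('a) \<longrightarrow>
            (\<exists>\<Lambda> \<mu> \<nu>. admissible \<Lambda> \<mu> \<nu> \<alpha> s\<^sub>\<mu> s\<^sub>\<nu> \<and> \<not> uniformly_L2_bounded \<Lambda> \<rho> \<mu> \<nu>))"
proof (intro conjI impI allI)
  fix \<Lambda> :: "('a \<Rightarrow> complex) \<Rightarrow> complex" and \<mu> \<nu> :: "'a measure"
  assume "\<alpha> > real DIM('a) - s" "admissible \<Lambda> \<mu> \<nu> \<alpha> s\<^sub>\<mu> s\<^sub>\<nu>"
  then show "uniformly_L2_bounded \<Lambda> \<rho> \<mu> \<nu>"
    using assms(9) by (intro uniformly_L2_bounded_of_decay[OF assms(1,5-8)]) simp_all
next
  assume "\<alpha> \<le> real DIM('a) - s \<and> s < real DIM('a)"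
  then show "\<exists>\<Lambda> \<mu> \<nu>. admissible \<Lambda> \<mu> \<nu> \<alpha> s\<^sub>\<mu> s\<^sub>\<nu> \<and> \<not> uniformly_L2_bounded \<Lambda> \<rho> \<mu> \<nu>"
    by (intro exists_not_uniformly_L2_bounded[OF assms(1,2,5-9) _ assms(3)]) simp_all
qed

end
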